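(* Let $\mathfrak N$ be a nilpotent Lie algebra that can be written as a direct sum of ideals $\mathfrak N=\mathfrak N_1\oplus\mathfrak N_2$. Then $\mathfrak N$ is an Einstein nilradical if and only if both $\mathfrak N_1$ and $\mathfrak N_2$ are Einstein nilradicals.
   Context: Lie algebras here are finite-dimensional and real. A left-invariant Ricci soliton metric on a nilpotent Lie group is called a nilsoliton. A simply connected nilpotent Lie group $N$, or equivalently its Lie algebra $\mathfrak N$, is called an Einstein nilradical if $N$ admits a nilsoliton, i.e. a left-invariant Riemannian metric that is a Ricci soliton. *)

theory Defs
  imports "HOL-Analysis.Analysis" "HOL-Algebra.Group"
begin

text \<open>
  A finite-dimensional real Lie algebra is a linear subspace \<open>L\<close> of some Euclidean space together
  with a bracket. Working with subspaces rather than types lets a Lie algebra and its ideals be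
  treated uniformly and admits the zero Lie algebra. The inner product of the ambient space is
  never used; only its linear structure and topology are.
\<close>

definition lie_algebra_on :: "'a::euclidean_space set \<Rightarrow> ('a \<Rightarrow> 'a \<Rightarrow> 'a) \<Rightarrow> bool" where
  "lie_algebra_on L br \<longleftrightarrow>
     subspace L \<and>
     (\<forall>x\<in>L. \<forall>y\<in>L. br x y \<in> L) \<and>
     (\<forall>x\<in>L. \<forall>y\<in>L. \<forall>z\<in>L. \<forall>a b. br (a *\<^sub>R x + b *\<^sub>R y) z = a *\<^sub>R br x z + b *\<^sub>R br y z) \<and>
     (\<forall>x\<in>L. \<forall>y\<in>L. \<forall>z\<in>L. \<forall>a b. br z (a *\<^sub>R x + b *\<^sub>R y) = a *\<^sub>R br z x + b *\<^sub>R br z y) \<and>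
     (\<forall>x\<in>L. br x x = 0) \<and>
     (\<forall>x\<in>L. \<forall>y\<in>L. \<forall>z\<in>L. br x (br y z) + br y (br z x) + br z (br x y) = 0)"

definition lie_ideal :: "'a::euclidean_space set \<Rightarrow> ('a \<Rightarrow> 'a \<Rightarrow> 'a) \<Rightarrow> 'a set \<Rightarrow> bool" where
  "lie_ideal L br I \<longleftrightarrow> subspace I \<and> I \<subseteq> L \<and> (\<forall>x\<in>L. \<forall>y\<in>I. br x y \<in> I)"

primrec lower_central_series ::
  "'a::euclidean_space set \<Rightarrow> ('a \<Rightarrow> 'a \<Rightarrow> 'a) \<Rightarrow> nat \<Rightarrow> 'a set" where
  "lower_central_series L br 0 = L"
| "lower_central_series L br (Suc k) = span {br x y | x y. x \<in> L \<and> y \<in> lower_central_series L br k}"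

definition nilpotent_lie_algebra_on :: "'a::euclidean_space set \<Rightarrow> ('a \<Rightarrow> 'a \<Rightarrow> 'a) \<Rightarrow> bool" where
  "nilpotent_lie_algebra_on L br \<longleftrightarrow>
     lie_algebra_on L br \<and> (\<exists>k. lower_central_series L br k = {0})"

definition direct_sum_of_ideals ::
  "'a::euclidean_space set \<Rightarrow> ('a \<Rightarrow> 'a \<Rightarrow> 'a) \<Rightarrow> 'a set \<Rightarrow> 'a set \<Rightarrow> bool" where
  "direct_sum_of_ideals L br I J \<longleftrightarrow>
     lie_ideal L br I \<and> lie_ideal L br J \<and> L = {x + y | x y. x \<in> I \<and> y \<in> J} \<and> I \<inter> J = {0}"


section \<open>Calculus on a linear subspace\<close>

text \<open>
  The derivative of \<open>f\<close> at \<open>x\<close> in direction \<open>v\<close>. For \<open>x\<close> and \<open>v\<close> in a subspace it depends only on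
  the restriction of \<open>f\<close> to that subspace. For smooth \<open>f\<close> it is the differential of \<open>f\<close> at \<open>x\<close>
  applied to \<open>v\<close>.
\<close>

definition dir_deriv ::
  "('a::real_normed_vector \<Rightarrow> 'b::real_normed_vector) \<Rightarrow> 'a \<Rightarrow> 'a \<Rightarrow> 'b" where
  "dir_deriv f x v = vector_derivative (\<lambda>t. f (x + t *\<^sub>R v)) (at 0)"

text \<open>
  In finite dimensions a function is \<open>C\<^sup>k\<close> iff all its iterated directional derivatives up to
  order \<open>k\<close> exist and are continuous.
\<close>

primrec Ck_on :: "nat \<Rightarrow> 'a::real_normed_vector set \<Rightarrow> ('a \<Rightarrow> 'b::real_normed_vector) \<Rightarrow> bool" where
  "Ck_on 0 S f = continuous_on S f"
| "Ck_on (Suc k) S f =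
     (continuous_on S f \<and>
      (\<forall>v\<in>S. (\<forall>x\<in>S. (\<lambda>t. f (x + t *\<^sub>R v)) differentiable (at (0::real))) \<and>
             Ck_on k S (\<lambda>x. dir_deriv f x v)))"

definition smooth_on :: "'a::real_normed_vector set \<Rightarrow> ('a \<Rightarrow> 'b::real_normed_vector) \<Rightarrow> bool" where
  "smooth_on S f \<longleftrightarrow> (\<forall>k. Ck_on k S f)"

text \<open>Vector fields on the manifold \<open>L\<close> are maps \<open>L \<Rightarrow> L\<close>: every tangent space is identified with \<open>L\<close>.\<close>

definition vector_field_on :: "'a::euclidean_space set \<Rightarrow> ('a \<Rightarrow> 'a) \<Rightarrow> bool" where
  "vector_field_on L X \<longleftrightarrow> smooth_on L X \<and> X ` L \<subseteq> L"

definition vf_bracket :: "('a::euclidean_space \<Rightarrow> 'a) \<Rightarrow> ('a \<Rightarrow> 'a) \<Rightarrow> 'a \<Rightarrow> 'a" where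
  "vf_bracket X Y x = dir_deriv Y x (X x) - dir_deriv X x (Y x)"


section \<open>Simply connected Lie groups with underlying manifold a vector space\<close>

text \<open>
  A Lie group structure on the manifold \<open>L\<close>. Such a group is simply connected, its underlying
  manifold being a vector space. Conversely the exponential map of a simply connected nilpotent Lie
  group is a diffeomorphism, so up to isomorphism every such group is of this form, with the
  manifold being its Lie algebra. The identity of the group need not be \<open>0\<close>.
\<close>

definition lie_group_on :: "'a::euclidean_space set \<Rightarrow> 'a monoid \<Rightarrow> bool" where
  "lie_group_on L G \<longleftrightarrow>
     subspace L \<and> group G \<and> carrier G = L \<and>
     smooth_on (L \<times> L) (\<lambda>(x, y). x \<otimes>\<^bsub>G\<^esub> y) \<and>
     smooth_on L (\<lambda>x. inv\<^bsub>G\<^esub> x)"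

text \<open>The differential at \<open>x\<close> of left translation by \<open>a\<close>.\<close>

definition left_translation_deriv :: "'a::euclidean_space monoid \<Rightarrow> 'a \<Rightarrow> 'a \<Rightarrow> 'a \<Rightarrow> 'a" where
  "left_translation_deriv G a x v = dir_deriv (\<lambda>y. a \<otimes>\<^bsub>G\<^esub> y) x v"

definition left_inv_field :: "'a::euclidean_space monoid \<Rightarrow> 'a \<Rightarrow> 'a \<Rightarrow> 'a" where
  "left_inv_field G u x = left_translation_deriv G x \<one>\<^bsub>G\<^esub> u"

text \<open>
  The Lie algebra of \<open>G\<close>, i.e. the tangent space \<open>L\<close> at the identity with the bracket of
  left-invariant vector fields, is \<open>(L, br)\<close>. Asking for equality rather than an isomorphism is no
  restriction: transport the group structure along a linear automorphism of \<open>L\<close>.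
\<close>

definition has_lie_algebra ::
  "'a::euclidean_space monoid \<Rightarrow> 'a set \<Rightarrow> ('a \<Rightarrow> 'a \<Rightarrow> 'a) \<Rightarrow> bool" where
  "has_lie_algebra G L br \<longleftrightarrow>
     (\<forall>u\<in>L. \<forall>v\<in>L. vf_bracket (left_inv_field G u) (left_inv_field G v) \<one>\<^bsub>G\<^esub> = br u v)"


section \<open>Riemannian metrics, Ricci curvature and Ricci solitons\<close>

text \<open>\<open>g x u v\<close> is the inner product of the tangent vectors \<open>u\<close> and \<open>v\<close> at the point \<open>x\<close>.\<close>

definition riemannian_metric_on ::
  "'a::euclidean_space set \<Rightarrow> ('a \<Rightarrow> 'a \<Rightarrow> 'a \<Rightarrow> real) \<Rightarrow> bool" where
  "riemannian_metric_on L g \<longleftrightarrow>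
     (\<forall>u\<in>L. \<forall>v\<in>L. smooth_on L (\<lambda>x. g x u v)) \<and>
     (\<forall>x\<in>L. \<forall>u\<in>L. \<forall>v\<in>L. g x u v = g x v u) \<and>
     (\<forall>x\<in>L. \<forall>u\<in>L. \<forall>v\<in>L. \<forall>w\<in>L. \<forall>a b.
        g x (a *\<^sub>R u + b *\<^sub>R v) w = a * g x u w + b * g x v w) \<and>
     (\<forall>x\<in>L. \<forall>u\<in>L. u \<noteq> 0 \<longrightarrow> g x u u > 0)"

definition left_invariant_metric_on ::
  "'a::euclidean_space set \<Rightarrow> 'a monoid \<Rightarrow> ('a \<Rightarrow> 'a \<Rightarrow> 'a \<Rightarrow> real) \<Rightarrow> bool" where
  "left_invariant_metric_on L G g \<longleftrightarrow>
     riemannian_metric_on L g \<and>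
     (\<forall>a\<in>L. \<forall>x\<in>L. \<forall>u\<in>L. \<forall>v\<in>L.
        g (a \<otimes>\<^bsub>G\<^esub> x) (left_translation_deriv G a x u) (left_translation_deriv G a x v) = g x u v)"

text \<open>
  The Christoffel symbol in the global linear chart: the value at \<open>x\<close> of the Levi-Civita derivative
  of the constant field \<open>v\<close> along the constant field \<open>u\<close> (Koszul formula; constant fields commute).
\<close>

definition christoffel ::
  "'a::euclidean_space set \<Rightarrow> ('a \<Rightarrow> 'a \<Rightarrow> 'a \<Rightarrow> real) \<Rightarrow> 'a \<Rightarrow> 'a \<Rightarrow> 'a \<Rightarrow> 'a" where
  "christoffel L g x u v =
     (THE z. z \<in> L \<and>
        (\<forall>w\<in>L. g x z w =
           (dir_deriv (\<lambda>y. g y v w) x u + dir_deriv (\<lambda>y. g y u w) x v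
            - dir_deriv (\<lambda>y. g y u v) x w) / 2))"

definition levi_civita ::
  "'a::euclidean_space set \<Rightarrow> ('a \<Rightarrow> 'a \<Rightarrow> 'a \<Rightarrow> real) \<Rightarrow> ('a \<Rightarrow> 'a) \<Rightarrow> ('a \<Rightarrow> 'a) \<Rightarrow> 'a \<Rightarrow> 'a" where
  "levi_civita L g X Y x = dir_deriv Y x (X x) + christoffel L g x (X x) (Y x)"

text \<open>
  \<open>R(u, v)w\<close> at \<open>x\<close>, computed by extending \<open>u\<close>, \<open>v\<close>, \<open>w\<close> to constant fields; the term involving
  the bracket of the extensions of \<open>u\<close> and \<open>v\<close> vanishes.
\<close>

definition riemann_curvature ::
  "'a::euclidean_space set \<Rightarrow> ('a \<Rightarrow> 'a \<Rightarrow> 'a \<Rightarrow> real) \<Rightarrow> 'a \<Rightarrow> 'a \<Rightarrow> 'a \<Rightarrow> 'a \<Rightarrow> 'a" where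
  "riemann_curvature L g x u v w =
     levi_civita L g (\<lambda>_. u) (levi_civita L g (\<lambda>_. v) (\<lambda>_. w)) x
     - levi_civita L g (\<lambda>_. v) (levi_civita L g (\<lambda>_. u) (\<lambda>_. w)) x"

text \<open>The trace of a linear endomorphism of \<open>L\<close>, computed in an arbitrary basis of \<open>L\<close>.\<close>

definition trace_on :: "'a::euclidean_space set \<Rightarrow> ('a \<Rightarrow> 'a) \<Rightarrow> real" where
  "trace_on L A =
     (let B = (SOME B. B \<subseteq> L \<and> independent B \<and> span B = L)
      in \<Sum>b\<in>B. real_vector.representation B (A b) b)"

definition ricci_curvature ::
  "'a::euclidean_space set \<Rightarrow> ('a \<Rightarrow> 'a \<Rightarrow> 'a \<Rightarrow> real) \<Rightarrow> 'a \<Rightarrow> 'a \<Rightarrow> 'a \<Rightarrow> real" where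
  "ricci_curvature L g x v w = trace_on L (\<lambda>u. riemann_curvature L g x u v w)"

text \<open>
  The Lie derivative of \<open>g\<close> along \<open>X\<close>, evaluated on the constant fields \<open>u\<close> and \<open>v\<close>; the bracket
  of \<open>X\<close> with the constant field \<open>u\<close> is minus the derivative of \<open>X\<close> in direction \<open>u\<close>.
\<close>

definition lie_derivative_metric ::
  "('a::euclidean_space \<Rightarrow> 'a) \<Rightarrow> ('a \<Rightarrow> 'a \<Rightarrow> 'a \<Rightarrow> real) \<Rightarrow> 'a \<Rightarrow> 'a \<Rightarrow> 'a \<Rightarrow> real" where
  "lie_derivative_metric X g x u v =
     dir_deriv (\<lambda>y. g y u v) x (X x) + g x (dir_deriv X x u) v + g x u (dir_deriv X x v)"

definition ricci_soliton_on ::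
  "'a::euclidean_space set \<Rightarrow> ('a \<Rightarrow> 'a \<Rightarrow> 'a \<Rightarrow> real) \<Rightarrow> bool" where
  "ricci_soliton_on L g \<longleftrightarrow>
     riemannian_metric_on L g \<and>
     (\<exists>c X. vector_field_on L X \<and>
        (\<forall>x\<in>L. \<forall>u\<in>L. \<forall>v\<in>L.
           ricci_curvature L g x u v = c * g x u v + lie_derivative_metric X g x u v))"

definition nilsoliton :: "'a::euclidean_space set \<Rightarrow> 'a monoid \<Rightarrow> ('a \<Rightarrow> 'a \<Rightarrow> 'a \<Rightarrow> real) \<Rightarrow> bool" where
  "nilsoliton L G g \<longleftrightarrow> left_invariant_metric_on L G g \<and> ricci_soliton_on L g"

text \<open>
  The simply connected Lie group with Lie algebra \<open>(L, br)\<close> is unique up to isomorphism, so the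
  existential quantifier over \<open>G\<close> is harmless.
\<close>

definition einstein_nilradical :: "'a::euclidean_space set \<Rightarrow> ('a \<Rightarrow> 'a \<Rightarrow> 'a) \<Rightarrow> bool" where
  "einstein_nilradical L br \<longleftrightarrow>
     nilpotent_lie_algebra_on L br \<and>
     (\<exists>G. lie_group_on L G \<and> has_lie_algebra G L br \<and> (\<exists>g. nilsoliton L G g))"

end

theory Submission
  imports Defs
begin

text \<open>
  Let \<open>\<mu>\<close> be the bracket, read in a Euclidean space that carries the metric. Up to scaling, the
  metric is a soliton iff \<open>Ric + 1\<close> is a derivation of \<open>\<mu>\<close>. For a soliton field \<open>X\<close> let \<open>T\<close> be its
  covariant derivative, in the left-invariant frame, for the flat connection whose parallel fields
  are the right-invariant ones. The soliton equation says \<open>T + T\<^sup>T = Ric + 1\<close>, and since the symmetric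
  part of \<open>T\<close> is constant, the curvature is stationary to first order when \<open>\<mu>\<close> moves along \<open>T\<close>. As
  the Ricci operator is the moment map of the action of \<open>gl\<close> on brackets, \<open>Ric + 1\<close> annihilates \<open>\<mu>\<close>.

  Conversely, if \<open>D = Ric + 1\<close> is a derivation, it is positive definite and grades the algebra. Then
  \<open>a * b = a + A a b\<close>, with \<open>A a\<close> the unipotent automorphism that conjugates \<open>D\<close> to \<open>D - ad a\<close>, is
  a group with the given Lie algebra, on which \<open>D\<close> acts by linear automorphisms; they provide
  the soliton field.

  Direct sums of algebraic solitons are algebraic solitons. For the other direction, the projection
  onto an ideal summand lies in the centroid of \<open>\<mu>\<close>, and so does its part \<open>A\<close> of degree \<open>0\<close> for \<open>ad D\<close>.
  Since \<open>A\<close> commutes with \<open>D\<close>, the moment map identity puts \<open>A\<^sup>T\<close> in the centroid as well, so the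
  range of \<open>A\<close> and its orthogonal complement are ideals, on which the soliton condition splits. The
  projection only adds terms of higher degree to \<open>A\<close>, whence the range of \<open>A\<close> is isomorphic to
  the given summand.
\<close>

section \<open>Smooth functions\<close>

text \<open>The soliton field is an arbitrary smooth field, not assumed complete or tied to
  automorphisms. Passing to algebra is therefore a prolongation argument, as for Killing fields: the
  derivative of \<open>T\<close> is skew-valued with known antisymmetrization, hence a function of
  \<open>T\<close> itself, and the integrability condition of this closed system is algebraic and
  read off at a single point. In the splitting, the obstacle is that complementary ideals need not
  be orthogonal for a soliton metric. The given summand is replaced by an isomorphic ideal whose
  orthogonal complement is an ideal too. Brackets live on a whole Euclidean space, so that adjoints,
  traces and orthonormal bases are at hand even when the Lie algebra is a proper subspace or zero.
  All models share the constant \<open>-1\<close>, because an orthogonal sum of solitons with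
  different constants need not be a soliton; this can be arranged by scaling since the constant is
  negative for a nonzero bracket.\<close>

lemma dir_derivI:
  "((\<lambda>t. f (x + t *\<^sub>R v)) has_vector_derivative d) (at 0) \<Longrightarrow> dir_deriv f x v = d"
  unfolding dir_deriv_def by (rule vector_derivative_at)

lemma Ck_on_dir_deriv:
  "Ck_on (Suc k) S f \<Longrightarrow> x \<in> S \<Longrightarrow> v \<in> S \<Longrightarrow>
    ((\<lambda>t. f (x + t *\<^sub>R v)) has_vector_derivative dir_deriv f x v) (at 0)"
  unfolding dir_deriv_def by (simp add: vector_derivative_works)

lemma Ck_on_mono: "Ck_on (Suc k) S f \<Longrightarrow> Ck_on k S f"
  by (induction k arbitrary: f) auto

lemma Ck_on_continuous: "Ck_on k S f \<Longrightarrow> continuous_on S f"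
  by (cases k) auto

lemma dir_deriv_cong:
  assumes "subspace S" "\<And>x. x \<in> S \<Longrightarrow> f x = g x" "x \<in> S" "v \<in> S"
  shows "dir_deriv f x v = dir_deriv g x v"
proof -
  have "(\<lambda>t. f (x + t *\<^sub>R v)) = (\<lambda>t. g (x + t *\<^sub>R v))"
    using assms by (auto intro!: ext simp: subspace_add subspace_scale)
  then show ?thesis by (simp add: dir_deriv_def)
qed

lemma Ck_on_cong:
  assumes "subspace S" "\<And>x. x \<in> S \<Longrightarrow> f x = g x" "Ck_on k S f"
  shows "Ck_on k S g"
  using assms(2,3)
proof (induction k arbitrary: f g)
  case 0
  then show ?case using continuous_on_eq[of S f g] by simp
next
  case (Suc k)
  have eq: "(\<lambda>t. f (x + t *\<^sub>R v)) = (\<lambda>t. g (x + t *\<^sub>R v))" if "x \<in> S" "v \<in> S" for x v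
    using Suc.prems(1) assms(1) that by (auto intro!: ext simp: subspace_add subspace_scale)
  have "Ck_on k S (\<lambda>x. dir_deriv g x v)" if "v \<in> S" for v
    by (rule Suc.IH[where f="\<lambda>x. dir_deriv f x v"])
      (use Suc.prems assms(1) that in \<open>auto intro!: dir_deriv_cong\<close>)
  moreover have "continuous_on S g"
    using Suc.prems continuous_on_eq[of S f g] by simp
  ultimately show ?case
    using Suc.prems eq by auto
qed

text \<open>The value \<open>dir_deriv f x v\<close> comes from a choice operator, but a
  \<open>has_vector_derivative\<close> fact pins it down, so an explicit candidate \<open>f'\<close>
  may replace it. The closure properties below are inductions through this rule.\<close>

lemma Ck_on_SucI:
  assumes "subspace S" "continuous_on S f"
    and "\<And>x v. x \<in> S \<Longrightarrow> v \<in> S \<Longrightarrow> ((\<lambda>t. f (x + t *\<^sub>R v)) has_vector_derivative f' v x) (at 0)"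
    and "\<And>v. v \<in> S \<Longrightarrow> Ck_on k S (f' v)"
  shows "Ck_on (Suc k) S f"
proof -
  have "Ck_on k S (\<lambda>x. dir_deriv f x v)" if "v \<in> S" for v
    by (rule Ck_on_cong[OF assms(1) _ assms(4)[OF that]])
      (use that in \<open>auto intro!: dir_derivI[symmetric] assms(3)\<close>)
  then show ?thesis
    using assms(2,3) by (auto intro: differentiableI_vector)
qed

lemma Ck_on_const: "subspace S \<Longrightarrow> Ck_on k S (\<lambda>_. c)"
proof (induction k arbitrary: c)
  case (Suc k)
  show ?case
    by (rule Ck_on_SucI[where f'="\<lambda>_ _. 0"]) (use Suc in \<open>auto intro!: derivative_eq_intros\<close>)
qed simp

lemma Ck_on_linear:
  assumes "subspace S" "bounded_linear h"
  shows "Ck_on k S h"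
proof (cases k)
  case 0
  then show ?thesis using assms linear_continuous_on by auto
next
  case (Suc m)
  interpret bounded_linear h by fact
  show ?thesis unfolding Suc
    by (rule Ck_on_SucI[where f'="\<lambda>v _. h v"])
      (auto intro!: derivative_eq_intros Ck_on_const assms linear_continuous_on simp: add scaleR)
qed

lemma Ck_on_bounded_linear:
  assumes "subspace S" "bounded_linear h"
  shows "Ck_on k S f \<Longrightarrow> Ck_on k S (\<lambda>x. h (f x))"
proof (induction k arbitrary: f)
  case 0
  then show ?case
    using bounded_linear.continuous_on[OF assms(2)] by auto
next
  case (Suc k)
  show ?case
  proof (rule Ck_on_SucI[where f'="\<lambda>v x. h (dir_deriv f x v)"])
    show "continuous_on S (\<lambda>x. h (f x))"
      using Suc.prems bounded_linear.continuous_on[OF assms(2)] by auto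
    show "((\<lambda>t. h (f (x + t *\<^sub>R v))) has_vector_derivative h (dir_deriv f x v)) (at 0)"
      if "x \<in> S" "v \<in> S" for x v
      by (rule bounded_linear.has_vector_derivative[OF assms(2)])
        (rule Ck_on_dir_deriv[OF Suc.prems that])
  qed (use Suc assms in auto)
qed

lemma Ck_on_add:
  assumes "subspace S"
  shows "Ck_on k S f \<Longrightarrow> Ck_on k S g \<Longrightarrow> Ck_on k S (\<lambda>x. f x + g x)"
proof (induction k arbitrary: f g)
  case 0
  then show ?case by (auto intro: continuous_intros)
next
  case (Suc k)
  show ?case
  proof (rule Ck_on_SucI[where f'="\<lambda>v x. dir_deriv f x v + dir_deriv g x v"])
    show "continuous_on S (\<lambda>x. f x + g x)"
      by (intro continuous_on_add Ck_on_continuous[OF Suc.prems(1)] Ck_on_continuous[OF Suc.prems(2)])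
    show "((\<lambda>t. f (x + t *\<^sub>R v) + g (x + t *\<^sub>R v)) has_vector_derivative
        dir_deriv f x v + dir_deriv g x v) (at 0)" if "x \<in> S" "v \<in> S" for x v
      by (intro has_vector_derivative_add Ck_on_dir_deriv[OF Suc.prems(1) that]
          Ck_on_dir_deriv[OF Suc.prems(2) that])
    show "Ck_on k S (\<lambda>x. dir_deriv f x v + dir_deriv g x v)" if "v \<in> S" for v
      using Suc.prems that by (intro Suc.IH) auto
  qed (rule assms)
qed

lemma Ck_on_sum:
  assumes "subspace S" "\<And>i. i \<in> I \<Longrightarrow> Ck_on k S (f i)"
  shows "Ck_on k S (\<lambda>x. \<Sum>i\<in>I. f i x)"
  using assms(2)
  by (induction I rule: infinite_finite_induct) (auto intro: Ck_on_const Ck_on_add assms(1))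

lemma Ck_on_bilinear:
  assumes "subspace S" "bounded_bilinear B"
  shows "Ck_on k S f \<Longrightarrow> Ck_on k S g \<Longrightarrow> Ck_on k S (\<lambda>x. B (f x) (g x))"
proof (induction k arbitrary: f g)
  case 0
  then show ?case
    using bounded_bilinear.continuous_on[OF assms(2)] by auto
next
  case (Suc k)
  show ?case
  proof (rule Ck_on_SucI[where f'="\<lambda>v x. B (f x) (dir_deriv g x v) + B (dir_deriv f x v) (g x)"])
    show "continuous_on S (\<lambda>x. B (f x) (g x))"
      using Suc.prems bounded_bilinear.continuous_on[OF assms(2)] by auto
    show "((\<lambda>t. B (f (x + t *\<^sub>R v)) (g (x + t *\<^sub>R v))) has_vector_derivative
        B (f x) (dir_deriv g x v) + B (dir_deriv f x v) (g x)) (at 0)"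
      if "x \<in> S" "v \<in> S" for x v
      using bounded_bilinear.has_vector_derivative[OF assms(2)
          Ck_on_dir_deriv[OF Suc.prems(1) that] Ck_on_dir_deriv[OF Suc.prems(2) that]]
      by simp
    show "Ck_on k S (\<lambda>x. B (f x) (dir_deriv g x v) + B (dir_deriv f x v) (g x))" if "v \<in> S" for v
    proof (rule Ck_on_add)
      show "Ck_on k S (\<lambda>x. B (f x) (dir_deriv g x v))"
        using Suc.prems that by (intro Suc.IH Ck_on_mono[OF Suc.prems(1)]) auto
      show "Ck_on k S (\<lambda>x. B (dir_deriv f x v) (g x))"
        using Suc.prems that by (intro Suc.IH Ck_on_mono[OF Suc.prems(2)]) auto
    qed (rule assms)
  qed (use assms in auto)
qed

text \<open>Coordinates are changed one at a time, each change being controlled by the mean value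
  inequality. This turns the purely directional regularity of \<open>Ck_on\<close> into a Frechet
  derivative, and hence into a chain rule.\<close>

lemma has_derivative_if_partials_continuous:
  fixes f :: "'a::euclidean_space \<Rightarrow> 'b::real_normed_vector"
  assumes D: "\<And>x i. i \<in> Basis \<Longrightarrow> ((\<lambda>t. f (x + t *\<^sub>R i)) has_vector_derivative f' i x) (at 0)"
    and cont: "\<And>i. i \<in> Basis \<Longrightarrow> continuous_on UNIV (f' i)"
  shows "(f has_derivative (\<lambda>h. \<Sum>i\<in>Basis. (h \<bullet> i) *\<^sub>R f' i x)) (at x)"
proof -
  have D': "((\<lambda>t. f (z + t *\<^sub>R i)) has_vector_derivative f' i (z + s *\<^sub>R i)) (at s)"
    if "i \<in> Basis" for z i s
  proof -
    have "((\<lambda>t. f (z + s *\<^sub>R i + t *\<^sub>R i)) \<circ> (\<lambda>t. t - s) has_vector_derivative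
        1 *\<^sub>R f' i (z + s *\<^sub>R i)) (at s)"
      by (rule vector_diff_chain_at) (use D[OF that, of "z + s *\<^sub>R i"] in \<open>auto simp: has_vector_derivative_diff_const intro: has_vector_derivative_id\<close>)
    then show ?thesis by (simp add: o_def algebra_simps)
  qed
  \<comment> \<open>The base point \<open>z\<close> varies near \<open>x\<close>: after a move along
    one coordinate, the remaining increments start from a displaced point.\<close>
  have step: "\<exists>d>0. \<forall>z h. norm (z - x) < d \<longrightarrow> norm h < d \<longrightarrow>
      norm (f (z + (\<Sum>i\<in>B. (h \<bullet> i) *\<^sub>R i)) - f z - (\<Sum>i\<in>B. (h \<bullet> i) *\<^sub>R f' i x)) \<le> e * norm h"
    if "finite B" "B \<subseteq> Basis" "e > 0" for B e
    using that
  proof (induction B arbitrary: e rule: finite_induct)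
    case empty
    then show ?case by (auto intro!: exI[of _ 1])
  next
    case (insert b B)
    then have b: "b \<in> Basis" by simp
    obtain d1 where d1: "d1 > 0" "\<And>z h. norm (z - x) < d1 \<Longrightarrow> norm h < d1 \<Longrightarrow>
      norm (f (z + (\<Sum>i\<in>B. (h \<bullet> i) *\<^sub>R i)) - f z - (\<Sum>i\<in>B. (h \<bullet> i) *\<^sub>R f' i x)) \<le> e/2 * norm h"
      using insert.IH[of "e/2"] insert.prems by auto
    obtain d2 where d2: "d2 > 0" "\<And>y. norm (y - x) < d2 \<Longrightarrow> norm (f' b y - f' b x) \<le> e/2"
    proof -
      have "\<exists>d>0. \<forall>y. dist y x < d \<longrightarrow> dist (f' b y) (f' b x) < e/2"
        using cont[OF b, unfolded continuous_on_iff, rule_format, of x "e/2"] insert.prems by simp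
      then show thesis using that by (auto simp: dist_norm intro: less_imp_le)
    qed
    show ?case
    proof (intro exI[of _ "min d1 d2 / 2"] conjI allI impI)
      show "min d1 d2 / 2 > 0" using d1 d2 by simp
      fix z h :: 'a
      assume z: "norm (z - x) < min d1 d2 / 2" and h: "norm h < min d1 d2 / 2"
      let ?t = "h \<bullet> b"
      have t: "\<bar>?t\<bar> \<le> norm h" using b Basis_le_norm by blast
      have near: "norm (z + s *\<^sub>R b - x) < min d1 d2" if "\<bar>s\<bar> \<le> \<bar>?t\<bar>" for s
      proof -
        have "norm (z + s *\<^sub>R b - x) \<le> norm (z - x) + \<bar>s\<bar>"
          using norm_triangle_ineq[of "z - x" "s *\<^sub>R b"] b by (simp add: algebra_simps)
        then show ?thesis using z h t that by linarith
      qed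
      \<comment> \<open>With the linear term subtracted, the derivative along the segment is at most
        \<open>e/2\<close>.\<close>
      let ?g = "\<lambda>s. f (z + s *\<^sub>R b) - s *\<^sub>R f' b x"
      have "norm (?g ?t - ?g 0) \<le> e/2 * norm (?t - 0)"
      proof (rule differentiable_bound[where S="closed_segment 0 ?t" and f="?g" and
            f'="\<lambda>s r. r *\<^sub>R (f' b (z + s *\<^sub>R b) - f' b x)"])
        fix s assume s: "s \<in> closed_segment 0 ?t"
        have "(?g has_vector_derivative (f' b (z + s *\<^sub>R b) - f' b x)) (at s within closed_segment 0 ?t)"
          by (intro has_vector_derivative_diff has_vector_derivative_at_within[OF D'[OF b]])
            (auto intro!: derivative_eq_intros)
        then show "(?g has_derivative (\<lambda>r. r *\<^sub>R (f' b (z + s *\<^sub>R b) - f' b x))) (at s within closed_segment 0 ?t)"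
          by (simp add: has_vector_derivative_def)
        have "\<bar>s\<bar> \<le> \<bar>?t\<bar>"
          using s by (auto simp: closed_segment_eq_real_ivl split: if_splits)
        then have "norm (f' b (z + s *\<^sub>R b) - f' b x) \<le> e/2"
          using near by (intro d2) auto
        then show "onorm (\<lambda>r. r *\<^sub>R (f' b (z + s *\<^sub>R b) - f' b x)) \<le> e/2"
        proof (intro onorm_bound)
          fix r :: real
          assume le: "norm (f' b (z + s *\<^sub>R b) - f' b x) \<le> e/2"
          show "norm (r *\<^sub>R (f' b (z + s *\<^sub>R b) - f' b x)) \<le> e/2 * norm r"
            using mult_right_mono[OF le, of "\<bar>r\<bar>"] by (simp add: mult.commute)
        qed (use insert.prems in auto)
      qed auto
      then have 1: "norm (f (z + ?t *\<^sub>R b) - f z - ?t *\<^sub>R f' b x) \<le> e/2 * norm h"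
      proof -
        have "e/2 * \<bar>?t\<bar> \<le> e/2 * norm h" using t insert.prems by (intro mult_left_mono) auto
        then show ?thesis using \<open>norm (?g ?t - ?g 0) \<le> e/2 * norm (?t - 0)\<close>
          by (simp add: algebra_simps)
      qed
      have 2: "norm (f ((z + ?t *\<^sub>R b) + (\<Sum>i\<in>B. (h \<bullet> i) *\<^sub>R i)) - f (z + ?t *\<^sub>R b)
          - (\<Sum>i\<in>B. (h \<bullet> i) *\<^sub>R f' i x)) \<le> e/2 * norm h"
        using near[of ?t] h d1(1) by (intro d1(2)) auto
      have "f (z + (\<Sum>i\<in>insert b B. (h \<bullet> i) *\<^sub>R i)) - f z - (\<Sum>i\<in>insert b B. (h \<bullet> i) *\<^sub>R f' i x)
        = (f ((z + ?t *\<^sub>R b) + (\<Sum>i\<in>B. (h \<bullet> i) *\<^sub>R i)) - f (z + ?t *\<^sub>R b)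
          - (\<Sum>i\<in>B. (h \<bullet> i) *\<^sub>R f' i x)) + (f (z + ?t *\<^sub>R b) - f z - ?t *\<^sub>R f' b x)"
        using insert.hyps by (simp add: algebra_simps)
      then show "norm (f (z + (\<Sum>i\<in>insert b B. (h \<bullet> i) *\<^sub>R i)) - f z
          - (\<Sum>i\<in>insert b B. (h \<bullet> i) *\<^sub>R f' i x)) \<le> e * norm h"
        using norm_triangle_mono[OF 2 1] by (simp only:)
    qed
  qed
  show ?thesis
    unfolding has_derivative_at_alt
  proof (intro conjI allI impI)
    show "bounded_linear (\<lambda>h. \<Sum>i\<in>Basis. (h \<bullet> i) *\<^sub>R f' i x)"
      by (intro bounded_linear_sum bounded_linear_scaleR_const bounded_linear_inner_left)
    fix e :: real assume "e > 0"
    from step[OF finite_Basis order_refl this] obtain d where d: "d > 0"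
      "\<And>h. norm h < d \<Longrightarrow> norm (f (x + h) - f x - (\<Sum>i\<in>Basis. (h \<bullet> i) *\<^sub>R f' i x)) \<le> e * norm h"
      by (force simp: euclidean_representation)
    show "\<exists>d>0. \<forall>y. norm (y - x) < d \<longrightarrow>
        norm (f y - f x - (\<Sum>i\<in>Basis. ((y - x) \<bullet> i) *\<^sub>R f' i x)) \<le> e * norm (y - x)"
      using d(1) d(2)[of "y - x" for y] by (intro exI[of _ d]) auto
  qed
qed

lemma has_derivative_imp_dir_deriv:
  assumes "(f has_derivative f') (at x)"
  shows "((\<lambda>t. f (x + t *\<^sub>R v)) has_vector_derivative f' v) (at 0)"
proof -
  have "((\<lambda>t. f (x + t *\<^sub>R v)) has_derivative (\<lambda>t. f' (t *\<^sub>R v))) (at 0)"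
    by (rule has_derivative_compose[where g=f and f="\<lambda>t. x + t *\<^sub>R v"])
      (use assms in \<open>auto intro!: derivative_eq_intros\<close>)
  then show ?thesis
    unfolding has_vector_derivative_def
    using linear_cmul[OF has_derivative_linear[OF assms]] by simp
qed

lemma dir_deriv_has_derivative:
  "(f has_derivative f') (at x) \<Longrightarrow> dir_deriv f x v = f' v"
  by (rule dir_derivI) (rule has_derivative_imp_dir_deriv)

lemma Ck_on_has_derivative:
  fixes f :: "'a::euclidean_space \<Rightarrow> 'b::real_normed_vector"
  assumes "Ck_on (Suc k) UNIV f"
  shows "(f has_derivative dir_deriv f x) (at x)"
proof -
  have "(f has_derivative (\<lambda>h. \<Sum>i\<in>Basis. (h \<bullet> i) *\<^sub>R dir_deriv f x i)) (at x)"
    by (rule has_derivative_if_partials_continuous)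
      (use assms Ck_on_dir_deriv[OF assms] in \<open>auto intro: Ck_on_continuous\<close>)
  moreover from dir_deriv_has_derivative[OF this]
  have "dir_deriv f x = (\<lambda>h. \<Sum>i\<in>Basis. (h \<bullet> i) *\<^sub>R dir_deriv f x i)" by (rule ext)
  ultimately show ?thesis by simp
qed

text \<open>By the chain rule \<open>f\<close> is differentiated in a direction that depends on
  \<open>x\<close>. Expanding it in \<open>Basis\<close> leaves derivatives of \<open>f\<close> in
  constant directions, to which the induction hypothesis applies.\<close>

lemma Ck_on_compose:
  fixes f :: "'b::euclidean_space \<Rightarrow> 'c::real_normed_vector" and g :: "'a::euclidean_space \<Rightarrow> 'b"
  shows "Ck_on k UNIV f \<Longrightarrow> Ck_on k UNIV g \<Longrightarrow> Ck_on k UNIV (\<lambda>x. f (g x))"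
proof (induction k arbitrary: f)
  case 0
  then show ?case using continuous_on_compose2[of UNIV f UNIV g] by auto
next
  case (Suc k)
  have cont: "continuous_on UNIV f" "continuous_on UNIV g"
    using Suc.prems by (auto dest: Ck_on_continuous)
  show ?case
  proof (rule Ck_on_SucI[where f'="\<lambda>v x. \<Sum>b\<in>Basis. (dir_deriv g x v \<bullet> b) *\<^sub>R dir_deriv f (g x) b"])
    show "continuous_on UNIV (\<lambda>x. f (g x))"
      using continuous_on_compose2[OF cont] by auto
    fix x v
    have df: "(f has_derivative dir_deriv f (g x)) (at (g x))"
      and dg: "(g has_derivative dir_deriv g x) (at x)"
      using Suc.prems Ck_on_has_derivative by blast+
    have "((\<lambda>x. f (g x)) has_derivative (\<lambda>v. dir_deriv f (g x) (dir_deriv g x v))) (at x)"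
      using has_derivative_compose[OF dg df] .
    from has_derivative_imp_dir_deriv[OF this]
    have "((\<lambda>t. f (g (x + t *\<^sub>R v))) has_vector_derivative dir_deriv f (g x) (dir_deriv g x v)) (at 0)" .
    moreover have "dir_deriv f (g x) (\<Sum>b\<in>Basis. (dir_deriv g x v \<bullet> b) *\<^sub>R b) =
        (\<Sum>b\<in>Basis. (dir_deriv g x v \<bullet> b) *\<^sub>R dir_deriv f (g x) b)"
      using has_derivative_linear[OF df] by (simp add: linear_sum linear_cmul)
    ultimately show "((\<lambda>t. f (g (x + t *\<^sub>R v))) has_vector_derivative
        (\<Sum>b\<in>Basis. (dir_deriv g x v \<bullet> b) *\<^sub>R dir_deriv f (g x) b)) (at 0)"
      by (simp add: euclidean_representation)
  next
    fix v :: 'a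
    show "Ck_on k UNIV (\<lambda>x. \<Sum>b\<in>Basis. (dir_deriv g x v \<bullet> b) *\<^sub>R dir_deriv f (g x) b)"
    proof (intro Ck_on_sum Ck_on_bilinear[OF _ bounded_bilinear_scaleR]
        Ck_on_bounded_linear[OF _ bounded_linear_inner_left])
      show "Ck_on k UNIV (\<lambda>x. dir_deriv g x v)" using Suc.prems by simp
      show "Ck_on k UNIV (\<lambda>x. dir_deriv f (g x) b)" for b
        using Suc.prems by (intro Suc.IH Ck_on_mono[OF Suc.prems(2)]) auto
    qed auto
  qed auto
qed

text \<open>Used chiefly with a projection onto the subspace as \<open>p\<close>: data given only on
  \<open>S\<close> extend to smooth data on the whole space.\<close>

lemma Ck_on_linear_precompose:
  assumes "subspace S" "subspace T" "bounded_linear p" "p ` T \<subseteq> S"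
  shows "Ck_on k S f \<Longrightarrow> Ck_on k T (\<lambda>x. f (p x))"
proof (induction k arbitrary: f)
  case 0
  then show ?case
    using continuous_on_compose2[of S f T p] assms linear_continuous_on by auto
next
  case (Suc k)
  interpret bounded_linear p by fact
  show ?case
  proof (rule Ck_on_SucI[where f'="\<lambda>v x. dir_deriv f (p x) (p v)"])
    show "continuous_on T (\<lambda>x. f (p x))"
      using Suc.prems continuous_on_compose2[of S f T p] assms linear_continuous_on by auto
    show "((\<lambda>t. f (p (x + t *\<^sub>R v))) has_vector_derivative dir_deriv f (p x) (p v)) (at 0)"
      if "x \<in> T" "v \<in> T" for x v
      using Ck_on_dir_deriv[OF Suc.prems, of "p x" "p v"] that assms(4) by (auto simp: add scaleR)
    show "Ck_on k T (\<lambda>x. dir_deriv f (p x) (p v))" if "v \<in> T" for v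
      using Suc.prems that assms(4) by (intro Suc.IH) auto
  qed (use assms in auto)
qed

lemma smooth_on_linear_precompose:
  "subspace S \<Longrightarrow> subspace T \<Longrightarrow> bounded_linear p \<Longrightarrow> p ` T \<subseteq> S \<Longrightarrow> smooth_on S f \<Longrightarrow>
    smooth_on T (\<lambda>x. f (p x))"
  unfolding smooth_on_def using Ck_on_linear_precompose by blast

lemma smooth_on_cong:
  "subspace S \<Longrightarrow> smooth_on S f \<Longrightarrow> (\<And>x. x \<in> S \<Longrightarrow> f x = g x) \<Longrightarrow> smooth_on S g"
  unfolding smooth_on_def using Ck_on_cong by metis

lemma smooth_on_subspace: "subspace S \<Longrightarrow> smooth_on UNIV f \<Longrightarrow> smooth_on S f"
  using smooth_on_linear_precompose[of UNIV S "\<lambda>x. x" f] by (simp add: bounded_linear_ident)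

section \<open>Calculus of smooth maps on a whole Euclidean space\<close>

lemma smooth_const: "smooth_on UNIV (\<lambda>_. c)"
  by (simp add: smooth_on_def Ck_on_const)

lemma smooth_linear: "bounded_linear h \<Longrightarrow> smooth_on UNIV h"
  by (simp add: smooth_on_def Ck_on_linear)

lemma smooth_bounded_linear:
  "bounded_linear h \<Longrightarrow> smooth_on UNIV f \<Longrightarrow> smooth_on UNIV (\<lambda>x. h (f x))"
  by (simp add: smooth_on_def Ck_on_bounded_linear)

lemma smooth_add: "smooth_on UNIV f \<Longrightarrow> smooth_on UNIV g \<Longrightarrow> smooth_on UNIV (\<lambda>x. f x + g x)"
  by (simp add: smooth_on_def Ck_on_add)

lemma smooth_minus: "smooth_on UNIV f \<Longrightarrow> smooth_on UNIV (\<lambda>x. - f x)"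
  using smooth_bounded_linear[OF bounded_linear_minus[OF bounded_linear_ident]] by blast

lemma smooth_diff: "smooth_on UNIV f \<Longrightarrow> smooth_on UNIV g \<Longrightarrow> smooth_on UNIV (\<lambda>x. f x - g x)"
  using smooth_add[OF _ smooth_minus, of f g] by simp

lemma smooth_sum: "(\<And>i. i \<in> I \<Longrightarrow> smooth_on UNIV (f i)) \<Longrightarrow> smooth_on UNIV (\<lambda>x. \<Sum>i\<in>I. f i x)"
  by (simp add: smooth_on_def Ck_on_sum)

lemma smooth_bilinear:
  "bounded_bilinear B \<Longrightarrow> smooth_on UNIV f \<Longrightarrow> smooth_on UNIV g \<Longrightarrow> smooth_on UNIV (\<lambda>x. B (f x) (g x))"
  by (simp add: smooth_on_def Ck_on_bilinear)

lemmas smooth_blinfun_apply = smooth_bilinear[OF bounded_bilinear_blinfun_apply]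
lemmas smooth_blinfun_compose = smooth_bilinear[OF bounded_bilinear_blinfun_compose]

lemma smooth_compose:
  fixes f :: "'b::euclidean_space \<Rightarrow> 'c::real_normed_vector" and g :: "'a::euclidean_space \<Rightarrow> 'b"
  shows "smooth_on UNIV f \<Longrightarrow> smooth_on UNIV g \<Longrightarrow> smooth_on UNIV (\<lambda>x. f (g x))"
  by (simp add: smooth_on_def Ck_on_compose)

lemma smooth_dir_deriv: "smooth_on UNIV f \<Longrightarrow> smooth_on UNIV (\<lambda>x. dir_deriv f x v)"
  unfolding smooth_on_def using Ck_on.simps(2) by blast

lemma smooth_has_derivative:
  fixes f :: "'a::euclidean_space \<Rightarrow> 'b::real_normed_vector"
  shows "smooth_on UNIV f \<Longrightarrow> (f has_derivative dir_deriv f x) (at x)"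
  unfolding smooth_on_def using Ck_on_has_derivative by blast

text \<open>An operator is the finite sum of rank-one operators built from its columns
  \<open>F x b\<close>, and each of these depends on its column through a fixed bounded linear
  map.\<close>

lemma smooth_blinfunI:
  fixes F :: "'a::euclidean_space \<Rightarrow> 'b::euclidean_space \<Rightarrow>\<^sub>L 'c::real_normed_vector"
  assumes "\<And>v. smooth_on UNIV (\<lambda>x. F x v)"
  shows "smooth_on UNIV F"
proof -
  define T :: "'b \<Rightarrow> 'c \<Rightarrow> 'b \<Rightarrow>\<^sub>L 'c"
    where "T b w = blinfun_scaleR_left w o\<^sub>L blinfun_inner_left b" for b w
  have T: "blinfun_apply (T b w) v = (v \<bullet> b) *\<^sub>R w" for b w v
    by (simp add: T_def blinfun_inner_left.rep_eq)
  have bl: "bounded_linear (T b)" for b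
    unfolding T_def
    by (rule bounded_linear_compose[OF
          bounded_bilinear.bounded_linear_left[OF bounded_bilinear_blinfun_compose]
          bounded_linear_blinfun_scaleR_left])
  have "F x = (\<Sum>b\<in>Basis. T b (F x b))" for x
  proof (rule blinfun_eqI)
    fix v
    have "F x v = F x (\<Sum>b\<in>Basis. (v \<bullet> b) *\<^sub>R b)" by (simp only: euclidean_representation)
    also have "\<dots> = (\<Sum>b\<in>Basis. (v \<bullet> b) *\<^sub>R F x b)"
      by (simp only: blinfun.sum_right blinfun.scaleR_right)
    finally show "F x v = (\<Sum>b\<in>Basis. T b (F x b)) v" by (simp only: blinfun.sum_left T)
  qed
  note F = this
  show ?thesis
    by (subst F[abs_def]) (intro smooth_sum smooth_bounded_linear[OF bl] assms)
qed

text \<open>Schwarz's theorem. Two applications of the mean value theorem express the second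
  difference over a small parallelogram by a value of either mixed derivative inside it; continuity
  then compares both values with those at \<open>x\<close>.\<close>

lemma second_derivative_symmetric_real:
  fixes f :: "'a::real_normed_vector \<Rightarrow> real"
  assumes fu: "\<And>x. ((\<lambda>t. f (x + t *\<^sub>R u)) has_vector_derivative fu x) (at 0)"
    and fv: "\<And>x. ((\<lambda>t. f (x + t *\<^sub>R v)) has_vector_derivative fv x) (at 0)"
    and fuv: "\<And>x. ((\<lambda>t. fu (x + t *\<^sub>R v)) has_vector_derivative fuv x) (at 0)"
    and fvu: "\<And>x. ((\<lambda>t. fv (x + t *\<^sub>R u)) has_vector_derivative fvu x) (at 0)"
    and cont: "continuous_on UNIV fuv" "continuous_on UNIV fvu"
  shows "fuv x = fvu x"
proof (rule ccontr)
  assume ne: "fuv x \<noteq> fvu x"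
  have shift: "((\<lambda>t. h (z + t *\<^sub>R w)) has_real_derivative h' (z + s *\<^sub>R w)) (at s)"
    if "\<And>x. ((\<lambda>t. h (x + t *\<^sub>R w)) has_vector_derivative h' x) (at 0)" for h h' :: "'a \<Rightarrow> real" and z w s
  proof -
    have "((\<lambda>t. h (z + s *\<^sub>R w + t *\<^sub>R w)) \<circ> (\<lambda>t. t - s) has_vector_derivative 1 *\<^sub>R h' (z + s *\<^sub>R w)) (at s)"
      by (rule vector_diff_chain_at) (use that[of "z + s *\<^sub>R w"] in \<open>auto simp: has_vector_derivative_diff_const intro: has_vector_derivative_id\<close>)
    then show ?thesis
      by (simp add: o_def algebra_simps has_real_derivative_iff_has_vector_derivative)
  qed
  define e where "e = \<bar>fuv x - fvu x\<bar> / 2"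
  have "e > 0" using ne by (simp add: e_def)
  obtain d1 where d1: "d1 > 0" "\<And>y. norm (y - x) < d1 \<Longrightarrow> \<bar>fuv y - fuv x\<bar> < e"
  proof -
    have "\<exists>d>0. \<forall>y. dist y x < d \<longrightarrow> dist (fuv y) (fuv x) < e"
      using cont(1)[unfolded continuous_on_iff, rule_format, of x e] \<open>e > 0\<close> by simp
    then show thesis using that by (auto simp: dist_norm)
  qed
  obtain d2 where d2: "d2 > 0" "\<And>y. norm (y - x) < d2 \<Longrightarrow> \<bar>fvu y - fvu x\<bar> < e"
  proof -
    have "\<exists>d>0. \<forall>y. dist y x < d \<longrightarrow> dist (fvu y) (fvu x) < e"
      using cont(2)[unfolded continuous_on_iff, rule_format, of x e] \<open>e > 0\<close> by simp
    then show thesis using that by (auto simp: dist_norm)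
  qed
  \<comment> \<open>The \<open>1\<close> keeps the denominator positive when
    \<open>u = v = 0\<close> and puts the interior of the parallelogram strictly inside both
    balls.\<close>
  define s where "s = min d1 d2 / (norm u + norm v + 1)"
  have pos: "norm u + norm v + 1 > 0" by (smt (verit) norm_ge_zero)
  have s: "s > 0" using d1 d2 pos by (simp add: s_def)
  have near: "norm (x + a *\<^sub>R u + b *\<^sub>R v - x) < min d1 d2" if "0 < a" "a < s" "0 < b" "b < s" for a b
  proof -
    have "norm (a *\<^sub>R u + b *\<^sub>R v) \<le> a * norm u + b * norm v"
      using norm_triangle_ineq[of "a *\<^sub>R u" "b *\<^sub>R v"] that by simp
    also have "\<dots> \<le> s * norm u + s * norm v"
      using that by (intro add_mono mult_right_mono) auto
    also have "\<dots> < s * (norm u + norm v + 1)" using s by (simp add: algebra_simps)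
    also have "\<dots> = min d1 d2" using pos by (simp add: s_def)
    finally show ?thesis by simp
  qed
  define \<Delta> where "\<Delta> = f (x + s *\<^sub>R u + s *\<^sub>R v) - f (x + s *\<^sub>R u) - f (x + s *\<^sub>R v) + f x"
  have mixed: "\<exists>a b. 0 < a \<and> a < s \<and> 0 < b \<and> b < s \<and>
      f (x + s *\<^sub>R u' + s *\<^sub>R v') - f (x + s *\<^sub>R u') - f (x + s *\<^sub>R v') + f x = s * (s * g2 (x + a *\<^sub>R u' + b *\<^sub>R v'))"
    if g1: "\<And>x. ((\<lambda>t. f (x + t *\<^sub>R u')) has_vector_derivative g1 x) (at 0)"
      and g2: "\<And>x. ((\<lambda>t. g1 (x + t *\<^sub>R v')) has_vector_derivative g2 x) (at 0)" for u' v' g1 g2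
  proof -
    have "\<exists>a>0. a < s \<and> (f (x + s *\<^sub>R v' + s *\<^sub>R u') - f (x + s *\<^sub>R u')) - (f (x + s *\<^sub>R v' + 0 *\<^sub>R u') - f (x + 0 *\<^sub>R u'))
       = (s - 0) * (g1 (x + s *\<^sub>R v' + a *\<^sub>R u') - g1 (x + a *\<^sub>R u'))"
      by (rule MVT2[OF s, where f="\<lambda>t. f (x + s *\<^sub>R v' + t *\<^sub>R u') - f (x + t *\<^sub>R u')"])
        (intro DERIV_diff shift g1)
    then obtain a where a: "0 < a" "a < s" and
      eq1: "f (x + s *\<^sub>R v' + s *\<^sub>R u') - f (x + s *\<^sub>R u') - f (x + s *\<^sub>R v') + f x
       = s * (g1 (x + s *\<^sub>R v' + a *\<^sub>R u') - g1 (x + a *\<^sub>R u'))" by auto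
    have "\<exists>b>0. b < s \<and> g1 (x + a *\<^sub>R u' + s *\<^sub>R v') - g1 (x + a *\<^sub>R u' + 0 *\<^sub>R v') = (s - 0) * g2 (x + a *\<^sub>R u' + b *\<^sub>R v')"
      by (rule MVT2[OF s]) (intro shift g2)
    then obtain b where b: "0 < b" "b < s" and
      eq2: "g1 (x + a *\<^sub>R u' + s *\<^sub>R v') - g1 (x + a *\<^sub>R u') = s * g2 (x + a *\<^sub>R u' + b *\<^sub>R v')" by auto
    show ?thesis
      using a b eq1 eq2 by (intro exI[of _ a] exI[of _ b]) (simp add: algebra_simps)
  qed
  obtain a b where ab: "0 < a" "a < s" "0 < b" "b < s" "\<Delta> = s * (s * fuv (x + a *\<^sub>R u + b *\<^sub>R v))"
    using mixed[OF fu fuv] unfolding \<Delta>_def by auto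
  obtain a' b' where ab': "0 < a'" "a' < s" "0 < b'" "b' < s" "\<Delta> = s * (s * fvu (x + a' *\<^sub>R u + b' *\<^sub>R v))"
    using mixed[OF fv fvu] unfolding \<Delta>_def by (auto simp: algebra_simps)
  have "fuv (x + a *\<^sub>R u + b *\<^sub>R v) = fvu (x + a' *\<^sub>R u + b' *\<^sub>R v)"
    using ab(5) ab'(5) s by simp
  moreover have "\<bar>fuv (x + a *\<^sub>R u + b *\<^sub>R v) - fuv x\<bar> < e" "\<bar>fvu (x + a' *\<^sub>R u + b' *\<^sub>R v) - fvu x\<bar> < e"
    using near[OF ab(1-4)] near[OF ab'(1-4)] by (auto intro!: d1 d2)
  ultimately have "\<bar>fuv x - fvu x\<bar> < e + e" by linarith
  then show False by (simp add: e_def)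
qed

lemma dir_deriv_bounded_linear:
  fixes f :: "'a::euclidean_space \<Rightarrow> 'b::real_normed_vector"
  assumes "bounded_linear h" "smooth_on UNIV f"
  shows "dir_deriv (\<lambda>x. h (f x)) x v = h (dir_deriv f x v)"
  by (rule dir_deriv_has_derivative[OF bounded_linear.has_derivative[OF assms(1) smooth_has_derivative[OF assms(2)]]])

lemma dir_deriv_bilinear:
  fixes f :: "'a::euclidean_space \<Rightarrow> 'b::real_normed_vector"
  assumes "bounded_bilinear B" "smooth_on UNIV f" "smooth_on UNIV g"
  shows "dir_deriv (\<lambda>x. B (f x) (g x)) x v = B (f x) (dir_deriv g x v) + B (dir_deriv f x v) (g x)"
  by (rule dir_deriv_has_derivative[OF bounded_bilinear.FDERIV[OF assms(1)
     smooth_has_derivative[OF assms(2)] smooth_has_derivative[OF assms(3)]]])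

lemmas dir_deriv_blinfun_apply = dir_deriv_bilinear[OF bounded_bilinear_blinfun_apply]
lemmas dir_deriv_blinfun_compose = dir_deriv_bilinear[OF bounded_bilinear_blinfun_compose]

lemma dir_deriv_add:
  fixes f :: "'a::euclidean_space \<Rightarrow> 'b::real_normed_vector"
  assumes "smooth_on UNIV f" "smooth_on UNIV g"
  shows "dir_deriv (\<lambda>x. f x + g x) x v = dir_deriv f x v + dir_deriv g x v"
  by (rule dir_deriv_has_derivative[OF has_derivative_add[OF
     smooth_has_derivative[OF assms(1)] smooth_has_derivative[OF assms(2)]]])

lemma dir_deriv_diff:
  fixes f :: "'a::euclidean_space \<Rightarrow> 'b::real_normed_vector"
  assumes "smooth_on UNIV f" "smooth_on UNIV g"
  shows "dir_deriv (\<lambda>x. f x - g x) x v = dir_deriv f x v - dir_deriv g x v"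
  by (rule dir_deriv_has_derivative[OF has_derivative_diff[OF
     smooth_has_derivative[OF assms(1)] smooth_has_derivative[OF assms(2)]]])

lemma dir_deriv_const [simp]: "dir_deriv (\<lambda>_. c) x v = 0"
  by (rule dir_deriv_has_derivative[where f'="\<lambda>_. 0"]) simp

lemma dir_deriv_linear: "bounded_linear h \<Longrightarrow> dir_deriv h x v = h v"
  by (rule dir_deriv_has_derivative[where f'=h]) (rule bounded_linear_imp_has_derivative)

lemma dir_deriv_compose:
  fixes f :: "'b::euclidean_space \<Rightarrow> 'c::real_normed_vector" and g :: "'a::euclidean_space \<Rightarrow> 'b"
  assumes "smooth_on UNIV f" "smooth_on UNIV g"
  shows "dir_deriv (\<lambda>x. f (g x)) x v = dir_deriv f (g x) (dir_deriv g x v)"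
  by (rule dir_deriv_has_derivative[OF has_derivative_compose[OF
     smooth_has_derivative[OF assms(2)] smooth_has_derivative[OF assms(1)]]])

lemma linear_dir_deriv:
  fixes f :: "'a::euclidean_space \<Rightarrow> 'b::real_normed_vector"
  shows "smooth_on UNIV f \<Longrightarrow> linear (dir_deriv f x)"
  using has_derivative_linear[OF smooth_has_derivative] .

lemma dir_deriv_commute:
  fixes f :: "'a::euclidean_space \<Rightarrow> 'b::euclidean_space"
  assumes "smooth_on UNIV f"
  shows "dir_deriv (\<lambda>x. dir_deriv f x u) x v = dir_deriv (\<lambda>x. dir_deriv f x v) x u"
proof (rule euclidean_eqI)
  fix b :: 'b
  note sm = assms smooth_dir_deriv[OF assms] smooth_dir_deriv[OF smooth_dir_deriv[OF assms]]
  have D: "((\<lambda>t. h (x + t *\<^sub>R w) \<bullet> b) has_vector_derivative dir_deriv h x w \<bullet> b) (at 0)"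
    if "smooth_on UNIV h" for h :: "'a \<Rightarrow> 'b" and x w
    by (rule bounded_linear.has_vector_derivative[OF bounded_linear_inner_left])
      (rule has_derivative_imp_dir_deriv[OF smooth_has_derivative[OF that]])
  have C: "continuous_on UNIV (\<lambda>x. h x \<bullet> b)" if "smooth_on UNIV h" for h :: "'a \<Rightarrow> 'b"
    using that by (intro continuous_on_inner continuous_on_const Ck_on_continuous[of 0])
      (simp add: smooth_on_def del: Ck_on.simps)
  show "dir_deriv (\<lambda>x. dir_deriv f x u) x v \<bullet> b = dir_deriv (\<lambda>x. dir_deriv f x v) x u \<bullet> b"
    by (rule second_derivative_symmetric_real[OF D[OF sm(1)] D[OF sm(1)] D[OF sm(2)] D[OF sm(2)]
          C[OF sm(3)] C[OF sm(3)]])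
qed

section \<open>Linear algebra\<close>

definition tr :: "('b::euclidean_space \<Rightarrow>\<^sub>L 'b) \<Rightarrow> real" where
  "tr A = (\<Sum>i\<in>Basis. A i \<bullet> i)"

definition adj :: "('a::euclidean_space \<Rightarrow>\<^sub>L 'b::euclidean_space) \<Rightarrow> 'b \<Rightarrow>\<^sub>L 'a" where
  "adj A = Blinfun (adjoint (blinfun_apply A))"

lemma linear_blinfun: "linear (blinfun_apply A)"
  by (simp add: bounded_linear.linear blinfun.bounded_linear_right)

lemma Blinfun_linear:
  fixes f :: "'a::euclidean_space \<Rightarrow> 'b::real_normed_vector"
  shows "linear f \<Longrightarrow> blinfun_apply (Blinfun f) = f"
  by (simp add: bounded_linear_Blinfun_apply linear_conv_bounded_linear)

lemma adj_right: "x \<bullet> adj A y = A x \<bullet> y"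
  unfolding adj_def by (simp add: Blinfun_linear adjoint_linear linear_blinfun adjoint_works)

lemma adj_left: "adj A y \<bullet> x = y \<bullet> A x"
  by (metis adj_right inner_commute)

lemma blinfun_inner_eqI:
  fixes A B :: "'a::real_normed_vector \<Rightarrow>\<^sub>L 'b::real_inner"
  shows "(\<And>x y. A x \<bullet> y = B x \<bullet> y) \<Longrightarrow> A = B"
  by (metis blinfun_eqI inner_commute vector_eq_rdot)

lemma adj_adj [simp]: "adj (adj A) = A"
  by (rule blinfun_inner_eqI) (simp add: adj_left adj_right)

lemma adj_unique:
  fixes A :: "'a::euclidean_space \<Rightarrow>\<^sub>L 'b::euclidean_space" and B :: "'b \<Rightarrow>\<^sub>L 'a"
  assumes "\<And>x y. A x \<bullet> y = x \<bullet> B y"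
  shows "adj A = B"
  by (rule blinfun_inner_eqI) (metis adj_left assms inner_commute)

lemma adj_compose: "adj (A o\<^sub>L B) = adj B o\<^sub>L adj A"
  by (rule adj_unique) (simp add: adj_right)

lemma adj_linear:
  "adj (A + B) = adj A + adj B" "adj (A - B) = adj A - adj B" "adj (- A) = - adj A"
  "adj (r *\<^sub>R A) = r *\<^sub>R adj A" "adj 0 = 0"
  by (rule adj_unique; simp add: blinfun.bilinear_simps inner_left_distrib inner_right_distrib
      inner_diff_left inner_diff_right adj_right)+

lemmas blinfun_compose_simps =
  bounded_bilinear.add_left[OF bounded_bilinear_blinfun_compose]
  bounded_bilinear.add_right[OF bounded_bilinear_blinfun_compose]
  bounded_bilinear.diff_left[OF bounded_bilinear_blinfun_compose]
  bounded_bilinear.diff_right[OF bounded_bilinear_blinfun_compose]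
  bounded_bilinear.minus_left[OF bounded_bilinear_blinfun_compose]
  bounded_bilinear.minus_right[OF bounded_bilinear_blinfun_compose]
  bounded_bilinear.scaleR_left[OF bounded_bilinear_blinfun_compose]
  bounded_bilinear.scaleR_right[OF bounded_bilinear_blinfun_compose]
  bounded_bilinear.zero_left[OF bounded_bilinear_blinfun_compose]
  bounded_bilinear.zero_right[OF bounded_bilinear_blinfun_compose]

lemma blinfun_compose_assoc: "(A o\<^sub>L B) o\<^sub>L C = A o\<^sub>L (B o\<^sub>L C)"
  by (rule blinfun_eqI) simp

lemma blinfun_compose_id [simp]: "A o\<^sub>L id_blinfun = A" "id_blinfun o\<^sub>L A = A"
  by (rule blinfun_eqI; simp)+

lemma tr_linear:
  "tr (A + B) = tr A + tr B" "tr (A - B) = tr A - tr B" "tr (- A) = - tr A"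
  "tr (r *\<^sub>R A) = r * tr A" "tr 0 = 0"
  by (simp_all add: tr_def blinfun.bilinear_simps inner_left_distrib inner_diff_left
      sum.distrib sum_subtractf sum_negf sum_distrib_left)

lemma blinfun_inner_expand: "A x \<bullet> y = (\<Sum>j\<in>Basis. (x \<bullet> j) * (A j \<bullet> y))"
  for A :: "'a::euclidean_space \<Rightarrow>\<^sub>L 'b::real_inner"
proof -
  have "A x = A (\<Sum>j\<in>Basis. (x \<bullet> j) *\<^sub>R j)" by (simp only: euclidean_representation)
  then show ?thesis by (simp add: blinfun.bilinear_simps inner_sum_left)
qed

lemma tr_compose_commute:
  fixes A :: "'a::euclidean_space \<Rightarrow>\<^sub>L 'b::euclidean_space" and B :: "'b \<Rightarrow>\<^sub>L 'a"
  shows "tr (A o\<^sub>L B) = tr (B o\<^sub>L A)"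
proof -
  have "tr (A o\<^sub>L B) = (\<Sum>i\<in>Basis. \<Sum>j\<in>Basis. (B i \<bullet> j) * (A j \<bullet> i))"
    unfolding tr_def blinfun_apply_blinfun_compose by (subst blinfun_inner_expand) simp
  also have "\<dots> = (\<Sum>j\<in>Basis. \<Sum>i\<in>Basis. (A j \<bullet> i) * (B i \<bullet> j))"
    by (subst sum.swap) (simp only: mult.commute)
  also have "\<dots> = tr (B o\<^sub>L A)"
    unfolding tr_def blinfun_apply_blinfun_compose by (subst (2) blinfun_inner_expand) simp
  finally show ?thesis .
qed

lemma tr_adj [simp]: "tr (adj A) = tr A"
  by (auto simp: tr_def adj_left intro!: sum.cong inner_commute)

lemma tr_adj_compose_self: "tr (adj A o\<^sub>L A) = (\<Sum>i\<in>Basis. (norm (A i))\<^sup>2)"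
  by (simp add: tr_def adj_left power2_norm_eq_inner)

lemma tr_adj_compose_self_nonneg: "tr (adj A o\<^sub>L A) \<ge> 0"
  by (simp add: tr_adj_compose_self sum_nonneg)

lemma tr_adj_compose_self_eq_0: "tr (adj A o\<^sub>L A) = 0 \<Longrightarrow> A = 0"
  by (rule blinfun_euclidean_eqI) (simp add: tr_adj_compose_self sum_nonneg_eq_0_iff)

text \<open>Cyclicity of the trace, which moves an operator across a contraction over an orthonormal
  basis.\<close>

lemma sum_inner_adj:
  fixes f g :: "'a::euclidean_space \<Rightarrow> 'b::euclidean_space" and E :: "'a \<Rightarrow>\<^sub>L 'a"
  assumes "linear f" "linear g"
  shows "(\<Sum>i\<in>Basis. f (E i) \<bullet> g i) = (\<Sum>i\<in>Basis. f i \<bullet> g (adj E i))"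
proof -
  let ?f = "Blinfun f" and ?g = "Blinfun g"
  have "(\<Sum>i\<in>Basis. f (E i) \<bullet> g i) = tr ((adj ?g o\<^sub>L ?f) o\<^sub>L E)"
    by (simp add: tr_def adj_left Blinfun_linear assms)
  also have "\<dots> = tr (E o\<^sub>L (adj ?g o\<^sub>L ?f))" by (rule tr_compose_commute)
  also have "\<dots> = (\<Sum>i\<in>Basis. f i \<bullet> g (adj E i))"
    unfolding tr_def
    by (rule sum.cong) (simp_all add: adj_right[of _ E, symmetric] adj_left[of ?g] Blinfun_linear assms)
  finally show ?thesis .
qed

section \<open>Orthogonal projections and operators lowering a filtration\<close>

lemma exists_orthogonal_projection:
  fixes S :: "'b::euclidean_space set"
  assumes "subspace S"
  shows "\<exists>p :: 'b \<Rightarrow>\<^sub>L 'b. (\<forall>x. p x \<in> S) \<and> (\<forall>x. \<forall>y\<in>S. (x - p x) \<bullet> y = 0)"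
proof -
  obtain B where B: "B \<subseteq> S" "pairwise orthogonal B" "\<And>x. x \<in> B \<Longrightarrow> norm x = 1"
    "independent B" "span B = S"
    using orthonormal_basis_subspace[OF assms] by metis
  have fin: "finite B" using B(4) independent_imp_finite by blast
  define p where "p x = (\<Sum>b\<in>B. (x \<bullet> b) *\<^sub>R b)" for x
  have "linear p" unfolding p_def
    by (auto intro!: linearI simp: inner_left_distrib scaleR_left_distrib sum.distrib scaleR_sum_right)
  then have p: "blinfun_apply (Blinfun p) = p" by (rule Blinfun_linear)
  have mem: "p x \<in> S" for x
    unfolding p_def using B(1) by (intro subspace_sum subspace_scale assms) auto
  have orth: "(x - p x) \<bullet> b = 0" if "b \<in> B" for x b
  proof -
    have "p x \<bullet> b = (\<Sum>c\<in>B. if c = b then x \<bullet> b else 0)"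
      unfolding p_def inner_sum_left
      by (rule sum.cong) (use B(2,3) that in \<open>auto simp: pairwise_def orthogonal_def norm_eq_1\<close>)
    then show ?thesis using fin that by (simp add: inner_diff_left)
  qed
  have "(x - p x) \<bullet> y = 0" if "y \<in> S" for x y
    using orthogonal_to_span[of y B "x - p x"] orth that B(5) by (auto simp: orthogonal_def)
  then show ?thesis using mem by (intro exI[of _ "Blinfun p"]) (simp add: p)
qed

definition proj :: "'b::euclidean_space set \<Rightarrow> 'b \<Rightarrow>\<^sub>L 'b" where
  "proj S = (SOME p :: 'b \<Rightarrow>\<^sub>L 'b. (\<forall>x. p x \<in> S) \<and> (\<forall>x. \<forall>y\<in>S. (x - p x) \<bullet> y = 0))"

context
  fixes S :: "'b::euclidean_space set"
  assumes S: "subspace S"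
begin

lemma proj_in: "proj S x \<in> S"
  and proj_orthogonal: "y \<in> S \<Longrightarrow> (x - proj S x) \<bullet> y = 0"
  using someI_ex[OF exists_orthogonal_projection[OF S]] by (auto simp: proj_def)

lemma proj_eqI: "y \<in> S \<Longrightarrow> (\<And>z. z \<in> S \<Longrightarrow> (x - y) \<bullet> z = 0) \<Longrightarrow> proj S x = y"
proof -
  assume y: "y \<in> S" "\<And>z. z \<in> S \<Longrightarrow> (x - y) \<bullet> z = 0"
  let ?d = "proj S x - y"
  have "?d \<in> S" using y(1) proj_in S by (intro subspace_diff)
  then have "(x - proj S x) \<bullet> ?d = 0" "(x - y) \<bullet> ?d = 0" using proj_orthogonal y by auto
  then have "?d \<bullet> ?d = 0" by (simp add: inner_diff_left)
  then show ?thesis by simp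
qed

lemma proj_id: "x \<in> S \<Longrightarrow> proj S x = x"
  by (rule proj_eqI) auto

lemma proj_idem [simp]: "proj S (proj S x) = proj S x"
  by (simp add: proj_id proj_in)

lemma proj_0: "(\<And>z. z \<in> S \<Longrightarrow> x \<bullet> z = 0) \<Longrightarrow> proj S x = 0"
  by (rule proj_eqI) (auto simp: subspace_0[OF S])

lemma proj_inner: "proj S x \<bullet> y = x \<bullet> proj S y"
proof -
  have "x \<bullet> proj S y = proj S x \<bullet> proj S y" "y \<bullet> proj S x = proj S y \<bullet> proj S x"
    using proj_orthogonal[OF proj_in, of x y] proj_orthogonal[OF proj_in, of y x]
    by (simp_all add: inner_diff_left)
  then show ?thesis by (metis inner_commute)
qed

lemma adj_proj: "adj (proj S) = proj S"
  by (rule adj_unique) (rule proj_inner)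

end

text \<open>The differences \<open>q k\<close> of consecutive projections project onto the graded
  pieces. Since \<open>N\<close> maps the \<open>k\<close>-th piece into the next subspace,
  \<open>q k\<close>, \<open>N\<close>, \<open>q k\<close> compose to zero; by cyclicity
  \<open>N\<close> after \<open>q k\<close> has trace zero, and the \<open>q k\<close> telescope to
  the identity.\<close>

lemma tr_filtered_nilpotent:
  fixes N :: "'b::euclidean_space \<Rightarrow>\<^sub>L 'b"
  assumes S: "\<And>k. subspace (S k)" "\<And>k. S (Suc k) \<subseteq> S k" "S 0 = UNIV" "S K = {0}"
    and N: "\<And>k x. x \<in> S k \<Longrightarrow> N x \<in> S (Suc k)"
  shows "tr N = 0"
proof -
  define q where "q k = proj (S k) - proj (S (Suc k))" for k
  have q: "q k x = proj (S k) x - proj (S (Suc k)) x" for k x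
    by (simp add: q_def blinfun.bilinear_simps)
  have mem: "proj (S (Suc k)) x \<in> S k" for k x
    using S(2) proj_in[OF S(1)] by (rule subsetD)
  have q_in: "q k x \<in> S k" for k x
    unfolding q by (intro subspace_diff S(1) mem proj_in)
  have q_0: "q k x = 0" if "x \<in> S (Suc k)" for k x
    unfolding q using S that proj_id[OF S(1)] by (auto simp: subset_eq)
  have sub: "proj (S (Suc k)) (proj (S k) x) = proj (S (Suc k)) x" for k x
  proof (rule proj_eqI[OF S(1) proj_in[OF S(1)]])
    fix z assume z: "z \<in> S (Suc k)"
    have "(x - proj (S (Suc k)) x) \<bullet> z = 0" by (rule proj_orthogonal[OF S(1) z])
    moreover have "(x - proj (S k) x) \<bullet> z = 0" using z S(2) by (intro proj_orthogonal[OF S(1)]) auto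
    ultimately show "(proj (S k) x - proj (S (Suc k)) x) \<bullet> z = 0" by (simp add: inner_diff_left)
  qed
  have idem: "q k (q k x) = q k x" for k x
    by (simp add: q blinfun.diff_right sub proj_idem[OF S(1)] proj_id[OF S(1) mem])
  have z: "tr (N o\<^sub>L q k) = 0" for k
  proof -
    have "tr (N o\<^sub>L q k) = tr ((N o\<^sub>L q k) o\<^sub>L q k)"
      by (rule arg_cong[where f=tr], rule blinfun_eqI) (simp add: idem)
    also have "\<dots> = tr (q k o\<^sub>L (N o\<^sub>L q k))" by (rule tr_compose_commute)
    also have "q k o\<^sub>L (N o\<^sub>L q k) = 0"
      by (rule blinfun_eqI) (simp add: q_0 N q_in)
    finally show ?thesis by (simp add: tr_linear)
  qed
  have "tr (N o\<^sub>L proj (S 0)) = tr (N o\<^sub>L proj (S k))" for k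
  proof (induction k)
    case (Suc k)
    then show ?case using z[of k] by (simp add: q_def blinfun_compose_simps tr_linear)
  qed simp
  moreover have "N o\<^sub>L proj (S 0) = N"
    by (rule blinfun_eqI) (simp add: S(3) proj_id)
  moreover have "N o\<^sub>L proj (S K) = 0"
    using proj_in[OF S(1), of K] by (intro blinfun_eqI) (simp add: S(4) blinfun.bilinear_simps)
  ultimately show ?thesis by (metis tr_linear(5))
qed

section \<open>Spectral theorem for symmetric operators\<close>

definition orthonormal_eigenbasis :: "('b::euclidean_space \<Rightarrow>\<^sub>L 'b) \<Rightarrow> 'b set \<Rightarrow> bool" where
  "orthonormal_eigenbasis D E \<longleftrightarrow> finite E \<and> pairwise orthogonal E \<and> (\<forall>e\<in>E. norm e = 1) \<and>
     span E = UNIV \<and> (\<forall>e\<in>E. D e = (D e \<bullet> e) *\<^sub>R e)"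

text \<open>A maximum of the Rayleigh quotient on the unit sphere of an invariant subspace is an
  eigenvector, and its orthogonal complement is invariant again. The induction runs over invariant
  subspaces of one fixed space, which avoids any change of type.\<close>

theorem exists_orthonormal_eigenbasis:
  fixes D :: "'b::euclidean_space \<Rightarrow>\<^sub>L 'b"
  assumes D: "\<And>x y. D x \<bullet> y = x \<bullet> D y"
  shows "\<exists>E. orthonormal_eigenbasis D E"
proof -
  have "\<exists>E. finite E \<and> pairwise orthogonal E \<and> (\<forall>e\<in>E. norm e = 1) \<and>
     span E = S \<and> (\<forall>e\<in>E. D e = (D e \<bullet> e) *\<^sub>R e)"
    if "subspace S" "\<And>x. x \<in> S \<Longrightarrow> D x \<in> S" for S
    using that
  proof (induction "dim S" arbitrary: S rule: less_induct)
    case less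
    note S = less.prems(1)
    show ?case
    proof (cases "S = {0}")
      case True
      then show ?thesis by (intro exI[of _ "{}"]) auto
    next
      case False
      let ?U = "sphere 0 1 \<inter> S"
      obtain z where z: "z \<in> S" "z \<noteq> 0" using False subspace_0[OF S] by auto
      have "(1 / norm z) *\<^sub>R z \<in> ?U" using z S by (simp add: subspace_scale)
      then have "?U \<noteq> {}" by blast
      moreover have "compact ?U" by (intro compact_Int_closed compact_sphere closed_subspace S)
      moreover have "continuous_on ?U (\<lambda>x. D x \<bullet> x)" by (intro continuous_intros)
      ultimately obtain e where e: "e \<in> ?U" and max: "\<And>x. x \<in> ?U \<Longrightarrow> D x \<bullet> x \<le> D e \<bullet> e"
        using continuous_attains_sup[of ?U "\<lambda>x. D x \<bullet> x"] by blast
      define l where "l = D e \<bullet> e"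
      have e1: "e \<bullet> e = 1" "norm e = 1" "e \<in> S" using e by (auto simp: norm_eq_1)
      have le: "D x \<bullet> x \<le> l * (x \<bullet> x)" if "x \<in> S" for x
      proof (cases "x = 0")
        case False
        have "D ((1 / norm x) *\<^sub>R x) \<bullet> ((1 / norm x) *\<^sub>R x) \<le> l"
          unfolding l_def using that False S by (intro max) (simp add: subspace_scale)
        then have "(D x \<bullet> x) / (norm x)\<^sup>2 \<le> l"
          by (simp add: blinfun.scaleR_right power2_eq_square)
        then show ?thesis using False
          by (simp add: pos_divide_le_eq power2_norm_eq_inner)
      qed simp
      define w where "w = D e - l *\<^sub>R e"
      have wS: "w \<in> S" unfolding w_def using less.prems e1 by (intro subspace_diff subspace_scale) auto
      have we: "w \<bullet> e = 0" by (simp add: w_def inner_diff_left e1 l_def)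
      have "D e = w + l *\<^sub>R e" by (simp add: w_def)
      then have Dew: "D e \<bullet> w = w \<bullet> w" using we by (simp add: inner_left_distrib inner_commute[of e])
      have "w = 0"
      proof (rule ccontr)
        assume "w \<noteq> 0"
        define c where "c = l * (w \<bullet> w) - D w \<bullet> w"
        \<comment> \<open>For this \<open>t\<close> the second-order loss \<open>t * c\<close> is at
          most \<open>w \<bullet> w\<close>, half of the first-order gain
          \<open>2 * (w \<bullet> w)\<close>; the \<open>1\<close> avoids division by zero.\<close>
        define t where "t = (w \<bullet> w) / (\<bar>c\<bar> + 1)"
        have ww: "w \<bullet> w > 0" using \<open>w \<noteq> 0\<close> by simp
        have "\<bar>c\<bar> * (w \<bullet> w) \<le> (w \<bullet> w) * (\<bar>c\<bar> + 1)" using ww by (simp add: distrib_left)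
        then have tc: "t * \<bar>c\<bar> \<le> w \<bullet> w" by (simp add: t_def pos_divide_le_eq mult.commute)
        have t: "t > 0" using ww by (simp add: t_def)
        have "D (e + t *\<^sub>R w) \<bullet> (e + t *\<^sub>R w) \<le> l * ((e + t *\<^sub>R w) \<bullet> (e + t *\<^sub>R w))"
          using wS e1 S by (intro le subspace_add subspace_scale)
        moreover have "D w \<bullet> e = w \<bullet> w" using Dew D[of w e] by (simp add: inner_commute)
        moreover have "D (e + t *\<^sub>R w) \<bullet> (e + t *\<^sub>R w)
            = D e \<bullet> e + t * (D e \<bullet> w) + t * (D w \<bullet> e) + t * t * (D w \<bullet> w)"
          by (simp add: blinfun.bilinear_simps inner_left_distrib inner_right_distrib distrib_left)
        moreover have "(e + t *\<^sub>R w) \<bullet> (e + t *\<^sub>R w) = 1 + t * t * (w \<bullet> w)"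
          using we e1 by (simp add: inner_left_distrib inner_right_distrib inner_commute[of e w])
        ultimately have "2 * t * (w \<bullet> w) \<le> t * t * c"
          using Dew by (simp add: l_def[symmetric] c_def right_diff_distrib distrib_left)
            (simp add: mult_ac)
        then have "t * (2 * (w \<bullet> w)) \<le> t * (t * c)" by (simp add: mult_ac)
        then have "2 * (w \<bullet> w) \<le> t * c" using t by simp
        also have "t * c \<le> t * \<bar>c\<bar>" using t by (intro mult_left_mono) auto
        also note tc
        finally show False using ww by simp
      qed
      then have De: "D e = l *\<^sub>R e" by (simp add: w_def)
      define T where "T = {x \<in> S. x \<bullet> e = 0}"
      have T: "subspace T" using S by (auto simp: T_def subspace_def inner_left_distrib)
      have "T \<subseteq> S" "e \<notin> T" using e1 by (auto simp: T_def)
      then have "T \<subset> S" using e1(3) by blast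
      then have "dim T < dim S" using dim_psubset[of T S] T S by (simp add: span_eq_iff[THEN iffD2])
      moreover have "D x \<in> T" if "x \<in> T" for x
        using that less.prems(2) by (auto simp: T_def D De)
      ultimately obtain E where E: "finite E" "pairwise orthogonal E" "\<forall>e\<in>E. norm e = 1"
        "span E = T" "\<forall>e\<in>E. D e = (D e \<bullet> e) *\<^sub>R e"
        using less.hyps[OF _ T] by blast
      have ET: "E \<subseteq> T" using E(4) span_superset by blast
      have "span (insert e E) = S"
      proof
        show "span (insert e E) \<subseteq> S"
          using ET e1 S by (intro span_minimal) (auto simp: T_def)
        show "S \<subseteq> span (insert e E)"
        proof
          fix x assume "x \<in> S"
          then have "x - (x \<bullet> e) *\<^sub>R e \<in> T"
            using e1 S by (auto simp: T_def inner_diff_left intro: subspace_diff subspace_scale)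
          then show "x \<in> span (insert e E)" using E(4) by (auto simp: span_insert)
        qed
      qed
      moreover have "pairwise orthogonal (insert e E)"
        using E(2) ET by (auto simp: pairwise_insert orthogonal_def T_def inner_commute)
      ultimately show ?thesis
        using E De e1 by (intro exI[of _ "insert e E"]) (auto simp: l_def)
    qed
  qed
  from this[of UNIV] show ?thesis by (simp add: orthonormal_eigenbasis_def)
qed

lemma orthonormal_eigenbasis_expand:
  assumes "orthonormal_eigenbasis D E"
  shows "(\<Sum>e\<in>E. (x \<bullet> e) *\<^sub>R e) = x"
  using assms by (intro orthonormal_basis_expand) (auto simp: orthonormal_eigenbasis_def)

lemma orthonormal_eigenbasis_inner:
  assumes "orthonormal_eigenbasis D E" "e \<in> E" "f \<in> E"
  shows "e \<bullet> f = (if e = f then 1 else 0)"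
  using assms by (auto simp: orthonormal_eigenbasis_def pairwise_def orthogonal_def norm_eq_1)

section \<open>Ricci curvature of a bracket\<close>

type_synonym 'b bracket = "'b \<Rightarrow>\<^sub>L 'b \<Rightarrow>\<^sub>L 'b"

definition bracket_of :: "('b::euclidean_space \<Rightarrow> 'b \<Rightarrow> 'b) \<Rightarrow> 'b bracket" where
  "bracket_of f = Blinfun (\<lambda>x. Blinfun (f x))"

lemma bracket_of_apply:
  assumes "\<And>y. linear (\<lambda>x. f x y)" "\<And>x. linear (f x)"
  shows "bracket_of f x y = f x y"
proof -
  have "linear (\<lambda>x. Blinfun (f x))"
    using assms by (intro linearI blinfun_eqI)
      (simp_all add: Blinfun_linear blinfun.bilinear_simps linear_add[OF assms(1)] linear_cmul[OF assms(1)])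
  then show ?thesis by (simp add: bracket_of_def Blinfun_linear assms)
qed

section \<open>Lie brackets, derivations and the action of operators\<close>

definition skew :: "'b::euclidean_space bracket \<Rightarrow> bool" where
  "skew \<mu> \<longleftrightarrow> (\<forall>x y. \<mu> x y = - \<mu> y x)"

lemma skewD: "skew \<mu> \<Longrightarrow> \<mu> x y = - \<mu> y x"
  unfolding skew_def by blast

lemma skew_self:
  assumes "skew \<mu>" shows "\<mu> x x = 0"
proof -
  have "\<mu> x x + \<mu> x x = 0"
    by (subst (1) skewD[OF assms]) (rule left_minus)
  then have "2 *\<^sub>R \<mu> x x = 0" by (simp only: scaleR_2)
  then show ?thesis by simp
qed

definition jacobi :: "'b::euclidean_space bracket \<Rightarrow> bool" where
  "jacobi \<mu> \<longleftrightarrow> (\<forall>x y z. \<mu> x (\<mu> y z) + \<mu> y (\<mu> z x) + \<mu> z (\<mu> x y) = 0)"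

definition derivation :: "'b::euclidean_space bracket \<Rightarrow> ('b \<Rightarrow>\<^sub>L 'b) \<Rightarrow> bool" where
  "derivation \<mu> D \<longleftrightarrow> (\<forall>x y. D (\<mu> x y) = \<mu> (D x) y + \<mu> x (D y))"

text \<open>The infinitesimal action of \<open>gl\<close> on brackets; derivations are the stabilizer.\<close>

definition act :: "('b \<Rightarrow>\<^sub>L 'b) \<Rightarrow> 'b::euclidean_space bracket \<Rightarrow> 'b bracket" where
  "act E \<mu> = bracket_of (\<lambda>x y. E (\<mu> x y) - \<mu> (E x) y - \<mu> x (E y))"

lemma act_apply: "act E \<mu> x y = E (\<mu> x y) - \<mu> (E x) y - \<mu> x (E y)"
  unfolding act_def
  by (rule bracket_of_apply; intro linearI; simp add: blinfun.bilinear_simps algebra_simps)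

lemma act_blinfun: "act E \<mu> x = (E o\<^sub>L \<mu> x) - \<mu> (E x) - (\<mu> x o\<^sub>L E)"
  by (rule blinfun_eqI) (simp add: act_apply blinfun.bilinear_simps)

lemma derivation_iff_act: "derivation \<mu> D \<longleftrightarrow> act D \<mu> = 0"
proof
  assume "derivation \<mu> D"
  then show "act D \<mu> = 0"
    by (intro blinfun_eqI) (simp add: act_apply derivation_def)
next
  assume "act D \<mu> = 0"
  then have "act D \<mu> x y = 0" for x y by simp
  then show "derivation \<mu> D" by (simp add: act_apply derivation_def algebra_simps)
qed

lemma bracket_eqI: "(\<And>x y. \<mu> x y = \<nu> x y) \<Longrightarrow> \<mu> = \<nu>" for \<mu> \<nu> :: "'b::euclidean_space bracket"
  by (intro blinfun_eqI) auto

lemma act_linear: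
  "act (A + B) \<mu> = act A \<mu> + act B \<mu>" "act (A - B) \<mu> = act A \<mu> - act B \<mu>"
  "act (r *\<^sub>R A) \<mu> = r *\<^sub>R act A \<mu>"
  by (rule bracket_eqI; simp add: act_apply blinfun.bilinear_simps algebra_simps)+

lemma act_commutator: "act ((A o\<^sub>L B) - (B o\<^sub>L A)) \<mu> = act A (act B \<mu>) - act B (act A \<mu>)"
  by (rule bracket_eqI) (simp add: act_apply blinfun.bilinear_simps algebra_simps)

lemma act_skew: "skew \<mu> \<Longrightarrow> skew (act E \<mu>)"
  unfolding skew_def act_apply
proof (intro allI)
  fix x y assume "\<forall>x y. \<mu> x y = - \<mu> y x"
  then have "\<mu> x y = - \<mu> y x" "\<mu> (E x) y = - \<mu> y (E x)" "\<mu> x (E y) = - \<mu> (E y) x" by blast+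
  then show "E (\<mu> x y) - \<mu> (E x) y - \<mu> x (E y) = - (E (\<mu> y x) - \<mu> (E y) x - \<mu> y (E x))"
    by (simp only: blinfun.minus_right) simp
qed

section \<open>Inner product of brackets and the Ricci operator\<close>

definition ip :: "'b::euclidean_space bracket \<Rightarrow> 'b bracket \<Rightarrow> real" where
  "ip \<mu> \<nu> = (\<Sum>i\<in>Basis. \<Sum>j\<in>Basis. \<mu> i j \<bullet> \<nu> i j)"

lemma ip_linear:
  "ip (\<mu> + \<mu>') \<nu> = ip \<mu> \<nu> + ip \<mu>' \<nu>" "ip (\<mu> - \<mu>') \<nu> = ip \<mu> \<nu> - ip \<mu>' \<nu>"
  "ip (r *\<^sub>R \<mu>) \<nu> = r * ip \<mu> \<nu>"
  "ip \<nu> (\<mu> + \<mu>') = ip \<nu> \<mu> + ip \<nu> \<mu>'" "ip \<nu> (\<mu> - \<mu>') = ip \<nu> \<mu> - ip \<nu> \<mu>'"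
  "ip \<nu> (r *\<^sub>R \<mu>) = r * ip \<nu> \<mu>" "ip 0 \<nu> = 0" "ip \<nu> 0 = 0"
  by (simp_all add: ip_def blinfun.bilinear_simps inner_left_distrib inner_diff_left
      inner_right_distrib inner_diff_right sum.distrib sum_subtractf sum_distrib_left)

lemma ip_commute: "ip \<mu> \<nu> = ip \<nu> \<mu>"
  by (simp add: ip_def inner_commute)

lemma ip_self: "ip \<mu> \<mu> = (\<Sum>i\<in>Basis. \<Sum>j\<in>Basis. (norm (\<mu> i j))\<^sup>2)"
  by (simp add: ip_def power2_norm_eq_inner)

lemma ip_self_nonneg: "ip \<mu> \<mu> \<ge> 0"
  by (simp add: ip_self sum_nonneg)

lemma ip_self_eq_0: "ip \<mu> \<mu> = 0 \<Longrightarrow> \<mu> = 0"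
  by (intro blinfun_euclidean_eqI)
    (auto simp: ip_self sum_nonneg sum_nonneg_eq_0_iff)

lemma linear_bracket_left: "linear (\<lambda>x. blinfun_apply (blinfun_apply \<mu> x) y)"
  by (intro linearI) (simp_all add: blinfun.bilinear_simps)

lemma ip_adj_left:
  "(\<Sum>i\<in>Basis. \<Sum>j\<in>Basis. \<mu> (E i) j \<bullet> \<nu> i j) = (\<Sum>i\<in>Basis. \<Sum>j\<in>Basis. \<mu> i j \<bullet> \<nu> (adj E i) j)"
  for E :: "'b::euclidean_space \<Rightarrow>\<^sub>L 'b" and \<mu> \<nu> :: "'b bracket"
  by (subst (1 2) sum.swap) (simp add: sum_inner_adj[OF linear_bracket_left linear_bracket_left])

lemma ip_adj_right:
  "(\<Sum>i\<in>Basis. \<Sum>j\<in>Basis. \<mu> i (E j) \<bullet> \<nu> i j) = (\<Sum>i\<in>Basis. \<Sum>j\<in>Basis. \<mu> i j \<bullet> \<nu> i (adj E j))"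
  for E :: "'b::euclidean_space \<Rightarrow>\<^sub>L 'b" and \<mu> \<nu> :: "'b bracket"
  by (simp add: sum_inner_adj[OF linear_blinfun linear_blinfun])

text \<open>The transpose of the action is the action of the transpose, so symmetric operators act
  symmetrically on brackets and skew ones act skewly.\<close>

lemma ip_act: "ip (act E \<mu>) \<nu> = ip \<mu> (act (adj E) \<nu>)"
  using ip_adj_left[of \<mu> E \<nu>] ip_adj_right[of \<mu> E \<nu>]
  by (simp add: ip_def act_apply inner_diff_left inner_diff_right sum_subtractf adj_right)

text \<open>The Ricci operator at the identity of a nilpotent metric Lie algebra. For a general
  bracket the Killing form and the trace of \<open>ad\<close> contribute as well; for nilpotent
  brackets both vanish, and \<open>sum_Rm\<close> identifies the operator with the trace of the
  curvature.\<close>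

definition Ric :: "'b::euclidean_space bracket \<Rightarrow> 'b \<Rightarrow>\<^sub>L 'b" where
  "Ric \<mu> = (\<Sum>i\<in>Basis. (1/4) *\<^sub>R (\<mu> i o\<^sub>L adj (\<mu> i)) - (1/2) *\<^sub>R (adj (\<mu> i) o\<^sub>L \<mu> i))"

lemma Ric_inner:
  "Ric \<mu> x \<bullet> y = (\<Sum>i\<in>Basis. (1/4) * (adj (\<mu> i) x \<bullet> adj (\<mu> i) y) - (1/2) * (\<mu> i x \<bullet> \<mu> i y))"
proof -
  have "\<mu> i (adj (\<mu> i) x) \<bullet> y = adj (\<mu> i) x \<bullet> adj (\<mu> i) y" for i by (simp only: adj_right)
  moreover have "adj (\<mu> i) (\<mu> i x) \<bullet> y = \<mu> i x \<bullet> \<mu> i y" for i by (simp only: adj_left)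
  ultimately show ?thesis
    by (simp add: Ric_def blinfun.sum_left blinfun.bilinear_simps inner_sum_left inner_diff_left)
qed

lemma Ric_self_adjoint: "Ric \<mu> x \<bullet> y = x \<bullet> Ric \<mu> y"
proof -
  have "Ric \<mu> x \<bullet> y = Ric \<mu> y \<bullet> x"
    unfolding Ric_inner by (intro sum.cong) (simp_all add: inner_commute)
  then show ?thesis by (simp only: inner_commute)
qed

lemma adj_Ric: "adj (Ric \<mu>) = Ric \<mu>"
  by (rule adj_unique) (rule Ric_self_adjoint)

lemma Ric_scaleR: "Ric (s *\<^sub>R \<mu>) = s\<^sup>2 *\<^sub>R Ric \<mu>"
  by (simp add: Ric_def blinfun.bilinear_simps adj_linear blinfun_compose_simps scaleR_sum_right
      scaleR_diff_right power2_eq_square mult.commute)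

text \<open>Kaplan's operators: for a skew bracket, the skew operator that represents the two-form
  \<open>(v, w) \<mapsto> u \<bullet> \<mu> v w\<close>.\<close>

definition Jop :: "'b::euclidean_space bracket \<Rightarrow> 'b \<Rightarrow> 'b \<Rightarrow>\<^sub>L 'b" where
  "Jop \<mu> u = Blinfun (\<lambda>v. adj (\<mu> v) u)"

lemma Jop_apply: "Jop \<mu> u v = adj (\<mu> v) u"
  unfolding Jop_def
  by (subst Blinfun_linear) (auto intro!: linearI simp: blinfun.bilinear_simps adj_linear)

lemma Jop_inner: "Jop \<mu> u v \<bullet> w = u \<bullet> \<mu> v w"
  by (simp add: Jop_apply adj_left)

text \<open>The Levi-Civita connection on left-invariant fields.\<close>

definition koszul :: "'b::euclidean_space bracket \<Rightarrow> 'b \<Rightarrow> 'b \<Rightarrow>\<^sub>L 'b" where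
  "koszul \<mu> u = (1/2) *\<^sub>R (\<mu> u - adj (\<mu> u) - Jop \<mu> u)"

lemma koszul_inner: "koszul \<mu> u v \<bullet> w = (\<mu> u v \<bullet> w - v \<bullet> \<mu> u w - u \<bullet> \<mu> v w) / 2"
  by (simp add: koszul_def blinfun.bilinear_simps inner_diff_left adj_left Jop_inner)

lemma koszul_linear:
  "koszul \<mu> (x + y) = koszul \<mu> x + koszul \<mu> y" "koszul \<mu> (x - y) = koszul \<mu> x - koszul \<mu> y"
  "koszul \<mu> (r *\<^sub>R x) = r *\<^sub>R koszul \<mu> x" "koszul \<mu> (- x) = - koszul \<mu> x"
  by (rule blinfun_inner_eqI;
      simp add: koszul_inner blinfun.bilinear_simps inner_left_distrib inner_right_distrib
      inner_diff_left inner_diff_right field_simps)+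

lemma koszul_skew:
  assumes "skew \<mu>" shows "koszul \<mu> u v \<bullet> w = - (v \<bullet> koszul \<mu> u w)"
proof -
  have "koszul \<mu> u v \<bullet> w = - (koszul \<mu> u w \<bullet> v)"
    using skewD[OF assms, of v w]
    by (simp add: koszul_inner inner_commute[of v] inner_commute[of w] field_simps)
  then show ?thesis by (simp only: inner_commute)
qed

lemma koszul_torsion: "skew \<mu> \<Longrightarrow> koszul \<mu> u v - koszul \<mu> v u = \<mu> u v"
proof (rule vector_eq_rdot[THEN iffD1, rule_format])
  fix w assume s: "skew \<mu>"
  show "(koszul \<mu> u v - koszul \<mu> v u) \<bullet> w = \<mu> u v \<bullet> w"
    using skewD[OF s, of v u] by (simp add: inner_diff_left koszul_inner field_simps)
qed

text \<open>Uniqueness of the Levi-Civita connection: skewness and torsion give the Koszul formula.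
  It holds for every bracket, in particular for \<open>act (T x) \<mu>\<close>, which need not
  satisfy the Jacobi identity.\<close>

lemma koszul_unique:
  fixes \<alpha> :: "'b::euclidean_space \<Rightarrow> 'b \<Rightarrow>\<^sub>L 'b" and \<mu> :: "'b bracket"
  assumes "\<And>u v w. \<alpha> u v \<bullet> w = - (v \<bullet> \<alpha> u w)" and "\<And>u v. \<alpha> u v - \<alpha> v u = \<mu> u v"
  shows "\<alpha> u = koszul \<mu> u"
proof (rule blinfun_inner_eqI)
  fix v w
  have "koszul \<mu> u v \<bullet> w = ((\<alpha> u v - \<alpha> v u) \<bullet> w - v \<bullet> (\<alpha> u w - \<alpha> w u) - u \<bullet> (\<alpha> v w - \<alpha> w v)) / 2"
    by (simp add: koszul_inner assms(2))
  also have "\<dots> = \<alpha> u v \<bullet> w"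
    using assms(1)[of u v w] assms(1)[of v u w] assms(1)[of w v u]
    by (simp add: inner_diff_left inner_diff_right inner_commute)
  finally show "\<alpha> u v \<bullet> w = koszul \<mu> u v \<bullet> w" by simp
qed

text \<open>\<open>koszul\<close> is built from bracket and inner product alone and is thus
  equivariant under orthogonal maps; this is the infinitesimal version.\<close>

lemma koszul_act_skew:
  fixes A :: "'b::euclidean_space \<Rightarrow>\<^sub>L 'b"
  assumes A: "\<And>x y. A x \<bullet> y = - (x \<bullet> A y)"
  shows "koszul (act A \<mu>) v = (A o\<^sub>L koszul \<mu> v) - (koszul \<mu> v o\<^sub>L A) - koszul \<mu> (A v)"
proof (rule blinfun_inner_eqI)
  fix x y
  have "koszul (act A \<mu>) v x \<bullet> y
      = (- (\<mu> v x \<bullet> A y) - \<mu> (A v) x \<bullet> y - \<mu> v (A x) \<bullet> y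
       + A x \<bullet> \<mu> v y + x \<bullet> \<mu> (A v) y + x \<bullet> \<mu> v (A y)
       + A v \<bullet> \<mu> x y + v \<bullet> \<mu> (A x) y + v \<bullet> \<mu> x (A y)) / 2"
    by (simp add: koszul_inner act_apply inner_diff_left inner_diff_right A)
  also have "\<dots> = - (koszul \<mu> v x \<bullet> A y) - koszul \<mu> v (A x) \<bullet> y - koszul \<mu> (A v) x \<bullet> y"
    unfolding koszul_inner by (simp add: field_simps)
  also have "- (koszul \<mu> v x \<bullet> A y) = A (koszul \<mu> v x) \<bullet> y" by (simp add: A)
  finally show "koszul (act A \<mu>) v x \<bullet> y = ((A o\<^sub>L koszul \<mu> v) - (koszul \<mu> v o\<^sub>L A) - koszul \<mu> (A v)) x \<bullet> y"
    by (simp add: blinfun.diff_left inner_diff_left)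
qed

text \<open>The curvature of \<open>\<mu>\<close> is \<open>Rm \<mu> \<mu>\<close>, its derivative in direction \<open>\<nu>\<close> is \<open>Rm \<mu> \<nu> + Rm \<nu> \<mu>\<close>.\<close>

definition Rm :: "'b::euclidean_space bracket \<Rightarrow> 'b bracket \<Rightarrow> 'b \<Rightarrow> 'b \<Rightarrow> 'b \<Rightarrow> 'b" where
  "Rm \<mu> \<nu> u v w = koszul \<mu> u (koszul \<nu> v w) - koszul \<mu> v (koszul \<nu> u w) - koszul \<mu> (\<nu> u v) w"

text \<open>Polarized Ricci form: what the trace of \<open>Rm \<mu> \<nu> + Rm \<nu> \<mu>\<close>
  retains after the mixed \<open>Jop\<close> terms and the Killing-type terms have
  cancelled.\<close>

definition ricf :: "'b::euclidean_space bracket \<Rightarrow> 'b bracket \<Rightarrow> 'b \<Rightarrow> 'b \<Rightarrow> real" where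
  "ricf \<mu> \<nu> v w = - tr (adj (\<mu> w) o\<^sub>L \<nu> v) / 2 - tr (Jop \<nu> w o\<^sub>L Jop \<mu> v) / 4"

lemma Jop_adj: "skew \<mu> \<Longrightarrow> adj (Jop \<mu> u) = - Jop \<mu> u"
proof (rule adj_unique)
  fix x y assume s: "skew \<mu>"
  show "Jop \<mu> u x \<bullet> y = x \<bullet> (- Jop \<mu> u) y"
    using skewD[OF s, of x y] by (subst inner_commute[of x]) (simp add: Jop_inner blinfun.bilinear_simps)
qed

text \<open>Vanishing torsion moves the summation variable to the right,
  \<open>koszul \<kappa> u w = (koszul \<kappa> w - \<kappa> w) u\<close>, so the sums become traces
  of products. The term contracting \<open>u\<close> with the direction of differentiation is a
  trace of \<open>ad\<close> and drops out by unimodularity.\<close>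

lemma tr_Rm:
  fixes \<mu> \<nu> :: "'b::euclidean_space bracket"
  assumes \<mu>: "skew \<mu>" and \<nu>: "skew \<nu>" and unimod: "\<And>z. tr (\<mu> z) = 0"
  shows "(\<Sum>u\<in>Basis. Rm \<mu> \<nu> u v w \<bullet> u) =
    tr (Jop \<nu> w o\<^sub>L \<mu> v) / 2 - tr (Jop \<nu> w o\<^sub>L Jop \<mu> v) / 4
    - (tr (\<mu> w o\<^sub>L \<nu> v) + tr (adj (\<mu> w) o\<^sub>L \<nu> v) + tr (Jop \<mu> w o\<^sub>L \<nu> v)) / 2"
proof -
  have 1: "(\<Sum>u\<in>Basis. koszul \<mu> u z \<bullet> u) = 0" for z
  proof -
    have "koszul \<mu> u z \<bullet> u = - (\<mu> z u \<bullet> u)" for u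
      using skewD[OF \<mu>, of u z]
      by (simp add: koszul_inner skew_self[OF \<mu>] inner_commute[of u "\<mu> z u"])
    then have "(\<Sum>u\<in>Basis. koszul \<mu> u z \<bullet> u) = - tr (\<mu> z)"
      by (simp add: tr_def sum_negf)
    then show ?thesis by (simp add: unimod)
  qed
  have M: "koszul \<kappa> u w = (koszul \<kappa> w - \<kappa> w) u" if "skew \<kappa>" for \<kappa> u w
    using koszul_torsion[OF that, of u w] skewD[OF that, of u w]
    by (simp add: blinfun.bilinear_simps algebra_simps)
  have M': "koszul \<kappa> w - \<kappa> w = (1/2) *\<^sub>R (- \<kappa> w - adj (\<kappa> w) - Jop \<kappa> w)" for \<kappa> and w :: 'b
    by (rule blinfun_eqI)
      (simp add: koszul_def blinfun.bilinear_simps scaleR_diff_right scaleR_add_right algebra_simps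
       flip: scaleR_left.add)
  have 2: "(\<Sum>u\<in>Basis. koszul \<mu> v (koszul \<nu> u w) \<bullet> u) = - tr (adj (koszul \<nu> w - \<nu> w) o\<^sub>L koszul \<mu> v)"
  proof -
    have "koszul \<mu> v (koszul \<nu> u w) \<bullet> u = - (((adj (koszul \<nu> w - \<nu> w) o\<^sub>L koszul \<mu> v) u) \<bullet> u)" for u
    proof -
      have "koszul \<mu> v (koszul \<nu> u w) \<bullet> u = - (koszul \<nu> u w \<bullet> koszul \<mu> v u)"
        by (rule koszul_skew[OF \<mu>])
      also have "koszul \<nu> u w \<bullet> koszul \<mu> v u = adj (koszul \<nu> w - \<nu> w) (koszul \<mu> v u) \<bullet> u"
        unfolding M[OF \<nu>] by (subst inner_commute) (simp only: adj_left)
      finally show ?thesis by simp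
    qed
    then show ?thesis by (simp add: tr_def sum_negf)
  qed
  have 3: "(\<Sum>u\<in>Basis. koszul \<mu> (\<nu> u v) w \<bullet> u) = - tr ((koszul \<mu> w - \<mu> w) o\<^sub>L \<nu> v)"
  proof -
    have "koszul \<mu> (\<nu> u v) w \<bullet> u = - (((koszul \<mu> w - \<mu> w) o\<^sub>L \<nu> v) u \<bullet> u)" for u
      unfolding M[OF \<mu>] skewD[OF \<nu>, of u v] by (simp only: blinfun.minus_right inner_minus_left) simp
    then show ?thesis by (simp add: tr_def sum_negf)
  qed
  have "(\<Sum>u\<in>Basis. Rm \<mu> \<nu> u v w \<bullet> u)
    = tr (adj (koszul \<nu> w - \<nu> w) o\<^sub>L koszul \<mu> v) + tr ((koszul \<mu> w - \<mu> w) o\<^sub>L \<nu> v)"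
    unfolding Rm_def inner_diff_left sum_subtractf 1 2 3 by simp
  moreover have "tr (adj (koszul \<nu> w - \<nu> w) o\<^sub>L koszul \<mu> v) =
    tr (Jop \<nu> w o\<^sub>L \<mu> v) / 2 - tr (Jop \<nu> w o\<^sub>L Jop \<mu> v) / 4"
  proof -
    have t1: "tr (adj (\<nu> w) o\<^sub>L \<mu> v) = tr (\<nu> w o\<^sub>L adj (\<mu> v))"
      using tr_adj[of "adj (\<nu> w) o\<^sub>L \<mu> v"] tr_compose_commute[of "adj (\<mu> v)" "\<nu> w"] by (simp add: adj_compose)
    have t2: "tr (adj (\<nu> w) o\<^sub>L adj (\<mu> v)) = tr (\<nu> w o\<^sub>L \<mu> v)"
      using tr_adj[of "\<mu> v o\<^sub>L \<nu> w"] tr_compose_commute[of "\<mu> v" "\<nu> w"] by (simp add: adj_compose)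
    have t3: "tr (adj (\<nu> w) o\<^sub>L Jop \<mu> v) = - tr (\<nu> w o\<^sub>L Jop \<mu> v)"
      using tr_adj[of "adj (\<nu> w) o\<^sub>L Jop \<mu> v"] tr_compose_commute[of "Jop \<mu> v" "\<nu> w"]
      by (simp add: adj_compose Jop_adj[OF \<mu>] blinfun_compose_simps tr_linear)
    have t4: "tr (Jop \<nu> w o\<^sub>L adj (\<mu> v)) = - tr (Jop \<nu> w o\<^sub>L \<mu> v)"
      using tr_adj[of "Jop \<nu> w o\<^sub>L adj (\<mu> v)"] tr_compose_commute[of "\<mu> v" "Jop \<nu> w"]
      by (simp add: adj_compose Jop_adj[OF \<nu>] blinfun_compose_simps tr_linear)
    show ?thesis
      unfolding M' koszul_def
      by (simp add: adj_linear blinfun_compose_simps tr_linear Jop_adj[OF \<nu>] t1 t2 t3 t4)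
        (simp add: field_simps)
  qed
  moreover have "tr ((koszul \<mu> w - \<mu> w) o\<^sub>L \<nu> v) =
    - (tr (\<mu> w o\<^sub>L \<nu> v) + tr (adj (\<mu> w) o\<^sub>L \<nu> v) + tr (Jop \<mu> w o\<^sub>L \<nu> v)) / 2"
    unfolding M' by (simp add: blinfun_compose_simps tr_linear)
  ultimately show ?thesis by linarith
qed

lemma ricf_Ric:
  assumes "skew \<mu>"
  shows "ricf \<mu> \<mu> v w = Ric \<mu> v \<bullet> w"
proof -
  have 1: "tr (adj (\<mu> w) o\<^sub>L \<mu> v) = (\<Sum>i\<in>Basis. \<mu> i v \<bullet> \<mu> i w)"
    unfolding tr_def
    by (rule sum.cong) (simp_all add: adj_left skewD[OF assms, of v] skewD[OF assms, of w] blinfun.bilinear_simps)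
  have 2: "tr (Jop \<mu> w o\<^sub>L Jop \<mu> v) = - (\<Sum>i\<in>Basis. adj (\<mu> i) v \<bullet> adj (\<mu> i) w)"
  proof -
    have "Jop \<mu> w (Jop \<mu> v i) \<bullet> i = - (adj (\<mu> i) v \<bullet> adj (\<mu> i) w)" for i
    proof -
      have "Jop \<mu> w (Jop \<mu> v i) \<bullet> i = Jop \<mu> v i \<bullet> adj (Jop \<mu> w) i" by (simp add: adj_right)
      then show ?thesis by (simp add: Jop_adj[OF assms] blinfun.bilinear_simps Jop_apply)
    qed
    then show ?thesis by (simp add: tr_def sum_negf)
  qed
  show ?thesis
    by (simp add: ricf_def 1 2 Ric_inner sum_subtractf sum_distrib_left sum_divide_distrib)
qed

text \<open>The moment map identity in polarized form. The \<open>Jop\<close> trace yields the term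
  of \<open>act E \<mu>\<close> with \<open>E\<close> outside the bracket; the adjoint trace yields
  the two others, which coincide by skewness. This explains the weights 1/4 and 1/2.\<close>

lemma ricf_contract:
  fixes E :: "'b::euclidean_space \<Rightarrow>\<^sub>L 'b"
  assumes "skew \<mu>" "skew \<nu>"
  shows "(\<Sum>v\<in>Basis. ricf \<mu> \<nu> v (E v)) = ip (act E \<mu>) \<nu> / 4"
proof -
  have 1: "(\<Sum>v\<in>Basis. tr (adj (\<mu> (E v)) o\<^sub>L \<nu> v)) = (\<Sum>v\<in>Basis. \<Sum>i\<in>Basis. \<mu> (E v) i \<bullet> \<nu> v i)"
    by (auto simp: tr_def adj_left intro!: sum.cong inner_commute)
  have "tr (Jop \<nu> (E v) o\<^sub>L Jop \<mu> v) = - (\<Sum>i\<in>Basis. \<Sum>k\<in>Basis. (v \<bullet> \<mu> i k) * (v \<bullet> adj E (\<nu> i k)))" for v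
  proof -
    have "Jop \<nu> (E v) (Jop \<mu> v i) \<bullet> i = - (Jop \<mu> v i \<bullet> Jop \<nu> (E v) i)" for i
    proof -
      have "Jop \<nu> (E v) (Jop \<mu> v i) \<bullet> i = Jop \<mu> v i \<bullet> adj (Jop \<nu> (E v)) i" by (simp add: adj_right)
      then show ?thesis by (simp add: Jop_adj[OF assms(2)] blinfun.bilinear_simps)
    qed
    moreover have "Jop \<mu> v i \<bullet> Jop \<nu> (E v) i = (\<Sum>k\<in>Basis. (v \<bullet> \<mu> i k) * (v \<bullet> adj E (\<nu> i k)))" for i
      by (subst euclidean_inner) (simp add: Jop_inner adj_right)
    ultimately show ?thesis by (simp add: tr_def sum_negf)
  qed
  then have "(\<Sum>v\<in>Basis. tr (Jop \<nu> (E v) o\<^sub>L Jop \<mu> v))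
    = - (\<Sum>v\<in>Basis. \<Sum>i\<in>Basis. \<Sum>k\<in>Basis. (v \<bullet> \<mu> i k) * (v \<bullet> adj E (\<nu> i k)))"
    by (simp add: sum_negf)
  also have "(\<Sum>v\<in>Basis. \<Sum>i\<in>Basis. \<Sum>k\<in>Basis. (v \<bullet> \<mu> i k) * (v \<bullet> adj E (\<nu> i k)))
    = (\<Sum>i\<in>Basis. \<Sum>k\<in>Basis. \<Sum>v\<in>Basis. (v \<bullet> \<mu> i k) * (v \<bullet> adj E (\<nu> i k)))"
    by (subst sum.swap, rule sum.cong[OF refl], rule sum.swap)
  also have "\<dots> = (\<Sum>i\<in>Basis. \<Sum>k\<in>Basis. E (\<mu> i k) \<bullet> \<nu> i k)"
  proof -
    have "(\<Sum>v\<in>Basis. (v \<bullet> x) * (v \<bullet> adj E y)) = E x \<bullet> y" for x y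
    proof -
      have "E x \<bullet> y = x \<bullet> adj E y" by (simp only: adj_right)
      also have "\<dots> = (\<Sum>v\<in>Basis. (x \<bullet> v) * (adj E y \<bullet> v))" by (rule euclidean_inner)
      finally show ?thesis by (simp only: inner_commute)
    qed
    then show ?thesis by simp
  qed
  finally have 2: "(\<Sum>v\<in>Basis. tr (Jop \<nu> (E v) o\<^sub>L Jop \<mu> v)) = - (\<Sum>i\<in>Basis. \<Sum>k\<in>Basis. E (\<mu> i k) \<bullet> \<nu> i k)" .
  have 3: "(\<Sum>i\<in>Basis. \<Sum>j\<in>Basis. \<mu> i (E j) \<bullet> \<nu> i j) = (\<Sum>i\<in>Basis. \<Sum>j\<in>Basis. \<mu> (E i) j \<bullet> \<nu> i j)"
  proof -
    have "\<mu> i (E j) \<bullet> \<nu> i j = \<mu> (E j) i \<bullet> \<nu> j i" for i j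
      using skewD[OF assms(1), of i "E j"] skewD[OF assms(2), of i j] by simp
    then show ?thesis by (subst sum.swap) simp
  qed
  show ?thesis
    by (simp add: ricf_def sum_subtractf sum_negf flip: sum_divide_distrib)
      (simp add: 1 2 ip_def act_apply inner_diff_left sum_subtractf 3)
qed

text \<open>The Ricci operator is a moment map for the action of \<open>gl\<close> on brackets.\<close>

lemma tr_Ric:
  assumes "skew \<mu>"
  shows "tr (Ric \<mu> o\<^sub>L E) = ip (act E \<mu>) \<mu> / 4"
proof -
  have "tr (Ric \<mu> o\<^sub>L E) = tr (E o\<^sub>L Ric \<mu>)" by (rule tr_compose_commute)
  also have "\<dots> = (\<Sum>v\<in>Basis. ricf \<mu> \<mu> v (adj E v))"
    unfolding tr_def by (simp add: ricf_Ric[OF assms] adj_right)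
  also have "\<dots> = ip (act E \<mu>) \<mu> / 4"
    using ricf_contract[OF assms assms, of "adj E"] ip_act[of "adj E" \<mu> \<mu>] ip_commute[of \<mu> "act E \<mu>"]
    by simp
  finally show ?thesis .
qed

section \<open>Nilpotent brackets and vanishing traces\<close>

definition nilpotent_bracket :: "'b::euclidean_space bracket \<Rightarrow> bool" where
  "nilpotent_bracket \<mu> \<longleftrightarrow> skew \<mu> \<and> jacobi \<mu> \<and> (\<exists>k. lower_central_series UNIV (\<lambda>x y. \<mu> x y) k = {0})"

lemma ad_derivation:
  assumes "skew \<mu>" "jacobi \<mu>" shows "derivation \<mu> (\<mu> x)"
  unfolding derivation_def
proof (intro allI)
  fix y z
  have "\<mu> x (\<mu> y z) + \<mu> y (\<mu> z x) + \<mu> z (\<mu> x y) = 0" using assms(2) unfolding jacobi_def by blast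
  moreover have "\<mu> y (\<mu> z x) = - \<mu> y (\<mu> x z)"
    by (subst skewD[OF assms(1), of z x]) (simp only: blinfun.minus_right)
  moreover have "\<mu> z (\<mu> x y) = - \<mu> (\<mu> x y) z" by (rule skewD[OF assms(1)])
  ultimately show "\<mu> x (\<mu> y z) = \<mu> (\<mu> x y) z + \<mu> y (\<mu> x z)"
    by (simp add: algebra_simps)
qed

lemma subspace_lower_central_series: "subspace L \<Longrightarrow> subspace (lower_central_series L br k)"
  by (cases k) auto

lemma lower_central_series_decreasing:
  "lower_central_series UNIV br (Suc k) \<subseteq> lower_central_series UNIV br k"
proof (induction k)
  case (Suc k)
  then show ?case by (simp only: lower_central_series.simps) (intro span_mono; blast)
qed simp

lemma derivation_lower_central_series:
  assumes "derivation \<mu> D"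
  shows "x \<in> lower_central_series UNIV (\<lambda>x y. \<mu> x y) k \<Longrightarrow>
    D x \<in> lower_central_series UNIV (\<lambda>x y. \<mu> x y) k"
proof (induction k arbitrary: x)
  case (Suc k)
  let ?X = "{\<mu> x y | x y. x \<in> UNIV \<and> y \<in> lower_central_series UNIV (\<lambda>x y. \<mu> x y) k}"
  have "span ?X \<subseteq> {x. D x \<in> span ?X}"
  proof (rule span_minimal)
    show "?X \<subseteq> {x. D x \<in> span ?X}"
    proof clarify
      fix a b assume b: "b \<in> lower_central_series UNIV (\<lambda>x y. \<mu> x y) k"
      have "D (\<mu> a b) = \<mu> (D a) b + \<mu> a (D b)" using assms unfolding derivation_def by blast
      moreover have "\<mu> (D a) b \<in> ?X" "\<mu> a (D b) \<in> ?X" using b Suc.IH by blast+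
      ultimately show "D (\<mu> a b) \<in> span ?X" by (simp only: span_add span_base)
    qed
    show "subspace {x. D x \<in> span ?X}"
      by (auto simp: subspace_def blinfun.bilinear_simps intro: span_add span_scale span_zero)
  qed
  then show ?case using Suc.prems by auto
qed simp

text \<open>\<open>\<mu> z\<close> pushes the lower central series one step down and
  \<open>A\<close> preserves it. With \<open>A\<close> the identity this gives unimodularity, with
  \<open>A\<close> an inner derivation the vanishing of the Killing form.\<close>

lemma nilpotent_bracket_trace:
  fixes A :: "'b::euclidean_space \<Rightarrow>\<^sub>L 'b"
  assumes "nilpotent_bracket \<mu>"
    and "\<And>k x. x \<in> lower_central_series UNIV (\<lambda>x y. \<mu> x y) k \<Longrightarrow>
          A x \<in> lower_central_series UNIV (\<lambda>x y. \<mu> x y) k"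
  shows "tr (A o\<^sub>L \<mu> z) = 0"
proof -
  let ?S = "lower_central_series UNIV (\<lambda>x y. \<mu> x y)"
  obtain K where "?S K = {0}" using assms(1) by (auto simp: nilpotent_bracket_def)
  moreover have "(A o\<^sub>L \<mu> z) x \<in> ?S (Suc k)" if "x \<in> ?S k" for k x
  proof -
    have "\<mu> z x \<in> ?S (Suc k)" using that by (auto intro: span_base)
    then show ?thesis using assms(2)[of "\<mu> z x" "Suc k"] by simp
  qed
  ultimately show ?thesis
    by (intro tr_filtered_nilpotent[where S="?S"] lower_central_series_decreasing
        subspace_lower_central_series) auto
qed

context
  fixes \<mu> :: "'b::euclidean_space bracket"
  assumes nil: "nilpotent_bracket \<mu>"
begin

lemma nil_skew: "skew \<mu>" and nil_jacobi: "jacobi \<mu>"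
  using nil by (auto simp: nilpotent_bracket_def)

lemma tr_ad: "tr (\<mu> z) = 0"
  using nilpotent_bracket_trace[OF nil, of id_blinfun z] by simp

lemma tr_derivation_ad: "derivation \<mu> D \<Longrightarrow> tr (D o\<^sub>L \<mu> z) = 0"
  by (rule nilpotent_bracket_trace[OF nil derivation_lower_central_series])

lemma tr_ad_ad: "tr (\<mu> y o\<^sub>L \<mu> z) = 0"
  by (rule tr_derivation_ad[OF ad_derivation[OF nil_skew nil_jacobi]])

lemma sum_Rm: "(\<Sum>u\<in>Basis. Rm \<mu> \<mu> u v w \<bullet> u) = Ric \<mu> v \<bullet> w"
  unfolding tr_Rm[OF nil_skew nil_skew tr_ad] ricf_Ric[OF nil_skew, symmetric] ricf_def
  by (simp add: tr_ad_ad field_simps)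

text \<open>Tracing the hypothesis makes the Ricci form stationary. Contraction with
  \<open>E\<close> then produces the wanted inner product twice: once directly, and once after the
  symmetric \<open>E\<close> is moved to the other side.\<close>

lemma act_orthogonal_if_curvature_stationary:
  assumes R: "\<And>u v w. Rm \<mu> (act T \<mu>) u v w + Rm (act T \<mu>) \<mu> u v w = 0"
    and E: "adj E = E"
  shows "ip (act E \<mu>) (act T \<mu>) = 0"
proof -
  let ?\<tau> = "act T \<mu>"
  have \<tau>: "skew ?\<tau>" by (rule act_skew[OF nil_skew])
  have unimod: "tr (?\<tau> z) = 0" for z
    by (simp add: act_blinfun tr_linear tr_ad tr_compose_commute[of T])
  have k1: "tr (\<mu> w o\<^sub>L ?\<tau> v) = tr (\<mu> w o\<^sub>L (T o\<^sub>L \<mu> v)) - tr (\<mu> w o\<^sub>L (\<mu> v o\<^sub>L T))" for v w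
    by (simp add: act_blinfun blinfun_compose_simps tr_linear tr_ad_ad)
  have k2: "tr (?\<tau> w o\<^sub>L \<mu> v) = tr (T o\<^sub>L (\<mu> w o\<^sub>L \<mu> v)) - tr (\<mu> w o\<^sub>L (T o\<^sub>L \<mu> v))" for v w
    by (simp add: act_blinfun blinfun_compose_simps tr_linear tr_ad_ad blinfun_compose_assoc)
  \<comment> \<open>First variation of the Killing form, which is zero along the whole orbit of a
    nilpotent bracket under the general linear group.\<close>
  have killing: "tr (\<mu> w o\<^sub>L ?\<tau> v) + tr (?\<tau> w o\<^sub>L \<mu> v) = 0" for v w
    using tr_compose_commute[of T "\<mu> w o\<^sub>L \<mu> v"] by (simp add: k1 k2 blinfun_compose_assoc)
  have "ricf \<mu> ?\<tau> v w + ricf ?\<tau> \<mu> v w = 0" for v w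
  proof -
    have "0 = (\<Sum>u\<in>Basis. (Rm \<mu> ?\<tau> u v w + Rm ?\<tau> \<mu> u v w) \<bullet> u)" by (simp add: R)
    also have "\<dots> = (\<Sum>u\<in>Basis. Rm \<mu> ?\<tau> u v w \<bullet> u) + (\<Sum>u\<in>Basis. Rm ?\<tau> \<mu> u v w \<bullet> u)"
      by (simp only: inner_left_distrib sum.distrib)
    also have "\<dots> = ricf \<mu> ?\<tau> v w + ricf ?\<tau> \<mu> v w"
      unfolding tr_Rm[OF nil_skew \<tau> tr_ad] tr_Rm[OF \<tau> nil_skew unimod] ricf_def
      using killing[of w v] by (simp add: field_simps)
    finally show ?thesis by simp
  qed
  then have "(\<Sum>v\<in>Basis. ricf \<mu> ?\<tau> v (E v)) + (\<Sum>v\<in>Basis. ricf ?\<tau> \<mu> v (E v)) = 0"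
    by (simp add: sum.distrib[symmetric])
  then have "ip (act E \<mu>) ?\<tau> + ip (act E ?\<tau>) \<mu> = 0"
    by (simp add: ricf_contract nil_skew \<tau>)
  moreover have "ip (act E ?\<tau>) \<mu> = ip (act E \<mu>) ?\<tau>"
    using ip_act[of E ?\<tau> \<mu>] ip_commute[of ?\<tau> "act E \<mu>"] E by simp
  ultimately show ?thesis by simp
qed

text \<open>Write \<open>T = S/2 + \<Omega>\<close> with \<open>\<Omega>\<close> skew. The inner
  product of \<open>act S \<mu>\<close> and \<open>act \<Omega> \<mu>\<close> is, up to a factor,
  the moment map at the commutator of \<open>S\<close> and \<open>\<Omega>\<close>, and this is zero
  because \<open>S\<close> commutes with \<open>Ric \<mu>\<close>. Orthogonality of
  \<open>act S \<mu>\<close> and \<open>act T \<mu>\<close> then says that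
  \<open>act S \<mu>\<close> has norm zero.\<close>

lemma derivation_if_curvature_stationary:
  assumes R: "\<And>u v w. Rm \<mu> (act T \<mu>) u v w + Rm (act T \<mu>) \<mu> u v w = 0"
    and S: "adj S = S" "T + adj T = S" and comm: "S o\<^sub>L Ric \<mu> = Ric \<mu> o\<^sub>L S"
  shows "derivation \<mu> S"
proof -
  define \<Omega> where "\<Omega> = T - (1/2) *\<^sub>R S"
  have \<Omega>: "adj \<Omega> = - \<Omega>"
  proof -
    have "adj T = S - T" using S(2) by (metis add_diff_cancel_left')
    then show ?thesis unfolding \<Omega>_def adj_linear S(1)
      by (simp add: algebra_simps flip: scaleR_2)
  qed
  have T: "T = (1/2) *\<^sub>R S + \<Omega>" by (simp add: \<Omega>_def)
  define x where "x = ip (act S \<mu>) (act \<Omega> \<mu>)"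
  have "x = ip \<mu> (act S (act \<Omega> \<mu>))" by (simp add: x_def ip_act S)
  moreover have "x = - ip \<mu> (act \<Omega> (act S \<mu>))"
  proof -
    have neg: "act (- \<Omega>) \<nu> = - act \<Omega> \<nu>" for \<nu>
      using act_linear(3)[of "-1" \<Omega> \<nu>] by simp
    have "x = ip (act \<Omega> \<mu>) (act S \<mu>)" by (simp add: x_def ip_commute)
    also have "\<dots> = ip \<mu> (- act \<Omega> (act S \<mu>))" by (simp add: ip_act \<Omega> neg)
    also have "\<dots> = - ip \<mu> (act \<Omega> (act S \<mu>))" using ip_linear(6)[of \<mu> "-1"] by simp
    finally show ?thesis .
  qed
  ultimately have "2 * x = ip \<mu> (act ((S o\<^sub>L \<Omega>) - (\<Omega> o\<^sub>L S)) \<mu>)"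
    by (simp add: act_commutator ip_linear)
  also have "\<dots> = 4 * tr (Ric \<mu> o\<^sub>L ((S o\<^sub>L \<Omega>) - (\<Omega> o\<^sub>L S)))"
    by (simp add: tr_Ric[OF nil_skew] ip_commute)
  also have "tr (Ric \<mu> o\<^sub>L ((S o\<^sub>L \<Omega>) - (\<Omega> o\<^sub>L S))) = 0"
  proof -
    have "tr (Ric \<mu> o\<^sub>L (\<Omega> o\<^sub>L S)) = tr (S o\<^sub>L (Ric \<mu> o\<^sub>L \<Omega>))"
      using tr_compose_commute[of "Ric \<mu> o\<^sub>L \<Omega>" S] by (simp add: blinfun_compose_assoc)
    also have "S o\<^sub>L (Ric \<mu> o\<^sub>L \<Omega>) = Ric \<mu> o\<^sub>L (S o\<^sub>L \<Omega>)"
      by (metis blinfun_compose_assoc comm)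
    finally show ?thesis by (simp add: blinfun_compose_simps tr_linear)
  qed
  finally have "x = 0" by simp
  then have "ip (act S \<mu>) (act S \<mu>) = 0"
    using act_orthogonal_if_curvature_stationary[OF R S(1)]
    unfolding T act_linear ip_linear x_def by simp
  then show ?thesis by (simp add: derivation_iff_act ip_self_eq_0)
qed

text \<open>The moment map vanishes at a derivation, so the trace of the square of
  \<open>Ric \<mu>\<close> is \<open>c * tr (Ric \<mu>)\<close>. At the identity it gives
  \<open>tr (Ric \<mu>) = - ip \<mu> \<mu> / 4\<close>, which is negative.\<close>

lemma soliton_constant_negative:
  assumes D: "derivation \<mu> (Ric \<mu> - c *\<^sub>R id_blinfun)" and "\<mu> \<noteq> 0"
  shows "c < 0"
proof -
  have trRic: "tr (Ric \<mu>) = - ip \<mu> \<mu> / 4"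
  proof -
    have "act id_blinfun \<mu> = (-1) *\<^sub>R \<mu>"
      by (rule bracket_eqI) (simp add: act_apply blinfun.bilinear_simps)
    then show ?thesis using tr_Ric[OF nil_skew, of id_blinfun] by (simp only: ip_linear) simp
  qed
  have "ip \<mu> \<mu> > 0" using ip_self_nonneg[of \<mu>] ip_self_eq_0[of \<mu>] \<open>\<mu> \<noteq> 0\<close> by force
  then have neg: "tr (Ric \<mu>) < 0" by (simp add: trRic)
  then have "Ric \<mu> \<noteq> 0" by (auto simp: tr_linear)
  then have "tr (Ric \<mu> o\<^sub>L Ric \<mu>) > 0"
    using tr_adj_compose_self_nonneg[of "Ric \<mu>"] tr_adj_compose_self_eq_0[of "Ric \<mu>"]
    by (force simp: adj_Ric)
  moreover have "tr (Ric \<mu> o\<^sub>L (Ric \<mu> - c *\<^sub>R id_blinfun)) = 0"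
    using D by (simp add: tr_Ric[OF nil_skew] derivation_iff_act ip_linear)
  ultimately have "c * tr (Ric \<mu>) > 0" by (simp add: blinfun_compose_simps tr_linear)
  then show ?thesis using neg by (simp add: zero_less_mult_iff)
qed

text \<open>A test operator for the moment map: if \<open>A\<close> is a derivation, the right-hand
  side has a sign.\<close>

lemma tr_Ric_commutator_adj:
  "tr (Ric \<mu> o\<^sub>L ((A o\<^sub>L adj A) - (adj A o\<^sub>L A))) =
    (ip (act (adj A) \<mu>) (act (adj A) \<mu>) - ip (act A \<mu>) (act A \<mu>)) / 4"
  unfolding tr_Ric[OF nil_skew] act_commutator ip_linear
  by (simp add: ip_act[of A] ip_act[of "adj A" "act A \<mu>"])

section \<open>Positivity of the soliton derivation\<close>

context
  fixes D :: "'b \<Rightarrow>\<^sub>L 'b"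
  assumes D_def: "D = Ric \<mu> + id_blinfun" and deriv: "derivation \<mu> D"
begin

lemma tr_soliton_commutator_adj:
  "tr (Ric \<mu> o\<^sub>L ((A o\<^sub>L adj A) - (adj A o\<^sub>L A))) = tr (((D o\<^sub>L A) - (A o\<^sub>L D)) o\<^sub>L adj A)"
proof -
  have R: "Ric \<mu> = D - id_blinfun" by (simp add: D_def)
  have "tr (D o\<^sub>L (adj A o\<^sub>L A)) = tr (A o\<^sub>L (D o\<^sub>L adj A))"
    using tr_compose_commute[of "D o\<^sub>L adj A" A] by (simp add: blinfun_compose_assoc)
  then show ?thesis
    by (simp add: R blinfun_compose_simps tr_linear blinfun_compose_assoc tr_compose_commute[of "adj A" A])
qed

text \<open>A central eigenvector has nonnegative Ricci curvature, so there \<open>l\<close> is at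
  least 1. Otherwise \<open>ad e\<close> has degree \<open>l\<close> for \<open>ad D\<close>, and
  the commutator test at \<open>ad e\<close> makes \<open>l\<close> times its squared norm a quarter
  of the squared norm of \<open>act (adj (\<mu> e)) \<mu>\<close>. For \<open>l = 0\<close> the
  transpose would be a derivation, and \<open>tr_derivation_ad\<close> would force
  \<open>ad e = 0\<close>.\<close>

lemma soliton_derivation_positive:
  assumes e: "D e = l *\<^sub>R e" "e \<noteq> 0"
  shows "l > 0"
proof (cases "\<mu> e = 0")
  case True
  have "\<mu> i e = 0" for i using skewD[OF nil_skew, of i e] True by simp
  then have "Ric \<mu> e \<bullet> e \<ge> 0" unfolding Ric_inner by (intro sum_nonneg) simp
  then have "D e \<bullet> e > 0" using e(2) by (simp add: D_def blinfun.add_left inner_left_distrib add_nonneg_pos)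
  then have "l * (e \<bullet> e) > 0" "e \<bullet> e > 0" using e by simp_all
  then show ?thesis by (rule zero_less_mult_pos2)
next
  case False
  let ?A = "\<mu> e"
  have A: "act ?A \<mu> = 0" using ad_derivation[OF nil_skew nil_jacobi] by (simp add: derivation_iff_act)
  have "(D o\<^sub>L ?A) - (?A o\<^sub>L D) = l *\<^sub>R ?A"
  proof (rule blinfun_eqI)
    fix y
    have "D (\<mu> e y) = \<mu> (D e) y + \<mu> e (D y)" using deriv unfolding derivation_def by blast
    then show "((D o\<^sub>L ?A) - (?A o\<^sub>L D)) y = (l *\<^sub>R ?A) y"
      by (simp add: e blinfun.bilinear_simps)
  qed
  then have eq: "l * tr (adj ?A o\<^sub>L ?A) = ip (act (adj ?A) \<mu>) (act (adj ?A) \<mu>) / 4"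
    using tr_soliton_commutator_adj[of ?A] tr_Ric_commutator_adj[of ?A]
    by (simp add: A ip_linear blinfun_compose_simps tr_linear tr_compose_commute[of "adj ?A"])
  have pos: "tr (adj ?A o\<^sub>L ?A) > 0"
    using tr_adj_compose_self_nonneg[of ?A] tr_adj_compose_self_eq_0[of ?A] False by force
  have "l * tr (adj ?A o\<^sub>L ?A) \<ge> 0" unfolding eq using ip_self_nonneg by simp
  then have "l \<ge> 0" using pos by (simp add: zero_le_mult_iff)
  moreover have "l \<noteq> 0"
  proof
    assume "l = 0"
    then have "derivation \<mu> (adj ?A)" using eq by (simp add: ip_self_eq_0 derivation_iff_act)
    then show False using tr_derivation_ad pos by fastforce
  qed
  ultimately show ?thesis by simp
qed

end

end

section \<open>Curvature in a Maurer--Cartan frame\<close>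

lemma dir_deriv_in_subspace:
  fixes f :: "'a::euclidean_space \<Rightarrow> 'b::euclidean_space"
  assumes "smooth_on UNIV f" "subspace L" "subspace S" "\<And>y. y \<in> L \<Longrightarrow> f y \<in> S" "x \<in> L" "v \<in> L"
  shows "dir_deriv f x v \<in> S"
proof -
  have "dir_deriv f x v = dir_deriv (\<lambda>y. proj S (f y)) x v"
    using assms by (intro dir_deriv_cong[of L]) (simp_all add: proj_id)
  also have "\<dots> = proj S (dir_deriv f x v)"
    by (rule dir_deriv_bounded_linear[OF blinfun.bounded_linear_right assms(1)])
  finally show ?thesis using proj_in[OF assms(3)] by metis
qed

lemma in_subspaceI:
  fixes W :: "'b::euclidean_space set"
  assumes "subspace W" "\<And>z. (\<And>w. w \<in> W \<Longrightarrow> z \<bullet> w = 0) \<Longrightarrow> v \<bullet> z = 0"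
  shows "v \<in> W"
proof -
  let ?z = "v - proj W v"
  have z: "?z \<bullet> w = 0" if "w \<in> W" for w using proj_orthogonal[OF assms(1) that] .
  have "v \<bullet> ?z = 0" using z by (rule assms(2))
  moreover have "proj W v \<bullet> ?z = 0" using z[OF proj_in[OF assms(1)]] by (metis inner_commute)
  ultimately have "?z \<bullet> ?z = 0" by (simp add: inner_diff_left)
  then have "v = proj W v" by simp
  then show ?thesis using proj_in[OF assms(1)] by metis
qed

text \<open>The basis behind \<open>trace_on\<close> is an unspecified choice, so both traces are
  compared through the coordinate functionals \<open>r b\<close>. As \<open>F\<close> kills the
  orthogonal complement of \<open>W\<close>, its trace on the whole space is its trace on
  \<open>W\<close>.\<close>

lemma trace_on_eq_tr:
  fixes \<Theta> :: "'a::euclidean_space \<Rightarrow>\<^sub>L 'b::euclidean_space" and F :: "'b \<Rightarrow>\<^sub>L 'b"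
    and V :: "'b \<Rightarrow>\<^sub>L 'a"
  assumes L: "subspace L" and W: "subspace W"
    and \<Theta>: "\<And>a. a \<in> L \<Longrightarrow> \<Theta> a \<in> W" "\<And>a. a \<in> L \<Longrightarrow> V (\<Theta> a) = a"
    and V: "\<And>w. w \<in> W \<Longrightarrow> V w \<in> L" "\<And>w. w \<in> W \<Longrightarrow> \<Theta> (V w) = w"
    and A: "\<And>a. a \<in> L \<Longrightarrow> A a \<in> L" "\<And>a. a \<in> L \<Longrightarrow> \<Theta> (A a) = F (\<Theta> a)"
    and F: "\<And>z. (\<And>w. w \<in> W \<Longrightarrow> z \<bullet> w = 0) \<Longrightarrow> F z = 0"
  shows "trace_on L A = tr F"
proof -
  define B where "B = (SOME B. B \<subseteq> L \<and> independent B \<and> span B = L)"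
  have "\<exists>B. B \<subseteq> L \<and> independent B \<and> span B = L"
    using basis_exists[of L] L by (metis span_eq_iff span_mono span_superset subset_antisym)
  then have B: "B \<subseteq> L" "independent B" "span B = L"
    unfolding B_def by (metis (mono_tags, lifting) someI_ex)+
  have fin: "finite B" using B(2) independent_imp_finite by blast
  define r where "r b z = representation B (V (proj W z)) b" for b z
  have in_span: "V (proj W z) \<in> span B" for z using V(1) proj_in[OF W] B(3) by auto
  have r_lin: "linear (r b)" for b
    by (intro linearI)
      (simp_all add: r_def blinfun.bilinear_simps real_vector.representation_add real_vector.representation_scale
       B(2) in_span)
  have expand: "proj W z = (\<Sum>b\<in>B. r b z *\<^sub>R \<Theta> b)" for z
  proof -
    have "V (proj W z) = (\<Sum>b\<in>B. r b z *\<^sub>R b)"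
      unfolding r_def using real_vector.sum_representation_eq[OF B(2) in_span fin order_refl] by simp
    then have "\<Theta> (V (proj W z)) = (\<Sum>b\<in>B. r b z *\<^sub>R \<Theta> b)" by (simp add: blinfun.bilinear_simps blinfun.sum_right)
    then show ?thesis using V(2) proj_in[OF W] by simp
  qed
  have Fproj: "F z = F (proj W z)" for z
  proof -
    have "F (z - proj W z) = 0" by (rule F) (rule proj_orthogonal[OF W])
    then show ?thesis by (simp add: blinfun.diff_right)
  qed
  have "tr F = (\<Sum>i\<in>Basis. \<Sum>b\<in>B. r b i * (F (\<Theta> b) \<bullet> i))"
  proof -
    have Fz: "F z = (\<Sum>b\<in>B. r b z *\<^sub>R F (\<Theta> b))" for z
      by (subst Fproj) (simp add: expand blinfun.sum_right blinfun.scaleR_right)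
    show ?thesis unfolding tr_def
      by (rule sum.cong[OF refl], subst Fz) (simp add: inner_sum_left)
  qed
  also have "\<dots> = (\<Sum>b\<in>B. \<Sum>i\<in>Basis. (F (\<Theta> b) \<bullet> i) * r b i)"
    by (subst sum.swap) (simp only: mult.commute)
  also have "\<dots> = (\<Sum>b\<in>B. r b (F (\<Theta> b)))"
  proof (rule sum.cong[OF refl])
    fix b assume "b \<in> B"
    have "r b (F (\<Theta> b)) = r b (\<Sum>i\<in>Basis. (F (\<Theta> b) \<bullet> i) *\<^sub>R i)" by (simp only: euclidean_representation)
    then show "(\<Sum>i\<in>Basis. (F (\<Theta> b) \<bullet> i) * r b i) = r b (F (\<Theta> b))"
      by (simp add: linear_sum[OF r_lin] linear_cmul[OF r_lin])
  qed
  also have "\<dots> = (\<Sum>b\<in>B. representation B (A b) b)"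
  proof (rule sum.cong[OF refl])
    fix b assume "b \<in> B"
    then have b: "b \<in> L" using B by auto
    have "proj W (F (\<Theta> b)) = \<Theta> (A b)" using A b \<Theta>(1) by (metis proj_id[OF W])
    then show "r b (F (\<Theta> b)) = representation B (A b) b" using \<Theta>(2) A(1) b by (simp add: r_def)
  qed
  finally show ?thesis by (simp add: trace_on_def B_def Let_def)
qed

text \<open>A left-invariant coframe \<open>\<Theta>\<close> with inverse \<open>V\<close>. Only the
  Maurer-Cartan equation is kept of the group, so one curvature computation serves a given Lie
  group, its product with a flat factor, and the group built from a soliton.\<close>

locale mc_frame =
  fixes L :: "'a::euclidean_space set" and W :: "'b::euclidean_space set" and \<mu> :: "'b bracket"
    and \<Theta> :: "'a \<Rightarrow> 'a \<Rightarrow>\<^sub>L 'b" and V :: "'a \<Rightarrow> 'b \<Rightarrow>\<^sub>L 'a" and g :: "'a \<Rightarrow> 'a \<Rightarrow> 'a \<Rightarrow> real"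
  assumes L: "subspace L" and W: "subspace W"
    and smooth_\<Theta>: "smooth_on UNIV \<Theta>" and smooth_V: "smooth_on UNIV V"
    and \<Theta>_in: "x \<in> L \<Longrightarrow> a \<in> L \<Longrightarrow> \<Theta> x a \<in> W" and V_in: "x \<in> L \<Longrightarrow> w \<in> W \<Longrightarrow> V x w \<in> L"
    and V_\<Theta>: "x \<in> L \<Longrightarrow> a \<in> L \<Longrightarrow> V x (\<Theta> x a) = a"
    and \<Theta>_V: "x \<in> L \<Longrightarrow> w \<in> W \<Longrightarrow> \<Theta> x (V x w) = w"
    and nil: "nilpotent_bracket \<mu>"
    and support: "(\<And>w. w \<in> W \<Longrightarrow> z \<bullet> w = 0) \<Longrightarrow> \<mu> z = 0"
    and closed: "u \<in> W \<Longrightarrow> v \<in> W \<Longrightarrow> \<mu> u v \<in> W"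
    and maurer_cartan: "x \<in> L \<Longrightarrow> a \<in> L \<Longrightarrow> b \<in> L \<Longrightarrow>
      dir_deriv \<Theta> x a b - dir_deriv \<Theta> x b a = - \<mu> (\<Theta> x a) (\<Theta> x b)"
    and metric: "x \<in> L \<Longrightarrow> a \<in> L \<Longrightarrow> b \<in> L \<Longrightarrow> g x a b = \<Theta> x a \<bullet> \<Theta> x b"
begin

lemma support_right: "(\<And>w. w \<in> W \<Longrightarrow> z \<bullet> w = 0) \<Longrightarrow> \<mu> v z = 0"
  using support[of z] skewD[OF nil_skew[OF nil], of v z] by simp

lemma bounded_linear_koszul: "bounded_linear (koszul \<mu>)"
  by (simp add: linear_conv_bounded_linear[symmetric] linearI koszul_linear)

lemma koszul_in: "u \<in> W \<Longrightarrow> v \<in> W \<Longrightarrow> koszul \<mu> u v \<in> W"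
proof (rule in_subspaceI[OF W])
  fix z assume "u \<in> W" "v \<in> W" and z: "\<And>w. w \<in> W \<Longrightarrow> z \<bullet> w = 0"
  then have "\<mu> u v \<bullet> z = 0" using closed by (metis inner_commute)
  then show "koszul \<mu> u v \<bullet> z = 0" using support_right[OF z] by (simp add: koszul_inner)
qed

lemma koszul_support: "(\<And>w. w \<in> W \<Longrightarrow> z \<bullet> w = 0) \<Longrightarrow> v \<in> W \<Longrightarrow> koszul \<mu> z v = 0"
proof (rule vector_eq_rdot[THEN iffD1, rule_format])
  fix w assume z: "\<And>w. w \<in> W \<Longrightarrow> z \<bullet> w = 0" and v: "v \<in> W"
  have "\<mu> v (w - proj W w) = 0" by (rule support_right) (rule proj_orthogonal[OF W])
  then have "\<mu> v w = \<mu> v (proj W w)" by (simp add: blinfun.diff_right)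
  then have "\<mu> v w \<in> W" using closed[OF v proj_in[OF W]] by simp
  then show "koszul \<mu> z v \<bullet> w = 0 \<bullet> w" using support[OF z] z by (simp add: koszul_inner)
qed

lemma smooth_frame_apply: "smooth_on UNIV (\<lambda>y. \<Theta> y a)"
  by (rule smooth_blinfun_apply[OF smooth_\<Theta> smooth_const])

lemma dir_deriv_frame_apply: "dir_deriv (\<lambda>y. \<Theta> y a) x u = dir_deriv \<Theta> x u a"
  using dir_deriv_bounded_linear[OF blinfun.bounded_linear_left smooth_\<Theta>] .

lemma dir_deriv_frame_in: "x \<in> L \<Longrightarrow> u \<in> L \<Longrightarrow> a \<in> L \<Longrightarrow> dir_deriv \<Theta> x u a \<in> W"
  unfolding dir_deriv_frame_apply[symmetric]
  by (rule dir_deriv_in_subspace[OF smooth_frame_apply L W \<Theta>_in])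

lemma dir_deriv_metric:
  assumes "x \<in> L" "u \<in> L" "a \<in> L" "b \<in> L"
  shows "dir_deriv (\<lambda>y. g y a b) x u = \<Theta> x a \<bullet> dir_deriv \<Theta> x u b + dir_deriv \<Theta> x u a \<bullet> \<Theta> x b"
proof -
  have "dir_deriv (\<lambda>y. g y a b) x u = dir_deriv (\<lambda>y. \<Theta> y a \<bullet> \<Theta> y b) x u"
    by (rule dir_deriv_cong[OF L]) (use assms metric in auto)
  then show ?thesis
    by (simp add: dir_deriv_bilinear[OF bounded_bilinear_inner smooth_frame_apply smooth_frame_apply]
        dir_deriv_frame_apply)
qed

text \<open>Frame coefficients of the covariant derivative of the constant field \<open>b\<close>
  along \<open>a\<close>. A constant field has nonconstant coefficients \<open>\<Theta> y b\<close>,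
  whence the derivative term.\<close>

definition conn :: "'a \<Rightarrow> 'a \<Rightarrow> 'a \<Rightarrow> 'b" where
  "conn x a b = koszul \<mu> (\<Theta> x a) (\<Theta> x b) + dir_deriv \<Theta> x a b"

lemma conn_in: "x \<in> L \<Longrightarrow> a \<in> L \<Longrightarrow> b \<in> L \<Longrightarrow> conn x a b \<in> W"
  unfolding conn_def by (intro subspace_add W koszul_in \<Theta>_in dir_deriv_frame_in)

lemma christoffel_eq:
  assumes x: "x \<in> L" "a \<in> L" "b \<in> L"
  shows "christoffel L g x a b = V x (conn x a b)"
  unfolding christoffel_def
proof (rule the_equality)
  have CL: "V x (conn x a b) \<in> L" by (intro V_in conn_in x)
  have koszul_formula: "conn x a b \<bullet> \<Theta> x w =
      (dir_deriv (\<lambda>y. g y b w) x a + dir_deriv (\<lambda>y. g y a w) x b - dir_deriv (\<lambda>y. g y a b) x w) / 2"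
    if w: "w \<in> L" for w
  proof -
    \<comment> \<open>Swapping the arguments of \<open>dir_deriv \<Theta> x\<close> costs a bracket;
      afterwards every derivative in the Koszul formula cancels except
      \<open>dir_deriv \<Theta> x a b\<close>.\<close>
    have "dir_deriv \<Theta> x b a = dir_deriv \<Theta> x a b + \<mu> (\<Theta> x a) (\<Theta> x b)"
      "dir_deriv \<Theta> x w a = dir_deriv \<Theta> x a w + \<mu> (\<Theta> x a) (\<Theta> x w)"
      "dir_deriv \<Theta> x w b = dir_deriv \<Theta> x b w + \<mu> (\<Theta> x b) (\<Theta> x w)"
      using maurer_cartan[OF x(1) x(2) x(3)] maurer_cartan[OF x(1) x(2) w] maurer_cartan[OF x(1) x(3) w]
      by (simp_all add: algebra_simps)
    then show ?thesis
      using x w by (simp add: dir_deriv_metric conn_def koszul_inner inner_left_distrib inner_right_distrib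
          inner_commute[of "dir_deriv \<Theta> x a w"] inner_commute[of "\<mu> (\<Theta> x a) (\<Theta> x w)"])
  qed
  show "V x (conn x a b) \<in> L \<and> (\<forall>w\<in>L. g x (V x (conn x a b)) w =
      (dir_deriv (\<lambda>y. g y b w) x a + dir_deriv (\<lambda>y. g y a w) x b - dir_deriv (\<lambda>y. g y a b) x w) / 2)"
    using CL koszul_formula by (simp add: metric x \<Theta>_V conn_in)
  fix z assume z: "z \<in> L \<and> (\<forall>w\<in>L. g x z w =
      (dir_deriv (\<lambda>y. g y b w) x a + dir_deriv (\<lambda>y. g y a w) x b - dir_deriv (\<lambda>y. g y a b) x w) / 2)"
  let ?w = "z - V x (conn x a b)"
  have w: "?w \<in> L" using z CL L by (intro subspace_diff) auto
  have "g x z ?w = conn x a b \<bullet> \<Theta> x ?w" unfolding koszul_formula[OF w] using z w by blast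
  then have "(\<Theta> x z - conn x a b) \<bullet> \<Theta> x ?w = 0" using z w x by (simp add: metric inner_diff_left)
  moreover have "\<Theta> x z - conn x a b = \<Theta> x ?w" by (simp add: blinfun.diff_right \<Theta>_V x conn_in)
  ultimately have "\<Theta> x ?w = 0" by (metis inner_eq_zero_iff)
  then have "?w = 0" using V_\<Theta>[OF x(1) w] by (simp add: blinfun.zero_right)
  then show "z = V x (conn x a b)" by simp
qed

lemma smooth_koszul_frame: "smooth_on UNIV (\<lambda>y. koszul \<mu> (\<Theta> y a))"
  by (rule smooth_bounded_linear[OF bounded_linear_koszul smooth_frame_apply])

lemma smooth_dir_deriv_frame: "smooth_on UNIV (\<lambda>y. dir_deriv \<Theta> y a b)"
  by (rule smooth_blinfun_apply[OF smooth_dir_deriv[OF smooth_\<Theta>] smooth_const])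

lemma smooth_conn: "smooth_on UNIV (\<lambda>y. conn y a b)"
  unfolding conn_def
  by (intro smooth_add smooth_blinfun_apply smooth_koszul_frame smooth_frame_apply smooth_dir_deriv_frame)

lemma smooth_V_conn: "smooth_on UNIV (\<lambda>y. V y (conn y a b))"
  by (intro smooth_blinfun_apply smooth_V smooth_conn)

lemma dir_deriv_conn:
  "dir_deriv (\<lambda>y. conn y a b) x u = koszul \<mu> (\<Theta> x a) (dir_deriv \<Theta> x u b)
    + koszul \<mu> (dir_deriv \<Theta> x u a) (\<Theta> x b) + dir_deriv (\<lambda>y. dir_deriv \<Theta> y a b) x u"
  unfolding conn_def
  by (simp add: dir_deriv_add smooth_blinfun_apply smooth_koszul_frame smooth_frame_apply
      smooth_dir_deriv_frame dir_deriv_blinfun_apply dir_deriv_frame_apply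
      dir_deriv_bounded_linear[OF bounded_linear_koszul smooth_frame_apply])

lemma levi_civita_const:
  "y \<in> L \<Longrightarrow> v \<in> L \<Longrightarrow> w \<in> L \<Longrightarrow> levi_civita L g (\<lambda>_. v) (\<lambda>_. w) y = V y (conn y v w)"
  by (simp add: levi_civita_def christoffel_eq)

lemma second_covariant_derivative:
  assumes x: "x \<in> L" "u \<in> L" "v \<in> L" "w \<in> L"
  defines "Z \<equiv> levi_civita L g (\<lambda>_. u) (levi_civita L g (\<lambda>_. v) (\<lambda>_. w)) x"
  shows "Z \<in> L" "\<Theta> x Z = dir_deriv (\<lambda>y. conn y v w) x u + koszul \<mu> (\<Theta> x u) (conn x v w)"
proof -
  let ?C = "\<lambda>y. V y (conn y v w)"
  have CL: "?C y \<in> L" if "y \<in> L" for y using that x by (intro V_in conn_in)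
  have "dir_deriv (levi_civita L g (\<lambda>_. v) (\<lambda>_. w)) x u = dir_deriv ?C x u"
    by (rule dir_deriv_cong[OF L]) (use x levi_civita_const in auto)
  then have Z: "Z = dir_deriv ?C x u + V x (conn x u (?C x))"
    using x CL by (simp add: Z_def levi_civita_def[of L g "\<lambda>_. u"] levi_civita_const christoffel_eq)
  have dC: "dir_deriv ?C x u \<in> L"
    using smooth_V_conn L L CL x(1,2) by (rule dir_deriv_in_subspace)
  then show "Z \<in> L" unfolding Z using x CL by (intro subspace_add L V_in conn_in)
  have "dir_deriv (\<lambda>y. \<Theta> y (?C y)) x u = dir_deriv (\<lambda>y. conn y v w) x u"
    by (rule dir_deriv_cong[OF L]) (use x \<Theta>_V conn_in in auto)
  then have "\<Theta> x (dir_deriv ?C x u) = dir_deriv (\<lambda>y. conn y v w) x u - dir_deriv \<Theta> x u (?C x)"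
    by (simp add: dir_deriv_blinfun_apply[OF smooth_\<Theta> smooth_V_conn] algebra_simps)
  moreover have "\<Theta> x (V x (conn x u (?C x))) = koszul \<mu> (\<Theta> x u) (conn x v w) + dir_deriv \<Theta> x u (?C x)"
    using x CL by (simp add: \<Theta>_V conn_in) (simp add: conn_def[of x u] \<Theta>_V conn_in x)
  ultimately show "\<Theta> x Z = dir_deriv (\<lambda>y. conn y v w) x u + koszul \<mu> (\<Theta> x u) (conn x v w)"
    by (simp add: Z blinfun.add_right)
qed

text \<open>Second derivatives of \<open>\<Theta>\<close> cancel by symmetry; its antisymmetrized
  first derivative is a bracket and supplies the third term of \<open>Rm\<close>.\<close>

lemma riemann_curvature_eq:
  assumes x: "x \<in> L" "u \<in> L" "v \<in> L" "w \<in> L"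
  shows "riemann_curvature L g x u v w \<in> L"
    and "\<Theta> x (riemann_curvature L g x u v w) = Rm \<mu> \<mu> (\<Theta> x u) (\<Theta> x v) (\<Theta> x w)"
proof -
  note Zuv = second_covariant_derivative[OF x(1,2,3,4)]
  note Zvu = second_covariant_derivative[OF x(1,3,2,4)]
  show "riemann_curvature L g x u v w \<in> L"
    unfolding riemann_curvature_def by (intro subspace_diff L Zuv Zvu)
  have sym: "dir_deriv (\<lambda>y. dir_deriv \<Theta> y v w) x u = dir_deriv (\<lambda>y. dir_deriv \<Theta> y u w) x v"
    unfolding dir_deriv_frame_apply[symmetric] by (rule dir_deriv_commute[OF smooth_frame_apply])
  have mc: "koszul \<mu> (dir_deriv \<Theta> x u v) - koszul \<mu> (dir_deriv \<Theta> x v u) = - koszul \<mu> (\<mu> (\<Theta> x u) (\<Theta> x v))"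
    by (simp only: koszul_linear(2)[symmetric] maurer_cartan[OF x(1,2,3)] koszul_linear(4))
  then have mc': "koszul \<mu> (dir_deriv \<Theta> x u v) (\<Theta> x w) =
      koszul \<mu> (dir_deriv \<Theta> x v u) (\<Theta> x w) - koszul \<mu> (\<mu> (\<Theta> x u) (\<Theta> x v)) (\<Theta> x w)"
    by (metis (no_types) add.commute blinfun.diff_left blinfun.minus_left diff_eq_eq diff_minus_eq_add uminus_add_conv_diff)
  show "\<Theta> x (riemann_curvature L g x u v w) = Rm \<mu> \<mu> (\<Theta> x u) (\<Theta> x v) (\<Theta> x w)"
    unfolding riemann_curvature_def blinfun.diff_right Zuv(2) Zvu(2) dir_deriv_conn Rm_def
    by (simp add: conn_def blinfun.add_right sym mc' algebra_simps)
qed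

theorem ricci_curvature_eq:
  assumes x: "x \<in> L" "v \<in> L" "w \<in> L"
  shows "ricci_curvature L g x v w = Ric \<mu> (\<Theta> x v) \<bullet> \<Theta> x w"
proof -
  define F where "F = Blinfun (\<lambda>u. Rm \<mu> \<mu> u (\<Theta> x v) (\<Theta> x w))"
  have F: "F u = Rm \<mu> \<mu> u (\<Theta> x v) (\<Theta> x w)" for u
    unfolding F_def
    by (subst Blinfun_linear)
      (auto intro!: linearI simp: Rm_def koszul_linear blinfun.bilinear_simps algebra_simps)
  have "trace_on L (\<lambda>u. riemann_curvature L g x u v w) = tr F"
  proof (rule trace_on_eq_tr[OF L W, of "\<Theta> x" "V x"])
    fix z assume z: "\<And>w. w \<in> W \<Longrightarrow> z \<bullet> w = 0"
    show "F z = 0"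
      using x by (simp add: F Rm_def koszul_support[OF z] koszul_in \<Theta>_in support[OF z] koszul_linear
         blinfun.zero_right koszul_linear(3)[of _ 0 0, simplified])
  qed (use x in \<open>auto simp: \<Theta>_in V_in V_\<Theta> \<Theta>_V riemann_curvature_eq F\<close>)
  also have "\<dots> = Ric \<mu> (\<Theta> x v) \<bullet> \<Theta> x w"
    by (simp add: tr_def F sum_Rm[OF nil])
  finally show ?thesis by (simp add: ricci_curvature_def)
qed

text \<open>Maurer-Cartan trades the derivative of \<open>\<Theta>\<close> along \<open>X\<close>
  for a derivative of the frame coefficients of \<open>X\<close>.\<close>

lemma lie_derivative_metric_eq:
  assumes X: "smooth_on UNIV X" "\<And>y. y \<in> L \<Longrightarrow> X y \<in> L" and x: "x \<in> L" "a \<in> L" "b \<in> L"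
  defines "\<tau> \<equiv> \<lambda>a. dir_deriv (\<lambda>y. \<Theta> y (X y)) x a + \<mu> (\<Theta> x a) (\<Theta> x (X x))"
  shows "lie_derivative_metric X g x a b = \<tau> a \<bullet> \<Theta> x b + \<Theta> x a \<bullet> \<tau> b"
proof -
  have dX: "dir_deriv X x a \<in> L" if "a \<in> L" for a
    using dir_deriv_in_subspace[OF X(1) L L X(2) x(1) that] .
  have \<tau>: "\<tau> a = dir_deriv \<Theta> x (X x) a + \<Theta> x (dir_deriv X x a)" if "a \<in> L" for a
    using maurer_cartan[OF x(1) X(2)[OF x(1)] that] skewD[OF nil_skew[OF nil], of "\<Theta> x (X x)" "\<Theta> x a"]
    by (simp add: \<tau>_def dir_deriv_blinfun_apply[OF smooth_\<Theta> X(1)] algebra_simps)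
  show ?thesis
    using x X(2) dX
    by (simp add: lie_derivative_metric_def dir_deriv_metric metric \<tau> inner_left_distrib inner_right_distrib)
qed

end

section \<open>Prolongation of the soliton equation\<close>

lemma norm_adj_le: "norm (adj A) \<le> norm A"
proof (rule norm_blinfun_bound)
  fix y
  show "norm (adj A y) \<le> norm A * norm y"
  proof (cases "adj A y = 0")
    case False
    have "norm (adj A y) * norm (adj A y) = y \<bullet> A (adj A y)"
      by (simp only: adj_left[symmetric] power2_norm_eq_inner[symmetric] power2_eq_square)
    also have "\<dots> \<le> norm y * (norm A * norm (adj A y))"
      using Cauchy_Schwarz_ineq2[of y "A (adj A y)"] norm_blinfun[of A "adj A y"]
      by (smt (verit) mult_left_mono norm_ge_zero)
    finally show ?thesis using False by (simp add: mult_ac)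
  qed simp
qed simp

lemma bounded_linear_adj: "bounded_linear adj"
  by (rule bounded_linear_intro[where K=1]) (simp_all add: adj_linear norm_adj_le)

lemma koszul_act_has_derivative:
  fixes T :: "'a::euclidean_space \<Rightarrow> 'b::euclidean_space \<Rightarrow>\<^sub>L 'b" and \<theta> :: "'a \<Rightarrow> 'b"
  assumes T: "(T has_derivative T') (at x)" and \<theta>: "(\<theta> has_derivative \<theta>') (at x)"
  shows "((\<lambda>x. koszul (act (T x) \<mu>) (\<theta> x) v \<bullet> w) has_derivative
    (\<lambda>b. koszul (act (T' b) \<mu>) (\<theta> x) v \<bullet> w + koszul (act (T x) \<mu>) (\<theta>' b) v \<bullet> w)) (at x)"
proof -
  note app = bounded_bilinear.FDERIV[OF bounded_bilinear_blinfun_apply]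
  note inner = bounded_bilinear.FDERIV[OF bounded_bilinear_inner]
  have 1: "((\<lambda>x. act (T x) \<mu> (\<theta> x) v) has_derivative
      (\<lambda>b. act (T' b) \<mu> (\<theta> x) v + act (T x) \<mu> (\<theta>' b) v)) (at x)" for v
    unfolding act_apply
    by (rule has_derivative_eq_rhs,
        (rule has_derivative_diff app T \<theta> has_derivative_const)+)
      (simp add: blinfun.bilinear_simps algebra_simps)
  have 2: "((\<lambda>x. act (T x) \<mu> v w) has_derivative (\<lambda>b. act (T' b) \<mu> v w)) (at x)"
    unfolding act_apply
    by (rule has_derivative_eq_rhs,
        (rule has_derivative_diff app T has_derivative_const)+)
      (simp add: blinfun.bilinear_simps algebra_simps)
  show ?thesis
    unfolding koszul_inner divide_inverse
    by (rule has_derivative_eq_rhs,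
        (rule has_derivative_mult_left has_derivative_diff inner 1 2 \<theta> has_derivative_const)+)
      (simp add: inner_left_distrib inner_right_distrib algebra_simps)
qed

text \<open>\<open>y\<close> holds the frame coefficients of the soliton field. The symmetric
  operator \<open>S\<close> is left general because along an added flat factor its value is zero and
  not the soliton constant.\<close>

locale mc_frame_full = mc_frame UNIV UNIV \<mu> \<Theta> V "\<lambda>x a b. \<Theta> x a \<bullet> \<Theta> x b"
  for \<mu> :: "'b::euclidean_space bracket" and \<Theta> :: "'a::euclidean_space \<Rightarrow> 'a \<Rightarrow>\<^sub>L 'b" and V +
  fixes y :: "'a \<Rightarrow> 'b" and S :: "'b \<Rightarrow>\<^sub>L 'b"
  assumes smooth_y: "smooth_on UNIV y"
    and S: "adj S = S" "S o\<^sub>L Ric \<mu> = Ric \<mu> o\<^sub>L S"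
    and soliton: "(dir_deriv y x a + \<mu> (\<Theta> x a) (y x)) \<bullet> \<Theta> x b
        + \<Theta> x a \<bullet> (dir_deriv y x b + \<mu> (\<Theta> x b) (y x)) = S (\<Theta> x a) \<bullet> \<Theta> x b"
begin

lemma mc: "dir_deriv \<Theta> x a b - dir_deriv \<Theta> x b a = - \<mu> (\<Theta> x a) (\<Theta> x b)"
  using maurer_cartan by simp

lemma \<Theta>V: "\<Theta> x (V x w) = w" and V\<Theta>: "V x (\<Theta> x a) = a"
  using \<Theta>_V V_\<Theta> by simp_all

definition dy :: "'a \<Rightarrow> 'a \<Rightarrow>\<^sub>L 'b" where "dy x = Blinfun (dir_deriv y x)"

lemma dy: "dy x a = dir_deriv y x a"
  by (simp add: dy_def Blinfun_linear linear_dir_deriv[OF smooth_y])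

lemma smooth_dy: "smooth_on UNIV dy"
  by (rule smooth_blinfunI) (simp add: dy smooth_dir_deriv[OF smooth_y])

text \<open>The covariant derivative of \<open>y\<close> for the flat connection whose parallel sections are the
  right-invariant fields, read in the frame.\<close>

definition T :: "'a \<Rightarrow> 'b \<Rightarrow>\<^sub>L 'b" where
  "T x = (dy x - (\<mu> (y x) o\<^sub>L \<Theta> x)) o\<^sub>L V x"

lemma T_frame: "T x (\<Theta> x a) = dir_deriv y x a - \<mu> (y x) (\<Theta> x a)"
  by (simp add: T_def blinfun.diff_left dy V\<Theta>)

lemma smooth_bracket_y: "smooth_on UNIV (\<lambda>x. \<mu> (y x))"
  by (rule smooth_bounded_linear[OF blinfun.bounded_linear_right smooth_y])

lemma smooth_T: "smooth_on UNIV T"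
  unfolding T_def
  by (intro smooth_blinfun_compose smooth_diff smooth_dy smooth_bracket_y smooth_\<Theta> smooth_V)

lemma T_adj: "T x + adj (T x) = S"
proof (rule blinfun_inner_eqI)
  fix u v
  have "\<mu> (\<Theta> x (V x w)) (y x) = - \<mu> (y x) (\<Theta> x (V x w))" for w
    using skewD[OF nil_skew[OF nil]] .
  then have "T x (\<Theta> x (V x u)) \<bullet> \<Theta> x (V x v) + \<Theta> x (V x u) \<bullet> T x (\<Theta> x (V x v))
      = S (\<Theta> x (V x u)) \<bullet> \<Theta> x (V x v)"
    using soliton[of x "V x u" "V x v"] by (simp add: T_frame)
  then show "(T x + adj (T x)) u \<bullet> v = S u \<bullet> v"
    by (simp add: \<Theta>V blinfun.add_left inner_left_distrib adj_left)
qed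

lemma dT_skew: "dir_deriv T x a u \<bullet> v = - (u \<bullet> dir_deriv T x a v)"
proof -
  have "dir_deriv (\<lambda>x. T x + adj (T x)) x a = dir_deriv T x a + adj (dir_deriv T x a)"
    by (simp add: dir_deriv_add smooth_T smooth_bounded_linear bounded_linear_adj
        dir_deriv_bounded_linear)
  then have "dir_deriv T x a + adj (dir_deriv T x a) = 0" by (simp add: T_adj)
  then have "(dir_deriv T x a + adj (dir_deriv T x a)) u \<bullet> v = 0" by simp
  then show ?thesis by (simp add: blinfun.add_left inner_left_distrib adj_left)
qed

text \<open>Second derivatives of \<open>y\<close> cancel by symmetry, Maurer-Cartan disposes of
  those of \<open>\<Theta>\<close>, and the Jacobi identity of the terms containing
  \<open>y x\<close> itself. What is left is linear in \<open>T x\<close>.\<close>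

lemma dT_frame: "dir_deriv T x a (\<Theta> x b) - dir_deriv T x b (\<Theta> x a) = act (T x) \<mu> (\<Theta> x a) (\<Theta> x b)"
proof -
  have D: "dir_deriv T x a (\<Theta> x b) + T x (dir_deriv \<Theta> x a b) =
      dir_deriv (\<lambda>x. dir_deriv y x b) x a - \<mu> (dir_deriv y x a) (\<Theta> x b) - \<mu> (y x) (dir_deriv \<Theta> x a b)" for a b
  proof -
    have "dir_deriv (\<lambda>x. T x (\<Theta> x b)) x a = dir_deriv (\<lambda>x. dir_deriv y x b - \<mu> (y x) (\<Theta> x b)) x a"
      by (simp add: T_frame)
    then show ?thesis
      by (simp add: dir_deriv_blinfun_apply smooth_T smooth_frame_apply dir_deriv_frame_apply
          dir_deriv_diff smooth_dir_deriv smooth_y smooth_blinfun_apply smooth_bracket_y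
          dir_deriv_bounded_linear[OF blinfun.bounded_linear_right smooth_y] algebra_simps)
  qed
  let ?u = "\<Theta> x a" and ?v = "\<Theta> x b"
  have d2: "dir_deriv (\<lambda>x. dir_deriv y x b) x a = dir_deriv (\<lambda>x. dir_deriv y x a) x b"
    by (rule dir_deriv_commute[OF smooth_y])
  have dab: "dir_deriv \<Theta> x a b = dir_deriv \<Theta> x b a - \<mu> ?u ?v"
    using mc[of x a b] by (simp add: algebra_simps)
  have dya: "dir_deriv y x a = T x ?u + \<mu> (y x) ?u" and dyb: "dir_deriv y x b = T x ?v + \<mu> (y x) ?v"
    by (simp_all add: T_frame)
  have der: "\<mu> (y x) (\<mu> ?u ?v) = \<mu> (\<mu> (y x) ?u) ?v + \<mu> ?u (\<mu> (y x) ?v)"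
    using ad_derivation[OF nil_skew[OF nil] nil_jacobi[OF nil]] unfolding derivation_def by blast
  have sk: "\<mu> (\<mu> (y x) ?v) ?u = - \<mu> ?u (\<mu> (y x) ?v)" "\<mu> (T x ?v) ?u = - \<mu> ?u (T x ?v)"
    by (rule skewD[OF nil_skew[OF nil]])+
  define e where "e = dir_deriv \<Theta> x b a"
  have "dir_deriv T x a ?v = dir_deriv (\<lambda>x. dir_deriv y x a) x b - \<mu> (T x ?u + \<mu> (y x) ?u) ?v
      - \<mu> (y x) (e - \<mu> ?u ?v) - T x (e - \<mu> ?u ?v)"
    using D[of a b] unfolding d2 dab dya e_def by (simp only: eq_diff_eq)
  moreover have "dir_deriv T x b ?u = dir_deriv (\<lambda>x. dir_deriv y x a) x b - \<mu> (T x ?v + \<mu> (y x) ?v) ?u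
      - \<mu> (y x) e - T x e"
    using D[of b a] unfolding dyb e_def by (simp only: eq_diff_eq)
  ultimately show ?thesis
    by (simp only: act_apply blinfun.bilinear_simps der sk) simp
qed

text \<open>\<open>dir_deriv T\<close> is skew-valued and its torsion is
  \<open>act (T x) \<mu>\<close>, so it is the Levi-Civita form of that bracket. This closes the
  system for \<open>T\<close>.\<close>

lemma dT_koszul: "dir_deriv T x a = koszul (act (T x) \<mu>) (\<Theta> x a)"
proof -
  have "dir_deriv T x (V x (\<Theta> x a)) = koszul (act (T x) \<mu>) (\<Theta> x a)"
  proof (rule koszul_unique)
    show "dir_deriv T x (V x u) v - dir_deriv T x (V x v) u = act (T x) \<mu> u v" for u v
      using dT_frame[of x "V x u" "V x v"] by (simp add: \<Theta>V)
  qed (rule dT_skew)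
  then show ?thesis by (simp add: V\<Theta>)
qed

text \<open>Since \<open>T\<close> is determined up to a skew part, symmetry of its second derivatives says that the
  curvature tensor does not change to first order when the bracket is moved by \<open>T\<close>.\<close>

lemma curvature_stationary: "Rm \<mu> (act (T x) \<mu>) u v w + Rm (act (T x) \<mu>) \<mu> u v w = 0"
proof -
  define a b where "a = V x u" and "b = V x v"
  have u: "\<Theta> x a = u" and v: "\<Theta> x b = v" by (simp_all add: a_def b_def \<Theta>V)
  let ?\<tau> = "act (T x) \<mu>" and ?G = "koszul \<mu>"
  let ?\<alpha> = "koszul ?\<tau>"
  have der: "dir_deriv (\<lambda>x. dir_deriv T x a p \<bullet> q) x b =
      koszul (act (dir_deriv T x b) \<mu>) (\<Theta> x a) p \<bullet> q + ?\<alpha> (dir_deriv \<Theta> x b a) p \<bullet> q" for a b p q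
  proof -
    have "((\<lambda>x. \<Theta> x a) has_derivative (\<lambda>b. dir_deriv \<Theta> x b a)) (at x)"
      using smooth_has_derivative[OF smooth_frame_apply, of a x]
      unfolding dir_deriv_frame_apply[symmetric] by simp
    from dir_deriv_has_derivative[OF koszul_act_has_derivative[OF smooth_has_derivative[OF smooth_T] this]]
    show ?thesis unfolding dT_koszul by blast
  qed
  have sm: "smooth_on UNIV (\<lambda>x. T x p \<bullet> q)" for p q
    by (intro smooth_bounded_linear[OF bounded_linear_inner_left] smooth_blinfun_apply smooth_T smooth_const)
  have first: "dir_deriv (\<lambda>x. T x p \<bullet> q) x a = dir_deriv T x a p \<bullet> q" for p q x a
    by (simp add: dir_deriv_bounded_linear[OF bounded_linear_inner_left] smooth_blinfun_apply
        smooth_T smooth_const dir_deriv_bounded_linear[OF blinfun.bounded_linear_left])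
  have "koszul (act (dir_deriv T x b) \<mu>) u + ?\<alpha> (dir_deriv \<Theta> x b a) =
      koszul (act (dir_deriv T x a) \<mu>) v + ?\<alpha> (dir_deriv \<Theta> x a b)"
  proof (rule blinfun_inner_eqI)
    fix p q
    have "dir_deriv (\<lambda>x. dir_deriv T x a p \<bullet> q) x b = dir_deriv (\<lambda>x. dir_deriv T x b p \<bullet> q) x a"
      using dir_deriv_commute[OF sm, of p q a x b] by (simp add: first)
    then show "(koszul (act (dir_deriv T x b) \<mu>) u + ?\<alpha> (dir_deriv \<Theta> x b a)) p \<bullet> q =
        (koszul (act (dir_deriv T x a) \<mu>) v + ?\<alpha> (dir_deriv \<Theta> x a b)) p \<bullet> q"
      unfolding der by (simp add: u v blinfun.add_left inner_left_distrib)
  qed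
  moreover have "dir_deriv \<Theta> x b a = dir_deriv \<Theta> x a b + \<mu> u v"
    using mc[of x a b] by (simp add: u v algebra_simps)
  \<comment> \<open>The derivative of \<open>T\<close> is skew, so \<open>koszul_act_skew\<close>
    applies to it, and \<open>dT_koszul\<close> evaluates it once more.\<close>
  moreover have "koszul (act (dir_deriv T x b) \<mu>) u = (?\<alpha> v o\<^sub>L ?G u) - (?G u o\<^sub>L ?\<alpha> v) - ?G (?\<alpha> v u)"
    "koszul (act (dir_deriv T x a) \<mu>) v = (?\<alpha> u o\<^sub>L ?G v) - (?G v o\<^sub>L ?\<alpha> u) - ?G (?\<alpha> u v)"
    by (simp_all add: koszul_act_skew[OF dT_skew]) (simp_all add: dT_koszul u v)
  ultimately have eq: "((?\<alpha> v o\<^sub>L ?G u) - (?G u o\<^sub>L ?\<alpha> v) - ?G (?\<alpha> v u) + ?\<alpha> (\<mu> u v)) w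
      = ((?\<alpha> u o\<^sub>L ?G v) - (?G v o\<^sub>L ?\<alpha> u) - ?G (?\<alpha> u v)) w"
    by (simp add: koszul_linear)
  have tor: "?G (?\<tau> u v) w = ?G (?\<alpha> u v) w - ?G (?\<alpha> v u) w"
    unfolding koszul_torsion[OF act_skew[OF nil_skew[OF nil]], symmetric]
    by (simp only: koszul_linear blinfun.diff_left)
  have "Rm \<mu> ?\<tau> u v w + Rm ?\<tau> \<mu> u v w =
      ((?\<alpha> u o\<^sub>L ?G v) - (?G v o\<^sub>L ?\<alpha> u) - ?G (?\<alpha> u v)) w
      - ((?\<alpha> v o\<^sub>L ?G u) - (?G u o\<^sub>L ?\<alpha> v) - ?G (?\<alpha> v u) + ?\<alpha> (\<mu> u v)) w"
    by (simp add: Rm_def tor blinfun.diff_left blinfun.add_left)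
  then show ?thesis by (simp only: eq) simp
qed

theorem derivation_S: "derivation \<mu> S"
  by (rule derivation_if_curvature_stationary[OF nil curvature_stationary[of 0] S(1) T_adj S(2)])

end

section \<open>Algebraic models\<close>

text \<open>A copy of the Lie algebra inside a Euclidean space, the inner product being the ambient one;
  the bracket is extended by \<open>0\<close> to the orthogonal complement.\<close>

definition bracket_model ::
  "'a::euclidean_space set \<Rightarrow> ('a \<Rightarrow> 'a \<Rightarrow> 'a) \<Rightarrow> ('a \<Rightarrow>\<^sub>L 'b::euclidean_space) \<Rightarrow> 'b bracket \<Rightarrow> bool" where
  "bracket_model L br \<psi> \<mu> \<longleftrightarrow> inj_on \<psi> L \<and> (\<forall>x\<in>L. \<forall>y\<in>L. \<psi> (br x y) = \<mu> (\<psi> x) (\<psi> y)) \<and>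
     (\<forall>z. (\<forall>x\<in>L. z \<bullet> \<psi> x = 0) \<longrightarrow> \<mu> z = 0 \<and> (\<forall>w. \<mu> w z = 0))"

text \<open>\<open>Ric = -1 + D\<close> with \<open>D\<close> a derivation; the constant is normalized, which also
  covers the flat case.\<close>

definition soliton_model ::
  "'a::euclidean_space set \<Rightarrow> ('a \<Rightarrow> 'a \<Rightarrow> 'a) \<Rightarrow> ('a \<Rightarrow>\<^sub>L 'b::euclidean_space) \<Rightarrow> 'b bracket \<Rightarrow> bool" where
  "soliton_model L br \<psi> \<mu> \<longleftrightarrow> bracket_model L br \<psi> \<mu> \<and> derivation \<mu> (Ric \<mu> + id_blinfun)"

lemma lie_algebra_on_skew:
  assumes "lie_algebra_on L br" "x \<in> L" "y \<in> L"
  shows "br x y = - br y x"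
proof -
  have sub: "subspace L" and sq: "\<And>z. z \<in> L \<Longrightarrow> br z z = 0"
    and lin: "\<And>x y z a b. x \<in> L \<Longrightarrow> y \<in> L \<Longrightarrow> z \<in> L \<Longrightarrow>
        br (a *\<^sub>R x + b *\<^sub>R y) z = a *\<^sub>R br x z + b *\<^sub>R br y z"
      "\<And>x y z a b. x \<in> L \<Longrightarrow> y \<in> L \<Longrightarrow> z \<in> L \<Longrightarrow>
        br z (a *\<^sub>R x + b *\<^sub>R y) = a *\<^sub>R br z x + b *\<^sub>R br z y"
    using assms(1) unfolding lie_algebra_on_def by blast+
  have "x + y \<in> L" using sub assms by (intro subspace_add)
  then have "br (x + y) (x + y) = 0" by (rule sq)
  moreover have "br (x + y) (x + y) = br x (x + y) + br y (x + y)"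
    using lin(1)[of x y "x + y" 1 1] assms \<open>x + y \<in> L\<close> by simp
  moreover have "br x (x + y) = br x x + br x y" "br y (x + y) = br y x + br y y"
    using lin(2)[of x y x 1 1] lin(2)[of x y y 1 1] assms by simp_all
  ultimately show ?thesis using sq assms by (simp add: eq_neg_iff_add_eq_0)
qed

lemma lower_central_series_subset:
  assumes "lie_algebra_on L br" shows "lower_central_series L br k \<subseteq> L"
proof (induction k)
  case (Suc k)
  have "subspace L" "\<And>x y. x \<in> L \<Longrightarrow> y \<in> L \<Longrightarrow> br x y \<in> L"
    using assms unfolding lie_algebra_on_def by blast+
  with Suc show ?case
    unfolding lower_central_series.simps by (intro span_minimal) blast+
qed simp

section \<open>Nilpotency and Ricci operator of a model\<close>

context
  fixes L :: "'a::euclidean_space set" and br and \<psi> :: "'a \<Rightarrow>\<^sub>L 'b::euclidean_space" and \<mu>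
  assumes nilp: "nilpotent_lie_algebra_on L br" and model: "bracket_model L br \<psi> \<mu>"
begin

lemma model_lie: "lie_algebra_on L br"
  using nilp by (simp add: nilpotent_lie_algebra_on_def)

lemma model_subspace: "subspace L" and model_br_in: "x \<in> L \<Longrightarrow> y \<in> L \<Longrightarrow> br x y \<in> L"
  using model_lie unfolding lie_algebra_on_def by blast+

lemma model_inj: "inj_on \<psi> L"
  and model_hom: "x \<in> L \<Longrightarrow> y \<in> L \<Longrightarrow> \<psi> (br x y) = \<mu> (\<psi> x) (\<psi> y)"
  using model unfolding bracket_model_def by blast+

lemma model_support: "(\<And>w. w \<in> \<psi> ` L \<Longrightarrow> z \<bullet> w = 0) \<Longrightarrow> \<mu> z = 0"
  and model_support_right: "(\<And>w. w \<in> \<psi> ` L \<Longrightarrow> z \<bullet> w = 0) \<Longrightarrow> \<mu> v z = 0"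
  using model unfolding bracket_model_def by blast+

lemma model_image_subspace: "subspace (\<psi> ` L)"
  by (rule linear_subspace_image[OF linear_blinfun model_subspace])

lemma model_closed: "u \<in> \<psi> ` L \<Longrightarrow> v \<in> \<psi> ` L \<Longrightarrow> \<mu> u v \<in> \<psi> ` L"
  by (auto simp: model_hom[symmetric] model_br_in)

lemma model_proj: "\<mu> (proj (\<psi> ` L) u) (proj (\<psi> ` L) v) = \<mu> u v"
proof -
  let ?q = "proj (\<psi> ` L)"
  have "\<mu> (u - ?q u) = 0" by (rule model_support) (rule proj_orthogonal[OF model_image_subspace])
  moreover have "\<mu> (?q u) (v - ?q v) = 0"
    by (rule model_support_right) (rule proj_orthogonal[OF model_image_subspace])
  ultimately show ?thesis by (simp add: blinfun.diff_right)
qed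

lemma model_bracket_in: "\<mu> u v \<in> \<psi> ` L"
  by (subst model_proj[symmetric]) (intro model_closed proj_in model_image_subspace)

lemma model_nilpotent: "nilpotent_bracket \<mu>"
  unfolding nilpotent_bracket_def
proof (intro conjI)
  let ?q = "proj (\<psi> ` L)"
  have pre: "\<exists>x\<in>L. ?q u = \<psi> x" for u using proj_in[OF model_image_subspace, of u] by blast
  have hom: "\<mu> u v = \<psi> (br x y)" if "x \<in> L" "?q u = \<psi> x" "y \<in> L" "?q v = \<psi> y" for u v x y
    using model_proj[of u v] model_hom[of x y] that by simp
  show "skew \<mu>"
    unfolding skew_def
  proof (intro allI)
    fix u v
    obtain x y where x: "x \<in> L" "?q u = \<psi> x" and y: "y \<in> L" "?q v = \<psi> y" using pre by metis
    have "\<mu> u v = \<psi> (br x y)" "\<mu> v u = \<psi> (br y x)"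
      by (intro hom x y)+
    then show "\<mu> u v = - \<mu> v u"
      using lie_algebra_on_skew[OF model_lie x(1) y(1)] by (simp add: blinfun.minus_right)
  qed
  show "jacobi \<mu>"
    unfolding jacobi_def
  proof (intro allI)
    fix u v w
    obtain x y z where x: "x \<in> L" "?q u = \<psi> x" and y: "y \<in> L" "?q v = \<psi> y" and z: "z \<in> L" "?q w = \<psi> z"
      using pre by metis
    have e: "\<mu> v w = \<psi> (br y z)" "\<mu> w u = \<psi> (br z x)" "\<mu> u v = \<psi> (br x y)"
      by (intro hom x y z)+
    have q: "?q (\<psi> t) = \<psi> t" if "t \<in> L" for t using that by (simp add: proj_id[OF model_image_subspace])
    have "\<mu> u (\<psi> (br y z)) = \<psi> (br x (br y z))" "\<mu> v (\<psi> (br z x)) = \<psi> (br y (br z x))"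
      "\<mu> w (\<psi> (br x y)) = \<psi> (br z (br x y))"
      by (intro hom q model_br_in x y z)+
    then have "\<mu> u (\<mu> v w) + \<mu> v (\<mu> w u) + \<mu> w (\<mu> u v)
        = \<psi> (br x (br y z) + br y (br z x) + br z (br x y))"
      by (simp add: e blinfun.add_right)
    also have "br x (br y z) + br y (br z x) + br z (br x y) = 0"
      using model_lie x y z unfolding lie_algebra_on_def by blast
    finally show "\<mu> u (\<mu> v w) + \<mu> v (\<mu> w u) + \<mu> w (\<mu> u v) = 0" by (simp add: blinfun.zero_right)
  qed
  let ?S = "lower_central_series UNIV (\<lambda>x y. \<mu> x y)" and ?R = "lower_central_series L br"
  \<comment> \<open>The comparison starts at \<open>Suc 0\<close>: the zeroth terms are the whole
    space and the image of \<open>L\<close>, which may differ, but every bracket already lies in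
    that image.\<close>
  have sub: "?S (Suc k) \<subseteq> \<psi> ` ?R (Suc k)" for k
  proof (induction k)
    case 0
    have "{\<mu> u v | u v. u \<in> UNIV \<and> v \<in> UNIV} \<subseteq> \<psi> ` ?R (Suc 0)"
    proof clarify
      fix u v
      obtain x y where x: "x \<in> L" "?q u = \<psi> x" and y: "y \<in> L" "?q v = \<psi> y" using pre by metis
      have "\<mu> u v = \<psi> (br x y)" by (intro hom x y)
      moreover have "br x y \<in> ?R (Suc 0)" using x y by (auto intro: span_base)
      ultimately show "\<mu> u v \<in> \<psi> ` ?R (Suc 0)" by blast
    qed
    then show ?case
      by (simp only: lower_central_series.simps(2)[of UNIV])
        (intro span_minimal linear_subspace_image[OF linear_blinfun] subspace_lower_central_series
          model_subspace; simp)
  next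
    case (Suc k)
    have "{\<mu> u v | u v. u \<in> UNIV \<and> v \<in> ?S (Suc k)} \<subseteq> \<psi> ` ?R (Suc (Suc k))"
    proof clarify
      fix u v assume "v \<in> ?S (Suc k)"
      then obtain y where y: "y \<in> ?R (Suc k)" "v = \<psi> y" using Suc by blast
      then have yL: "y \<in> L" using lower_central_series_subset[OF model_lie] by blast
      then have qv: "?q v = \<psi> y" using y by (simp add: proj_id[OF model_image_subspace])
      obtain x where x: "x \<in> L" "?q u = \<psi> x" using pre by metis
      have "\<mu> u v = \<psi> (br x y)" by (intro hom x yL qv)
      moreover have "br x y \<in> ?R (Suc (Suc k))"
        unfolding lower_central_series.simps(2)[of L br "Suc k"] using x y(1) by (intro span_base) blast
      ultimately show "\<mu> u v \<in> \<psi> ` ?R (Suc (Suc k))" by blast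
    qed
    then show ?case
      by (simp only: lower_central_series.simps(2)[of UNIV _ "Suc k"])
        (intro span_minimal linear_subspace_image[OF linear_blinfun] subspace_lower_central_series model_subspace)
  qed
  obtain K where K: "?R K = {0}" using nilp unfolding nilpotent_lie_algebra_on_def by blast
  have "br x 0 = 0" if "x \<in> L" for x
  proof -
    have 0: "0 \<in> L" using model_subspace by (rule subspace_0)
    have "br x (0 *\<^sub>R 0 + 0 *\<^sub>R 0) = 0 *\<^sub>R br x 0 + 0 *\<^sub>R br x 0"
      using model_lie that 0 unfolding lie_algebra_on_def by blast
    then show ?thesis by simp
  qed
  then have "{br x y | x y. x \<in> L \<and> y \<in> ?R K} \<subseteq> {0}" using K by auto
  then have "?R (Suc K) \<subseteq> {0}"
    unfolding lower_central_series.simps by (rule span_minimal) simp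
  then have "\<psi> ` ?R (Suc K) \<subseteq> {0}" by (auto simp: blinfun.zero_right simp del: lower_central_series.simps)
  with sub[of K] have "?S (Suc K) \<subseteq> {0}" by (rule subset_trans)
  moreover have "0 \<in> ?S (Suc K)" by (simp add: span_zero)
  ultimately show "\<exists>k. ?S k = {0}" by blast
qed

lemma model_Ric_support: "(\<And>w. w \<in> \<psi> ` L \<Longrightarrow> z \<bullet> w = 0) \<Longrightarrow> Ric \<mu> z = 0"
proof (rule vector_eq_rdot[THEN iffD1, rule_format])
  fix y assume z: "\<And>w. w \<in> \<psi> ` L \<Longrightarrow> z \<bullet> w = 0"
  have "adj (\<mu> i) z = 0" for i
  proof (rule vector_eq_rdot[THEN iffD1, rule_format])
    fix w show "adj (\<mu> i) z \<bullet> w = 0 \<bullet> w" using z[OF model_bracket_in, of i w] by (simp add: adj_left)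
  qed
  then show "Ric \<mu> z \<bullet> y = 0 \<bullet> y" using model_support_right[OF z] by (simp add: Ric_inner)
qed

lemma model_Ric_in: "Ric \<mu> z \<in> \<psi> ` L"
proof (rule in_subspaceI[OF model_image_subspace])
  fix w assume "\<And>x. x \<in> \<psi> ` L \<Longrightarrow> w \<bullet> x = 0"
  then have "Ric \<mu> w = 0" by (rule model_Ric_support)
  then show "Ric \<mu> z \<bullet> w = 0" by (simp add: Ric_self_adjoint)
qed

end

lemma derivation_scaleR: "derivation \<mu> D \<Longrightarrow> derivation (s *\<^sub>R \<mu>) (r *\<^sub>R D)"
  by (simp add: derivation_def blinfun.bilinear_simps scaleR_add_right mult.commute)

text \<open>Scaling the bracket by \<open>s\<close> multiplies \<open>Ric\<close> by the square of
  \<open>s\<close> and is absorbed into \<open>\<psi>\<close>; since \<open>c\<close> is negative,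
  that square can be chosen as \<open>-1/c\<close>. For the zero bracket every operator is a
  derivation.\<close>

lemma soliton_model_normalize:
  fixes \<psi> :: "'a::euclidean_space \<Rightarrow>\<^sub>L 'b::euclidean_space"
  assumes nilp: "nilpotent_lie_algebra_on L br" and model: "bracket_model L br \<psi> \<mu>"
    and D: "derivation \<mu> (Ric \<mu> - c *\<^sub>R id_blinfun)"
  shows "\<exists>(\<psi>' :: 'a \<Rightarrow>\<^sub>L 'b) \<mu>'. soliton_model L br \<psi>' \<mu>'"
proof (cases "\<mu> = 0")
  case True
  then have "derivation \<mu> (Ric \<mu> + id_blinfun)" by (simp add: derivation_def blinfun.zero_right)
  then show ?thesis using model unfolding soliton_model_def by blast
next
  case False
  then have c: "c < 0" using soliton_constant_negative[OF model_nilpotent[OF nilp model] D] by simp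
  define s where "s = sqrt (- 1 / c)"
  have s: "s > 0" "s * s * c = -1" using c by (simp_all add: s_def divide_neg_neg flip: power2_eq_square)
  have "bracket_model L br ((1/s) *\<^sub>R \<psi>) (s *\<^sub>R \<mu>)"
    using model s unfolding bracket_model_def
    by (auto simp: blinfun.bilinear_simps inj_on_def)
  moreover have "derivation (s *\<^sub>R \<mu>) (Ric (s *\<^sub>R \<mu>) + id_blinfun)"
  proof -
    have "Ric (s *\<^sub>R \<mu>) + id_blinfun = s\<^sup>2 *\<^sub>R (Ric \<mu> - c *\<^sub>R id_blinfun)"
      using s(2) by (simp add: Ric_scaleR power2_eq_square scaleR_diff_right)
    then show ?thesis using derivation_scaleR[OF D] by simp
  qed
  ultimately show ?thesis unfolding soliton_model_def by blast
qed

text \<open>\<open>\<psi>\<close> is the square root of the Gram operator of \<open>H\<close>, taken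
  on an eigenbasis.\<close>

lemma exists_isometry_to_standard:
  fixes H :: "'a::euclidean_space \<Rightarrow> 'a \<Rightarrow> real"
  assumes lin: "\<And>v. linear (\<lambda>u. H u v)" and sym: "\<And>u v. H u v = H v u" and pos: "\<And>u. u \<noteq> 0 \<Longrightarrow> H u u > 0"
  shows "\<exists>\<psi> :: 'a \<Rightarrow>\<^sub>L 'a. \<forall>u v. H u v = \<psi> u \<bullet> \<psi> v"
proof -
  define A where "A = Blinfun (\<lambda>u. \<Sum>b\<in>Basis. H u b *\<^sub>R b)"
  have A: "A u \<bullet> v = H u v" for u v
  proof -
    have "linear (\<lambda>u. \<Sum>b\<in>Basis. H u b *\<^sub>R b)"
      by (intro linearI) (simp_all add: linear_add[OF lin] linear_cmul[OF lin] scaleR_left_distrib sum.distrib scaleR_sum_right)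
    then have "A u \<bullet> v = (\<Sum>b\<in>Basis. H u b * (b \<bullet> v))" by (simp add: A_def Blinfun_linear inner_sum_left)
    also have "\<dots> = H (\<Sum>b\<in>Basis. (v \<bullet> b) *\<^sub>R b) u"
      unfolding linear_sum[OF lin] by (simp add: linear_cmul[OF lin] sym[of u] inner_commute mult.commute)
    finally show ?thesis by (simp add: euclidean_representation sym)
  qed
  obtain E where E: "orthonormal_eigenbasis A E"
    using exists_orthonormal_eigenbasis[of A] A sym by (metis inner_commute)
  have fin: "finite E" and eig: "\<And>e. e \<in> E \<Longrightarrow> A e = (A e \<bullet> e) *\<^sub>R e" and n1: "\<And>e. e \<in> E \<Longrightarrow> norm e = 1"
    using E unfolding orthonormal_eigenbasis_def by blast+
  define \<psi> where "\<psi> = Blinfun (\<lambda>u. \<Sum>e\<in>E. (sqrt (A e \<bullet> e) * (u \<bullet> e)) *\<^sub>R e)"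
  have \<psi>: "\<psi> u = (\<Sum>e\<in>E. (sqrt (A e \<bullet> e) * (u \<bullet> e)) *\<^sub>R e)" for u
    unfolding \<psi>_def
    by (subst Blinfun_linear)
      (auto intro!: linearI simp: inner_left_distrib distrib_left scaleR_left_distrib sum.distrib scaleR_sum_right mult_ac)
  have \<psi>e: "\<psi> u \<bullet> e = sqrt (A e \<bullet> e) * (u \<bullet> e)" if "e \<in> E" for u e
  proof -
    have "\<psi> u \<bullet> e = (\<Sum>f\<in>E. if f = e then sqrt (A e \<bullet> e) * (u \<bullet> e) else 0)"
      unfolding \<psi> inner_sum_left
      by (rule sum.cong) (use orthonormal_eigenbasis_inner[OF E] that in auto)
    then show ?thesis using fin that by simp
  qed
  have "H u v = \<psi> u \<bullet> \<psi> v" for u v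
  proof -
    have "\<psi> u \<bullet> \<psi> v = (\<Sum>e\<in>E. (sqrt (A e \<bullet> e) * (v \<bullet> e)) * (\<psi> u \<bullet> e))"
      unfolding \<psi>[of v] by (simp add: inner_sum_right)
    also have "\<dots> = (\<Sum>e\<in>E. (A e \<bullet> e) * (u \<bullet> e) * (v \<bullet> e))"
    proof (rule sum.cong[OF refl])
      fix e assume e: "e \<in> E"
      then have "e \<noteq> 0" using n1 by force
      then have "A e \<bullet> e \<ge> 0" using pos[of e] A by (simp add: less_imp_le)
      then have "sqrt (A e \<bullet> e) * sqrt (A e \<bullet> e) = A e \<bullet> e" by simp
      then show "(sqrt (A e \<bullet> e) * (v \<bullet> e)) * (\<psi> u \<bullet> e) = (A e \<bullet> e) * (u \<bullet> e) * (v \<bullet> e)"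
        unfolding \<psi>e[OF e] by (metis mult.assoc mult.commute)
    qed
    also have "\<dots> = (\<Sum>e\<in>E. (u \<bullet> e) *\<^sub>R A e) \<bullet> v"
      unfolding inner_sum_left
    proof (rule sum.cong[OF refl])
      fix e assume "e \<in> E"
      then have "A e \<bullet> v = (A e \<bullet> e) * (e \<bullet> v)" using eig by (metis inner_scaleR_left)
      then show "(A e \<bullet> e) * (u \<bullet> e) * (v \<bullet> e) = (u \<bullet> e) *\<^sub>R A e \<bullet> v"
        by (simp add: inner_commute)
    qed
    also have "(\<Sum>e\<in>E. (u \<bullet> e) *\<^sub>R A e) = A u"
    proof -
      have "A u = A (\<Sum>e\<in>E. (u \<bullet> e) *\<^sub>R e)" by (simp only: orthonormal_eigenbasis_expand[OF E])
      then show ?thesis by (simp add: blinfun.sum_right blinfun.scaleR_right)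
    qed
    finally show ?thesis by (simp add: A)
  qed
  then show ?thesis by blast
qed

section \<open>The left-invariant frame of a Lie group\<close>

lemma smooth_Pair:
  fixes f :: "'a::euclidean_space \<Rightarrow> 'b::euclidean_space" and h :: "'a \<Rightarrow> 'c::euclidean_space"
  assumes "smooth_on UNIV f" "smooth_on UNIV h"
  shows "smooth_on UNIV (\<lambda>x. (f x, h x))"
proof -
  have "smooth_on UNIV (\<lambda>x. (f x, 0::'c) + (0::'b, h x))"
    by (intro smooth_add smooth_bounded_linear[OF _ assms(1)] smooth_bounded_linear[OF _ assms(2)]
        bounded_linear_Pair bounded_linear_ident bounded_linear_zero)
  then show ?thesis by simp
qed

locale lie_group_frame =
  fixes L :: "'a::euclidean_space set" and br :: "'a \<Rightarrow> 'a \<Rightarrow> 'a" and G :: "'a monoid"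
    and g :: "'a \<Rightarrow> 'a \<Rightarrow> 'a \<Rightarrow> real"
  assumes nilp: "nilpotent_lie_algebra_on L br" and G: "lie_group_on L G"
    and LA: "has_lie_algebra G L br" and left_inv: "left_invariant_metric_on L G g"
begin

lemma L: "subspace L"
  using G by (simp add: lie_group_on_def)

sublocale grp: group G
  using G by (simp add: lie_group_on_def)

lemma carrier: "carrier G = L"
  using G by (simp add: lie_group_on_def)

abbreviation p :: "'a \<Rightarrow>\<^sub>L 'a" where "p \<equiv> proj L"

lemma p_in: "p x \<in> L" and p_id: "x \<in> L \<Longrightarrow> p x = x" and p_idem: "p (p x) = p x"
  using proj_in[OF L] proj_id[OF L] by simp_all

definition e :: 'a where "e = \<one>\<^bsub>G\<^esub>"

lemma e_in: "e \<in> L" using grp.one_closed by (simp add: e_def carrier)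

text \<open>Composing with the projection makes product and inverse smooth on the whole space, where
  the chain rule and Schwarz's theorem are available.\<close>

definition mul :: "'a \<Rightarrow> 'a \<Rightarrow> 'a" where "mul x y = p x \<otimes>\<^bsub>G\<^esub> p y"
definition inv' :: "'a \<Rightarrow> 'a" where "inv' x = inv\<^bsub>G\<^esub> (p x)"

lemma mul_in: "mul x y \<in> L" and inv'_in: "inv' x \<in> L"
  using grp.m_closed[of "p x" "p y"] grp.inv_closed[of "p x"] p_in carrier by (simp_all add: mul_def inv'_def)

lemma mul_assoc: "mul (mul x y) z = mul x (mul y z)"
proof -
  have "p (p a \<otimes>\<^bsub>G\<^esub> p b) = p a \<otimes>\<^bsub>G\<^esub> p b" for a b
    using p_id[OF mul_in[of a b]] by (simp add: mul_def)
  then show ?thesis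
    using grp.m_assoc[of "p x" "p y" "p z"] p_in carrier by (simp add: mul_def)
qed

lemma mul_e: "x \<in> L \<Longrightarrow> mul x e = x" "mul e x = p x"
  using e_in p_in[of x] grp.r_one[of x] grp.l_one[of "p x"] carrier by (simp_all add: mul_def p_id e_def[symmetric])

lemma mul_inv: "mul (inv' x) x = e" "mul x (inv' x) = e"
  using p_in[of x] inv'_in[of x] grp.l_inv[of "p x"] grp.r_inv[of "p x"] carrier
  by (simp_all add: mul_def p_id) (simp_all add: inv'_def e_def)

lemma inv_mul_cancel: "mul (inv' (mul a x)) a = inv' x"
proof -
  have "mul (mul (inv' (mul a x)) a) x = e" by (simp add: mul_assoc mul_inv)
  then have "mul (mul (mul (inv' (mul a x)) a) x) (inv' x) = mul e (inv' x)" by simp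
  then have "mul (mul (inv' (mul a x)) a) e = inv' x"
    using mul_assoc[of "mul (inv' (mul a x)) a" x "inv' x"] by (simp add: mul_inv mul_e inv'_in p_id)
  then show ?thesis using mul_in by (simp add: mul_e)
qed

lemma smooth_mul: "smooth_on UNIV (\<lambda>z. mul (fst z) (snd z))"
proof -
  have "smooth_on (L \<times> L) (\<lambda>(x, y). x \<otimes>\<^bsub>G\<^esub> y)" using G by (simp add: lie_group_on_def)
  moreover have "bounded_linear (\<lambda>z. (p (fst z), p (snd z)))"
    by (intro bounded_linear_Pair bounded_linear_compose[OF blinfun.bounded_linear_right]
        bounded_linear_fst bounded_linear_snd)
  ultimately have "smooth_on UNIV (\<lambda>z. (\<lambda>(x, y). x \<otimes>\<^bsub>G\<^esub> y) (p (fst z), p (snd z)))"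
    by (intro smooth_on_linear_precompose[of "L \<times> L" UNIV]) (auto intro: subspace_Times L p_in)
  then show ?thesis by (simp add: mul_def)
qed

lemma smooth_inv': "smooth_on UNIV inv'"
proof -
  have "smooth_on L (\<lambda>x. inv\<^bsub>G\<^esub> x)" using G by (simp add: lie_group_on_def)
  then have "smooth_on UNIV (\<lambda>x. inv\<^bsub>G\<^esub> (p x))"
    by (rule smooth_on_linear_precompose[rotated 4]) (auto intro: L p_in blinfun.bounded_linear_right)
  then show ?thesis by (simp add: inv'_def[abs_def])
qed

lemma smooth_mul_comp: "smooth_on UNIV f \<Longrightarrow> smooth_on UNIV h \<Longrightarrow> smooth_on UNIV (\<lambda>x. mul (f x) (h x))"
  for f h :: "'c::euclidean_space \<Rightarrow> 'a"
  using smooth_compose[OF smooth_mul smooth_Pair, of f h] by simp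

lemma smooth_mul_left: "smooth_on UNIV (mul a)"
  using smooth_mul_comp[OF smooth_const smooth_linear[OF bounded_linear_ident]] .

definition lt :: "'a \<Rightarrow> 'a \<Rightarrow> 'a \<Rightarrow>\<^sub>L 'a" where
  "lt a x = Blinfun (dir_deriv (mul a) x)"

lemma lt: "lt a x v = dir_deriv (mul a) x v"
  by (simp add: lt_def Blinfun_linear linear_dir_deriv smooth_mul_left)

text \<open>\<open>lt\<close> is a partial derivative of the jointly smooth product, in direction
  \<open>(0, v)\<close>.\<close>

lemma smooth_lt:
  fixes f h :: "'a \<Rightarrow> 'a"
  assumes "smooth_on UNIV f" "smooth_on UNIV h"
  shows "smooth_on UNIV (\<lambda>x. lt (f x) (h x))"
proof (rule smooth_blinfunI)
  fix v
  have "lt (f x) (h x) v = dir_deriv (\<lambda>z. mul (fst z) (snd z)) (f x, h x) (0, v)" for x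
    by (simp add: lt dir_deriv_def)
  then show "smooth_on UNIV (\<lambda>x. lt (f x) (h x) v)"
    using smooth_compose[OF smooth_dir_deriv[OF smooth_mul] smooth_Pair[OF assms]] by simp
qed

lemma lt_in: "lt a x v \<in> L"
  unfolding lt by (rule dir_deriv_in_subspace[OF smooth_mul_left subspace_UNIV L mul_in]) auto

lemma lt_mul: "lt (mul a b) x v = lt a (mul b x) (lt b x v)"
proof -
  have "mul (mul a b) = (\<lambda>y. mul a (mul b y))" by (rule ext) (rule mul_assoc)
  then show ?thesis by (simp add: lt dir_deriv_compose smooth_mul_left)
qed

lemma lt_e: "v \<in> L \<Longrightarrow> lt e x v = v"
proof -
  have "mul e = p" by (rule ext) (rule mul_e)
  then show "v \<in> L \<Longrightarrow> lt e x v = v"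
    by (simp add: lt dir_deriv_linear blinfun.bounded_linear_right p_id)
qed

lemma lt_eq: "a \<in> L \<Longrightarrow> x \<in> L \<Longrightarrow> v \<in> L \<Longrightarrow> left_translation_deriv G a x v = lt a x v"
  unfolding left_translation_deriv_def lt
  by (rule dir_deriv_cong[OF L]) (simp_all add: mul_def p_id)

text \<open>The left Maurer-Cartan form; \<open>\<nu>\<close> below is the left-invariant frame
  inverse to it.\<close>

definition \<theta> :: "'a \<Rightarrow> 'a \<Rightarrow>\<^sub>L 'a" where "\<theta> x = lt (inv' x) x"
definition \<nu> :: "'a \<Rightarrow> 'a \<Rightarrow>\<^sub>L 'a" where "\<nu> x = lt x e"

lemma smooth_\<theta>: "smooth_on UNIV \<theta>" and smooth_\<nu>: "smooth_on UNIV \<nu>"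
  unfolding \<theta>_def[abs_def] \<nu>_def[abs_def]
  by (intro smooth_lt smooth_inv' smooth_linear bounded_linear_ident smooth_const)+

lemma \<theta>_in: "\<theta> x v \<in> L" and \<nu>_in: "\<nu> x v \<in> L"
  by (simp_all add: \<theta>_def \<nu>_def lt_in)

lemma \<theta>_\<nu>: "x \<in> L \<Longrightarrow> v \<in> L \<Longrightarrow> \<theta> x (\<nu> x v) = v"
  using lt_mul[of "inv' x" x e v] by (simp add: \<theta>_def \<nu>_def mul_e mul_inv lt_e)

lemma \<nu>_\<theta>: "x \<in> L \<Longrightarrow> v \<in> L \<Longrightarrow> \<nu> x (\<theta> x v) = v"
  using lt_mul[of x "inv' x" x v] by (simp add: \<theta>_def \<nu>_def mul_inv lt_e)

lemma \<nu>_e: "v \<in> L \<Longrightarrow> \<nu> e v = v"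
  by (simp add: \<nu>_def lt_e)

lemma \<theta>_e: "v \<in> L \<Longrightarrow> \<theta> e v = v"
  using \<theta>_\<nu>[OF e_in] \<nu>_e by metis

lemma \<theta>_left_invariant: "\<theta> (mul a x) (lt a x v) = \<theta> x v"
  using lt_mul[of "inv' (mul a x)" a x v] by (simp add: \<theta>_def inv_mul_cancel)

text \<open>Differentiating \<open>\<theta> x (\<nu> x v) = v\<close> at the identity shows that
  \<open>\<theta>\<close> and \<open>\<nu>\<close> have opposite derivatives there, and the bracket
  of left-invariant fields is the antisymmetrized derivative of \<open>\<nu>\<close>.\<close>

lemma maurer_cartan_e:
  assumes u: "u \<in> L" and v: "v \<in> L"
  shows "dir_deriv \<theta> e u v - dir_deriv \<theta> e v u = - br u v"
proof -
  have d\<nu>: "dir_deriv \<nu> e u v = - dir_deriv \<theta> e u v" if u: "u \<in> L" and v: "v \<in> L" for u v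
  proof -
    have app: "smooth_on UNIV (\<lambda>x. \<nu> x v)" by (rule smooth_blinfun_apply[OF smooth_\<nu> smooth_const])
    have dapp: "dir_deriv (\<lambda>x. \<nu> x v) e u = dir_deriv \<nu> e u v"
      by (rule dir_deriv_bounded_linear[OF blinfun.bounded_linear_left smooth_\<nu>])
    have "dir_deriv (\<lambda>x. \<theta> x (\<nu> x v)) e u = dir_deriv (\<lambda>x. v) e u"
      by (rule dir_deriv_cong[OF L]) (use u v e_in \<theta>_\<nu> in auto)
    then have "\<theta> e (dir_deriv \<nu> e u v) + dir_deriv \<theta> e u (\<nu> e v) = 0"
      by (simp add: dir_deriv_blinfun_apply[OF smooth_\<theta> app] dapp)
    moreover have "dir_deriv \<nu> e u v \<in> L"
      unfolding dapp[symmetric] by (rule dir_deriv_in_subspace[OF app L L \<nu>_in e_in u])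
    ultimately show ?thesis using v by (simp add: \<theta>_e \<nu>_e eq_neg_iff_add_eq_0)
  qed
  have fld: "left_inv_field G w x = \<nu> x w" if "x \<in> L" "w \<in> L" for x w
    using that e_in by (simp add: left_inv_field_def \<nu>_def lt_eq e_def[symmetric])
  have "dir_deriv (left_inv_field G w) e z = dir_deriv \<nu> e z w" if "w \<in> L" "z \<in> L" for w z
  proof -
    have "dir_deriv (left_inv_field G w) e z = dir_deriv (\<lambda>x. \<nu> x w) e z"
      by (rule dir_deriv_cong[OF L]) (use that e_in fld in auto)
    then show ?thesis by (simp add: dir_deriv_bounded_linear[OF blinfun.bounded_linear_left smooth_\<nu>])
  qed
  then have "vf_bracket (left_inv_field G u) (left_inv_field G v) e = dir_deriv \<nu> e u v - dir_deriv \<nu> e v u"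
    using u v by (simp add: vf_bracket_def fld e_in \<nu>_e)
  moreover have "vf_bracket (left_inv_field G u) (left_inv_field G v) e = br u v"
    using LA u v unfolding has_lie_algebra_def e_def by blast
  ultimately show ?thesis using u v by (simp add: d\<nu>)
qed

text \<open>Left invariance carries the identity case to \<open>x\<close>. Differentiating it leaves
  an error term \<open>m\<close> with the second derivative of the translation, which is symmetric
  and drops out.\<close>

lemma maurer_cartan_L:
  assumes x: "x \<in> L" and a: "a \<in> L" and b: "b \<in> L"
  shows "dir_deriv \<theta> x a b - dir_deriv \<theta> x b a = - br (\<theta> x a) (\<theta> x b)"
proof -
  have D: "dir_deriv \<theta> x (\<nu> x u) (\<nu> x v) + \<theta> x (dir_deriv (\<lambda>y. dir_deriv (mul x) y v) e u) = dir_deriv \<theta> e u v"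
    if u: "u \<in> L" and v: "v \<in> L" for u v
  proof -
    have sm: "smooth_on UNIV (\<lambda>y. \<theta> (mul x y))" by (rule smooth_compose[OF smooth_\<theta> smooth_mul_left])
    have "(\<lambda>y. \<theta> (mul x y) (dir_deriv (mul x) y v)) = (\<lambda>y. \<theta> y v)"
      by (rule ext) (simp add: \<theta>_left_invariant flip: lt)
    then have "dir_deriv (\<lambda>y. \<theta> (mul x y) (dir_deriv (mul x) y v)) e u = dir_deriv (\<lambda>y. \<theta> y v) e u"
      by simp
    moreover have "dir_deriv (\<lambda>y. \<theta> (mul x y)) e u = dir_deriv \<theta> x (\<nu> x u)"
      using x by (simp add: dir_deriv_compose smooth_\<theta> smooth_mul_left mul_e \<nu>_def lt)
    ultimately show ?thesis
      using x by (simp add: dir_deriv_blinfun_apply[OF sm smooth_dir_deriv[OF smooth_mul_left]] mul_e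
         \<nu>_def lt dir_deriv_bounded_linear[OF blinfun.bounded_linear_left smooth_\<theta>] add.commute)
  qed
  let ?u = "\<theta> x a" and ?v = "\<theta> x b"
  define m where "m = \<theta> x (dir_deriv (\<lambda>y. dir_deriv (mul x) y ?v) e ?u)"
  have m': "m = \<theta> x (dir_deriv (\<lambda>y. dir_deriv (mul x) y ?u) e ?v)"
    unfolding m_def by (subst dir_deriv_commute[OF smooth_mul_left]) (rule refl)
  have "dir_deriv \<theta> x (\<nu> x ?u) (\<nu> x ?v) = dir_deriv \<theta> e ?u ?v - m"
    "dir_deriv \<theta> x (\<nu> x ?v) (\<nu> x ?u) = dir_deriv \<theta> e ?v ?u - m"
    using D[OF \<theta>_in \<theta>_in, of x a x b] D[OF \<theta>_in \<theta>_in, of x b x a]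
    unfolding m_def[symmetric] m'[symmetric] by (simp_all only: eq_diff_eq)
  then have "dir_deriv \<theta> x (\<nu> x ?u) (\<nu> x ?v) - dir_deriv \<theta> x (\<nu> x ?v) (\<nu> x ?u) = - br ?u ?v"
    using maurer_cartan_e[OF \<theta>_in \<theta>_in, of x a x b] by simp
  then show ?thesis using x a b by (simp add: \<nu>_\<theta>)
qed

lemma metric_\<theta>:
  assumes "x \<in> L" "u \<in> L" "v \<in> L"
  shows "g x u v = g e (\<theta> x u) (\<theta> x v)"
proof -
  have "g (inv' x \<otimes>\<^bsub>G\<^esub> x) (left_translation_deriv G (inv' x) x u) (left_translation_deriv G (inv' x) x v) = g x u v"
    using left_inv assms inv'_in[of x] unfolding left_invariant_metric_on_def by blast
  moreover have "inv' x \<otimes>\<^bsub>G\<^esub> x = e"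
    using mul_inv(1)[of x] assms inv'_in[of x] by (simp add: mul_def p_id)
  ultimately show ?thesis using assms inv'_in[of x] by (simp add: lt_eq \<theta>_def)
qed

end

section \<open>Soliton metrics are algebraic\<close>

context lie_group_frame
begin

text \<open>The given inner product on \<open>L\<close>, completed by the ambient one on the
  orthogonal complement, which thereby becomes a flat factor.\<close>

definition H :: "'a \<Rightarrow> 'a \<Rightarrow> real" where
  "H u v = g e (p u) (p v) + (u - p u) \<bullet> (v - p v)"

lemma metric_rules:
  shows metric_sym: "u \<in> L \<Longrightarrow> v \<in> L \<Longrightarrow> g e u v = g e v u"
    and metric_pos: "u \<in> L \<Longrightarrow> u \<noteq> 0 \<Longrightarrow> g e u u > 0"
    and metric_lin: "u \<in> L \<Longrightarrow> v \<in> L \<Longrightarrow> w \<in> L \<Longrightarrow>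
      g e (a *\<^sub>R u + b *\<^sub>R v) w = a * g e u w + b * g e v w"
  using left_inv e_in unfolding left_invariant_metric_on_def riemannian_metric_on_def by blast+

lemma H_linear: "linear (\<lambda>u. H u v)"
proof (rule linearI)
  fix x y
  show "H (x + y) v = H x v + H y v"
    using metric_lin[of "p x" "p y" "p v" 1 1] p_in
    by (simp add: H_def blinfun.add_right inner_left_distrib inner_diff_left)
next
  fix r x
  show "H (r *\<^sub>R x) v = r *\<^sub>R H x v"
    using metric_lin[of "p x" "p x" "p v" r 0] p_in
    by (simp add: H_def blinfun.scaleR_right inner_diff_left algebra_simps)
qed

lemma H_sym: "H u v = H v u"
  using metric_sym p_in by (simp add: H_def inner_commute)

lemma H_pos: "u \<noteq> 0 \<Longrightarrow> H u u > 0"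
proof (cases "p u = 0")
  case True
  have "g e 0 0 = 0" using metric_lin[of 0 0 0 0 0] subspace_0[OF L] by simp
  then show "u \<noteq> 0 \<Longrightarrow> H u u > 0" using True by (simp add: H_def)
next
  case False
  then show ?thesis using metric_pos[OF p_in False] by (simp add: H_def add_pos_nonneg)
qed

definition \<psi> :: "'a \<Rightarrow>\<^sub>L 'a" where "\<psi> = (SOME \<psi> :: 'a \<Rightarrow>\<^sub>L 'a. \<forall>u v. H u v = \<psi> u \<bullet> \<psi> v)"

lemma \<psi>: "\<psi> u \<bullet> \<psi> v = H u v"
proof -
  have "\<forall>u v. H u v = \<psi> u \<bullet> \<psi> v"
    unfolding \<psi>_def by (rule someI_ex) (rule exists_isometry_to_standard[OF H_linear H_sym H_pos])
  then show ?thesis by (simp only:)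
qed

lemma inj_\<psi>: "inj \<psi>"
proof (rule injI)
  fix x y assume "\<psi> x = \<psi> y"
  then have "\<psi> (x - y) \<bullet> \<psi> (x - y) = 0" by (simp add: blinfun.diff_right)
  then show "x = y" using H_pos[of "x - y"] by (auto simp: \<psi>)
qed

definition \<psi>i :: "'a \<Rightarrow>\<^sub>L 'a" where "\<psi>i = Blinfun (inv_into UNIV \<psi>)"

lemma \<psi>i_\<psi>: "\<psi>i (\<psi> x) = x" and \<psi>_\<psi>i: "\<psi> (\<psi>i x) = x"
proof -
  have surj: "surj \<psi>" using linear_injective_imp_surjective[OF linear_blinfun inj_\<psi>] by simp
  have "linear (inv_into UNIV \<psi>)"
  proof (rule linearI)
    fix x y
    have "\<psi> (inv_into UNIV \<psi> x + inv_into UNIV \<psi> y) = x + y" using surj by (simp add: blinfun.add_right surj_f_inv_f)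
    then show "inv_into UNIV \<psi> (x + y) = inv_into UNIV \<psi> x + inv_into UNIV \<psi> y" using inj_\<psi> by (metis inv_f_f)
  next
    fix r x
    have "\<psi> (r *\<^sub>R inv_into UNIV \<psi> x) = r *\<^sub>R x" using surj by (simp add: blinfun.scaleR_right surj_f_inv_f)
    then show "inv_into UNIV \<psi> (r *\<^sub>R x) = r *\<^sub>R inv_into UNIV \<psi> x" using inj_\<psi> by (metis inv_f_f)
  qed
  then have "blinfun_apply \<psi>i = inv_into UNIV \<psi>" by (simp add: \<psi>i_def Blinfun_linear)
  then show "\<psi>i (\<psi> x) = x" "\<psi> (\<psi>i x) = x" using inj_\<psi> surj by (simp_all add: surj_f_inv_f)
qed

definition \<mu> :: "'a bracket" where "\<mu> = bracket_of (\<lambda>x y. \<psi> (br (p (\<psi>i x)) (p (\<psi>i y))))"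

lemma br_lin:
  "x \<in> L \<Longrightarrow> y \<in> L \<Longrightarrow> z \<in> L \<Longrightarrow> br (a *\<^sub>R x + b *\<^sub>R y) z = a *\<^sub>R br x z + b *\<^sub>R br y z"
  "x \<in> L \<Longrightarrow> y \<in> L \<Longrightarrow> z \<in> L \<Longrightarrow> br z (a *\<^sub>R x + b *\<^sub>R y) = a *\<^sub>R br z x + b *\<^sub>R br z y"
  using nilp unfolding nilpotent_lie_algebra_on_def lie_algebra_on_def by blast+

lemma br_linear: "linear (\<lambda>x. br (p x) (p y))" "linear (\<lambda>y. br (p x) (p y))"
proof -
  have "br (p (x + x')) (p y) = br (p x) (p y) + br (p x') (p y)"
    "br (p y) (p (x + x')) = br (p y) (p x) + br (p y) (p x')"
    "br (p (r *\<^sub>R x)) (p y) = r *\<^sub>R br (p x) (p y)" "br (p y) (p (r *\<^sub>R x)) = r *\<^sub>R br (p y) (p x)" for x x' y r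
    using br_lin(1)[OF p_in p_in p_in, of 1 x 1 x' y] br_lin(2)[OF p_in p_in p_in, of y 1 x 1 x']
      br_lin(1)[OF p_in p_in p_in, of r x 0 x y] br_lin(2)[OF p_in p_in p_in, of y r x 0 x]
    by (simp_all add: blinfun.add_right blinfun.scaleR_right)
  then show "linear (\<lambda>x. br (p x) (p y))" "linear (\<lambda>y. br (p x) (p y))"
    by (auto intro!: linearI)
qed

lemma \<mu>: "\<mu> x y = \<psi> (br (p (\<psi>i x)) (p (\<psi>i y)))"
  unfolding \<mu>_def
proof (rule bracket_of_apply)
  show "linear (\<lambda>x. \<psi> (br (p (\<psi>i x)) (p (\<psi>i y))))" for y
    using linear_compose[OF linear_compose[OF linear_blinfun[of \<psi>i] br_linear(1)[of "\<psi>i y"]] linear_blinfun[of \<psi>]]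
    by (simp add: o_def)
  show "linear (\<lambda>y. \<psi> (br (p (\<psi>i x)) (p (\<psi>i y))))" for x
    using linear_compose[OF linear_compose[OF linear_blinfun[of \<psi>i] br_linear(2)[of "\<psi>i x"]] linear_blinfun[of \<psi>]]
    by (simp add: o_def)
qed

lemma model: "bracket_model L br \<psi> \<mu>"
  unfolding bracket_model_def
proof (intro conjI ballI allI impI)
  show "inj_on \<psi> L" using inj_\<psi> by (rule inj_on_subset) simp
  show "\<psi> (br x y) = \<mu> (\<psi> x) (\<psi> y)" if "x \<in> L" "y \<in> L" for x y
    using that by (simp add: \<mu> \<psi>i_\<psi> p_id)
next
  fix z assume z: "\<forall>x\<in>L. z \<bullet> \<psi> x = 0"
  have "\<psi> (\<psi>i z) \<bullet> \<psi> (p (\<psi>i z)) = 0" using z p_in by (simp add: \<psi>_\<psi>i)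
  then have "g e (p (\<psi>i z)) (p (\<psi>i z)) = 0" by (simp add: \<psi> H_def p_idem)
  then have z0: "p (\<psi>i z) = 0" using metric_pos[OF p_in] by force
  show "\<mu> z = 0"
    by (rule blinfun_eqI) (use z0 linear_0[OF br_linear(1)] in \<open>simp add: \<mu> blinfun.zero_right\<close>)
  show "\<mu> w z = 0" for w
    using z0 linear_0[OF br_linear(2)] by (simp add: \<mu> blinfun.zero_right)
qed

lemma nil_\<mu>: "nilpotent_bracket \<mu>"
  by (rule model_nilpotent[OF nilp model])

definition W where "W = \<psi> ` L"

lemma W: "subspace W" unfolding W_def by (rule model_image_subspace[OF nilp model])

lemma p_diff: "p (a - p a) = 0" by (simp add: blinfun.diff_right p_idem)

lemma orthogonal_complement:
  assumes "w \<in> W" shows "\<psi> (a - p a) \<bullet> w = 0"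
proof -
  obtain x where x: "x \<in> L" "w = \<psi> x" using assms by (auto simp: W_def)
  have "g e 0 x = 0" using metric_lin[of 0 0 x 0 0] x subspace_0[OF L] by simp
  then have "H (a - p a) x = 0" unfolding H_def p_diff p_id[OF x(1)] by simp
  then show ?thesis using x by (simp only: \<psi>)
qed

text \<open>The frame of the product of the group with the flat complement; it is constant in the
  flat directions.\<close>

definition \<Theta> :: "'a \<Rightarrow> 'a \<Rightarrow>\<^sub>L 'a" where
  "\<Theta> x = \<psi> o\<^sub>L ((\<theta> (p x) o\<^sub>L p) + (id_blinfun - p))"

definition V :: "'a \<Rightarrow> 'a \<Rightarrow>\<^sub>L 'a" where
  "V x = ((\<nu> (p x) o\<^sub>L p) + (id_blinfun - p)) o\<^sub>L \<psi>i"

lemma \<Theta>: "\<Theta> x a = \<psi> (\<theta> (p x) (p a) + (a - p a))"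
  by (simp add: \<Theta>_def blinfun.add_left blinfun.diff_left)

lemma V: "V x w = \<nu> (p x) (p (\<psi>i w)) + (\<psi>i w - p (\<psi>i w))"
  by (simp add: V_def blinfun.add_left blinfun.diff_left)

lemma V_\<Theta>: "V x (\<Theta> x a) = a"
  by (simp add: V \<Theta> \<psi>i_\<psi> blinfun.add_right p_diff p_id[OF \<theta>_in] \<nu>_\<theta>[OF p_in p_in])

lemma \<Theta>_V: "\<Theta> x (V x w) = w"
  by (simp add: V \<Theta> blinfun.add_right p_diff p_id[OF \<nu>_in] \<theta>_\<nu>[OF p_in p_in])
    (simp add: \<psi>_\<psi>i flip: blinfun.add_right)

lemma smooth_comp_p: "smooth_on UNIV f \<Longrightarrow> smooth_on UNIV (\<lambda>x. f (p x))"
  by (rule smooth_on_linear_precompose) (auto intro: blinfun.bounded_linear_right)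

lemma smooth_\<Theta>: "smooth_on UNIV \<Theta>" and smooth_V: "smooth_on UNIV V"
  unfolding \<Theta>_def[abs_def] V_def[abs_def]
  by (intro smooth_blinfun_compose smooth_const smooth_add smooth_comp_p[OF smooth_\<theta>] smooth_comp_p[OF smooth_\<nu>])+

lemma dir_deriv_\<Theta>: "dir_deriv \<Theta> x a b = \<psi> (dir_deriv \<theta> (p x) (p a) (p b))"
proof -
  have sm: "smooth_on UNIV (\<lambda>x. \<theta> (p x) (p b))"
    by (rule smooth_blinfun_apply[OF smooth_comp_p[OF smooth_\<theta>] smooth_const])
  have "dir_deriv \<Theta> x a b = dir_deriv (\<lambda>x. \<Theta> x b) x a"
    by (simp add: dir_deriv_bounded_linear[OF blinfun.bounded_linear_left smooth_\<Theta>])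
  also have "\<dots> = \<psi> (dir_deriv (\<lambda>x. \<theta> (p x) (p b) + (b - p b)) x a)"
    unfolding \<Theta>
    by (rule dir_deriv_bounded_linear[OF blinfun.bounded_linear_right]) (intro smooth_add sm smooth_const)
  also have "dir_deriv (\<lambda>x. \<theta> (p x) (p b) + (b - p b)) x a = dir_deriv (\<lambda>x. \<theta> (p x) (p b)) x a"
    by (simp add: dir_deriv_add[OF sm smooth_const])
  also have "\<dots> = dir_deriv (\<lambda>x. \<theta> (p x)) x a (p b)"
    by (rule dir_deriv_bounded_linear[OF blinfun.bounded_linear_left]) (rule smooth_comp_p[OF smooth_\<theta>])
  also have "dir_deriv (\<lambda>x. \<theta> (p x)) x a = dir_deriv \<theta> (p x) (p a)"
    by (simp add: dir_deriv_def blinfun.add_right blinfun.scaleR_right)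
  finally show ?thesis .
qed

lemma p_\<psi>i_\<Theta>: "p (\<psi>i (\<Theta> x a)) = \<theta> (p x) (p a)"
  by (simp add: \<Theta> \<psi>i_\<psi> blinfun.add_right p_diff p_id[OF \<theta>_in])

lemma maurer_cartan_\<Theta>: "dir_deriv \<Theta> x a b - dir_deriv \<Theta> x b a = - \<mu> (\<Theta> x a) (\<Theta> x b)"
  using maurer_cartan_L[OF p_in p_in p_in, of x a b]
  by (simp add: dir_deriv_\<Theta> \<mu> p_\<psi>i_\<Theta> flip: blinfun.diff_right blinfun.minus_right)

lemma \<Theta>_in: "a \<in> L \<Longrightarrow> \<Theta> x a \<in> W"
  by (simp add: \<Theta> W_def p_id \<theta>_in)

lemma frame: "mc_frame L W \<mu> \<Theta> V g"
proof
  show "V x w \<in> L" if "x \<in> L" "w \<in> W" for x w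
    using that by (auto simp: V W_def \<psi>i_\<psi> p_id \<nu>_in)
  show "g x a b = \<Theta> x a \<bullet> \<Theta> x b" if "x \<in> L" "a \<in> L" "b \<in> L" for x a b
    using metric_\<theta>[OF that] that by (simp add: \<Theta> \<psi> H_def p_id \<theta>_in)
  show "\<mu> z = 0" if "\<And>w. w \<in> W \<Longrightarrow> z \<bullet> w = 0" for z
    using that unfolding W_def by (rule model_support[OF nilp model])
  show "\<mu> u v \<in> W" for u v unfolding W_def by (rule model_bracket_in[OF nilp model])
qed (simp_all add: L W smooth_\<Theta> smooth_V \<Theta>_in V_\<Theta> \<Theta>_V nil_\<mu> maurer_cartan_\<Theta>)

lemma frame_full: "mc_frame UNIV UNIV \<mu> \<Theta> V (\<lambda>x a b. \<Theta> x a \<bullet> \<Theta> x b)"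
proof
  show "\<mu> z = 0" if "\<And>w. w \<in> UNIV \<Longrightarrow> z \<bullet> w = 0" for z
    using that[of z] by (simp add: blinfun.zero_right)
qed (simp_all add: smooth_\<Theta> smooth_V V_\<Theta> \<Theta>_V nil_\<mu> maurer_cartan_\<Theta>)

lemma Ric_proj: "Ric \<mu> (proj W u) = Ric \<mu> u"
proof -
  have "Ric \<mu> (u - proj W u) = 0"
    by (rule model_Ric_support[OF nilp model]) (simp add: proj_orthogonal[OF W] flip: W_def)
  then show ?thesis by (simp add: blinfun.diff_right)
qed

lemma proj_Ric: "proj W (Ric \<mu> u) = Ric \<mu> u"
  using model_Ric_in[OF nilp model] by (simp add: proj_id[OF W] flip: W_def)

lemma proj_\<Theta>: "proj W (\<Theta> x a) = \<Theta> (p x) (p a)"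
proof (rule proj_eqI[OF W])
  show "\<Theta> (p x) (p a) \<in> W" by (rule \<Theta>_in[OF p_in])
  fix z assume "z \<in> W"
  have "\<Theta> x a - \<Theta> (p x) (p a) = \<psi> (a - p a)"
    by (simp add: \<Theta> p_idem blinfun.add_right)
  then show "(\<Theta> x a - \<Theta> (p x) (p a)) \<bullet> z = 0" using orthogonal_complement[OF \<open>z \<in> W\<close>] by simp
qed

theorem exists_soliton_model:
  assumes "ricci_soliton_on L g"
  shows "\<exists>(\<psi> :: 'a \<Rightarrow>\<^sub>L 'a) \<mu>. soliton_model L br \<psi> \<mu>"
proof -
  interpret F: mc_frame L W \<mu> \<Theta> V g by (rule frame)
  obtain c X where vX: "vector_field_on L X"
    and sol': "\<forall>x\<in>L. \<forall>u\<in>L. \<forall>v\<in>L.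
      ricci_curvature L g x u v = c * g x u v + lie_derivative_metric X g x u v"
    using assms unfolding ricci_soliton_on_def by (elim conjE exE) (rule that)
  have X: "smooth_on L X" "X ` L \<subseteq> L" using vX by (simp_all add: vector_field_on_def)
  have sol: "ricci_curvature L g x u v = c * g x u v + lie_derivative_metric X g x u v"
    if "x \<in> L" "u \<in> L" "v \<in> L" for x u v
    using sol' that by simp
  define Y where "Y x = X (p x)" for x
  have Y: "smooth_on UNIV Y"
    unfolding Y_def by (rule smooth_on_linear_precompose[OF L _ blinfun.bounded_linear_right _ X(1)])
      (auto intro: p_in)
  have Y_in: "Y x \<in> L" for x using X(2) p_in by (auto simp: Y_def)
  have lieXY: "lie_derivative_metric X g x u v = lie_derivative_metric Y g x u v"
    if "x \<in> L" "u \<in> L" "v \<in> L" for x u v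
  proof -
    have "dir_deriv X x w = dir_deriv Y x w" if "w \<in> L" for w
      by (rule dir_deriv_cong[OF L]) (use that \<open>x \<in> L\<close> in \<open>auto simp: Y_def p_id\<close>)
    then show ?thesis using that by (simp add: lie_derivative_metric_def Y_def p_id)
  qed
  define y where "y x = \<Theta> x (Y x)" for x
  have smooth_y: "smooth_on UNIV y"
    unfolding y_def by (intro smooth_blinfun_apply smooth_\<Theta> Y)
  have y_in: "y x \<in> W" for x unfolding y_def by (rule \<Theta>_in[OF Y_in])
  define \<tau> where "\<tau> x a = dir_deriv y x a + \<mu> (\<Theta> x a) (y x)" for x a
  have y_p: "y (p x) = y x" for x
    unfolding y_def using proj_\<Theta>[of x "Y x"] Y_in[of x] \<Theta>_in[OF Y_in, of x x]
    by (simp add: p_id proj_id[OF W] Y_def p_idem)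
  have "\<mu> (\<Theta> x a) = \<mu> (\<Theta> (p x) (p a))" for x a
  proof -
    have "\<mu> (\<Theta> x a - proj W (\<Theta> x a)) = 0"
      by (rule F.support) (rule proj_orthogonal[OF W])
    then show ?thesis by (simp add: blinfun.diff_right proj_\<Theta>)
  qed
  moreover have "dir_deriv y x a = dir_deriv y (p x) (p a)" for x a
  proof -
    have "(\<lambda>t. y (x + t *\<^sub>R a)) = (\<lambda>t. y (p x + t *\<^sub>R p a))"
      by (rule ext) (metis y_p blinfun.add_right blinfun.scaleR_right)
    then show ?thesis by (simp add: dir_deriv_def)
  qed
  ultimately have \<tau>_p: "\<tau> x a = \<tau> (p x) (p a)" for x a by (simp add: \<tau>_def y_p)
  have \<tau>_in: "\<tau> x a \<in> W" for x a
    unfolding \<tau>_def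
    by (intro subspace_add W dir_deriv_in_subspace[OF smooth_y subspace_UNIV W y_in])
      (auto simp: W_def model_bracket_in[OF nilp model])
  have eqL: "\<tau> x a \<bullet> \<Theta> x b + \<Theta> x a \<bullet> \<tau> x b = Ric \<mu> (\<Theta> x a) \<bullet> \<Theta> x b - c * (\<Theta> x a \<bullet> \<Theta> x b)"
    if "x \<in> L" "a \<in> L" "b \<in> L" for x a b
    using sol[OF that] F.ricci_curvature_eq[OF that] F.lie_derivative_metric_eq[OF Y Y_in that]
    unfolding lieXY[OF that] F.metric[OF that] \<tau>_def y_def by simp
  \<comment> \<open>The extended field neither depends on the flat directions nor points along them,
    so the symmetric operator must vanish there; hence \<open>proj W\<close> and not the
    identity.\<close>
  define S where "S = Ric \<mu> - c *\<^sub>R proj W"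
  have inner_p: "u \<bullet> v = u \<bullet> proj W v" if "u \<in> W" for u v
    using proj_inner[OF W, of u v] proj_id[OF W that] by simp
  interpret M: mc_frame_full \<mu> \<Theta> V y S
  proof (intro mc_frame_full.intro frame_full mc_frame_full_axioms.intro)
    show "smooth_on UNIV y" by (rule smooth_y)
    show "adj S = S" by (simp add: S_def adj_linear adj_Ric adj_proj[OF W])
    show "S o\<^sub>L Ric \<mu> = Ric \<mu> o\<^sub>L S"
      by (rule blinfun_eqI)
        (simp add: S_def blinfun.bilinear_simps proj_Ric Ric_proj)
    fix x a b
    have "\<tau> x a \<bullet> \<Theta> x b = \<tau> (p x) (p a) \<bullet> \<Theta> (p x) (p b)"
      using inner_p[OF \<tau>_in, of x a "\<Theta> x b"] by (simp add: proj_\<Theta> \<tau>_p[of x a])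
    moreover have "\<Theta> x a \<bullet> \<tau> x b = \<Theta> (p x) (p a) \<bullet> \<tau> (p x) (p b)"
      using inner_p[OF \<tau>_in, of x b "\<Theta> x a"] by (simp add: proj_\<Theta> \<tau>_p[of x b] inner_commute)
    ultimately have "\<tau> x a \<bullet> \<Theta> x b + \<Theta> x a \<bullet> \<tau> x b =
        Ric \<mu> (\<Theta> (p x) (p a)) \<bullet> \<Theta> (p x) (p b) - c * (\<Theta> (p x) (p a) \<bullet> \<Theta> (p x) (p b))"
      using eqL[OF p_in p_in p_in, of x a b] by simp
    also have "\<dots> = S (\<Theta> x a) \<bullet> \<Theta> x b"
    proof -
      have "S (\<Theta> x a) = Ric \<mu> (\<Theta> (p x) (p a)) - c *\<^sub>R \<Theta> (p x) (p a)"
        by (simp add: S_def blinfun.bilinear_simps proj_\<Theta> flip: Ric_proj[of "\<Theta> x a"])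
      moreover have "Ric \<mu> (\<Theta> (p x) (p a)) - c *\<^sub>R \<Theta> (p x) (p a) \<in> W"
        using proj_in[OF W, of "Ric \<mu> (\<Theta> (p x) (p a))"]
        by (intro subspace_diff subspace_scale W \<Theta>_in p_in) (simp add: proj_Ric)
      ultimately show ?thesis
        using inner_p[of "S (\<Theta> x a)" "\<Theta> x b"] by (simp add: proj_\<Theta> inner_diff_left)
    qed
    finally show "(dir_deriv y x a + \<mu> (\<Theta> x a) (y x)) \<bullet> \<Theta> x b
        + \<Theta> x a \<bullet> (dir_deriv y x b + \<mu> (\<Theta> x b) (y x)) = S (\<Theta> x a) \<bullet> \<Theta> x b"
      by (simp add: \<tau>_def)
  qed
  have "derivation \<mu> S" by (rule M.derivation_S)
  \<comment> \<open>All brackets lie in \<open>W\<close> and its complement is central. Subtracting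
    a multiple of this derivation restores the identity in
    \<open>Ric \<mu> - c *\<^sub>R id_blinfun\<close>.\<close>
  moreover have "derivation \<mu> (id_blinfun - proj W)"
  proof -
    have "proj W (\<mu> u v) = \<mu> u v" for u v
      using model_bracket_in[OF nilp model] by (simp add: proj_id[OF W] flip: W_def)
    moreover have "\<mu> (u - proj W u) = 0" "\<mu> v (u - proj W u) = 0" for u v
      using model_support[OF nilp model] model_support_right[OF nilp model] proj_orthogonal[OF W]
      unfolding W_def by blast+
    ultimately show ?thesis by (simp add: derivation_def blinfun.diff_left)
  qed
  ultimately have "act (S - c *\<^sub>R (id_blinfun - proj W)) \<mu> = 0"
    by (simp add: act_linear derivation_iff_act)
  moreover have "S - c *\<^sub>R (id_blinfun - proj W) = Ric \<mu> - c *\<^sub>R id_blinfun"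
    by (simp add: S_def scaleR_diff_right)
  ultimately have "derivation \<mu> (Ric \<mu> - c *\<^sub>R id_blinfun)" by (simp add: derivation_iff_act)
  then show ?thesis by (rule soliton_model_normalize[OF nilp model])
qed

end

section \<open>The centroid of a soliton\<close>

text \<open>For a skew bracket, the operators commuting with every \<open>ad x\<close>.\<close>

definition centroid :: "'b::euclidean_space bracket \<Rightarrow> ('b \<Rightarrow>\<^sub>L 'b) \<Rightarrow> bool" where
  "centroid \<mu> A \<longleftrightarrow> (\<forall>x y. A (\<mu> x y) = \<mu> (A x) y)"

lemma centroid_left: "centroid \<mu> A \<Longrightarrow> A (\<mu> x y) = \<mu> (A x) y"
  by (simp add: centroid_def)

lemma centroid_right:
  assumes "skew \<mu>" "centroid \<mu> A" shows "A (\<mu> x y) = \<mu> x (A y)"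
proof -
  have "A (\<mu> x y) = - A (\<mu> y x)" by (subst skewD[OF assms(1)]) (rule blinfun.minus_right)
  also have "\<dots> = - \<mu> (A y) x" by (simp only: centroid_left[OF assms(2)])
  also have "\<dots> = \<mu> x (A y)" using skewD[OF assms(1), of x "A y"] by simp
  finally show ?thesis .
qed

lemma sum_inner_swap:
  fixes \<mu> \<nu> :: "'b::euclidean_space bracket" and E F G :: "'b \<Rightarrow>\<^sub>L 'b"
  shows "(\<Sum>i\<in>Basis. \<Sum>j\<in>Basis. \<mu> (E i) (G j) \<bullet> \<nu> i (F j)) =
    (\<Sum>i\<in>Basis. \<Sum>j\<in>Basis. \<mu> i (G j) \<bullet> \<nu> (adj E i) (F j))"
  by (subst (1 2) sum.swap) (simp add: sum_inner_adj[OF linear_bracket_left linear_bracket_left])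

lemma bracket_ext_Basis:
  fixes f h :: "'b::euclidean_space \<Rightarrow> 'b \<Rightarrow> 'b"
  assumes "bilinear f" "bilinear h" "\<And>i j. i \<in> Basis \<Longrightarrow> j \<in> Basis \<Longrightarrow> f i j = h i j"
  shows "f x y = h x y"
  using bilinear_eq[OF assms(1,2), of UNIV Basis UNIV Basis x y] assms(3) by (auto simp: span_Basis)

text \<open>For \<open>A\<close> in the centroid put \<open>a = A\<^sup>T\<mu>\<close>, \<open>b = \<mu>(A\<^sup>T\<cdot>,\<cdot>)\<close>, \<open>c = \<mu>(\<cdot>,A\<^sup>T\<cdot>)\<close>. All three mutual inner
  products equal \<open>|A\<mu>|\<^sup>2\<close>, so the moment map evaluated on \<open>[A,A\<^sup>T]\<close> is \<open>|a-b|\<^sup>2 + |b-c|\<^sup>2/2\<close>.\<close>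

lemma centroid_moment:
  fixes \<mu> :: "'b::euclidean_space bracket"
  assumes nil: "nilpotent_bracket \<mu>" and A: "centroid \<mu> A"
  shows "4 * tr (Ric \<mu> o\<^sub>L ((A o\<^sub>L adj A) - (adj A o\<^sub>L A))) =
     (\<Sum>i\<in>Basis. \<Sum>j\<in>Basis. (norm (adj A (\<mu> i j) - \<mu> (adj A i) j))\<^sup>2)
     + (\<Sum>i\<in>Basis. \<Sum>j\<in>Basis. (norm (\<mu> (adj A i) j - \<mu> i (adj A j)))\<^sup>2) / 2"
proof -
  note sk = nil_skew[OF nil]
  let ?S = "\<lambda>f. \<Sum>i\<in>Basis. \<Sum>j\<in>Basis. (f (i::'b) (j::'b) :: real)"
  define s where "s = ?S (\<lambda>i j. A (\<mu> i j) \<bullet> A (\<mu> i j))"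
  define a where "a = ?S (\<lambda>i j. adj A (\<mu> i j) \<bullet> adj A (\<mu> i j))"
  define b where "b = ?S (\<lambda>i j. \<mu> (adj A i) j \<bullet> \<mu> (adj A i) j)"
  have half: "?S (\<lambda>i j. \<mu> i (B j) \<bullet> \<mu> i j) = ?S (\<lambda>i j. \<mu> (B i) j \<bullet> \<mu> i j)" for B :: "'b \<Rightarrow>\<^sub>L 'b"
  proof -
    have "\<mu> i (B j) \<bullet> \<mu> i j = \<mu> (B j) i \<bullet> \<mu> j i" for i j
      using skewD[OF sk, of i "B j"] skewD[OF sk, of i j] by simp
    then show ?thesis by (subst sum.swap) simp
  qed
  have act: "ip (act B \<mu>) \<mu> = ?S (\<lambda>i j. B (\<mu> i j) \<bullet> \<mu> i j) - 2 * ?S (\<lambda>i j. \<mu> (B i) j \<bullet> \<mu> i j)" for B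
    by (simp add: ip_def act_apply inner_diff_left sum_subtractf half)
  have a1: "?S (\<lambda>i j. (A o\<^sub>L adj A) (\<mu> i j) \<bullet> \<mu> i j) = a"
    unfolding a_def by (simp add: adj_right[where A=A, symmetric])
  have a2: "?S (\<lambda>i j. (adj A o\<^sub>L A) (\<mu> i j) \<bullet> \<mu> i j) = s"
    unfolding s_def by (simp add: adj_left)
  have r1: "?S (\<lambda>i j. \<mu> ((A o\<^sub>L adj A) i) j \<bullet> \<mu> i j) = s"
    using sum_inner_swap[of "\<mu> o\<^sub>L A" "adj A" id_blinfun \<mu> id_blinfun]
    by (simp add: s_def centroid_left[OF A])
  have r2: "?S (\<lambda>i j. \<mu> ((adj A o\<^sub>L A) i) j \<bullet> \<mu> i j) = b"
    using sum_inner_swap[of "\<mu> o\<^sub>L adj A" A id_blinfun \<mu> id_blinfun] by (simp add: b_def)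
  have moment: "4 * tr (Ric \<mu> o\<^sub>L ((A o\<^sub>L adj A) - (adj A o\<^sub>L A))) = a + 2 * b - 3 * s"
    by (simp add: blinfun_compose_simps tr_linear tr_Ric[OF sk] act[of "A o\<^sub>L adj A"] act[of "adj A o\<^sub>L A"] a1 a2 r1 r2
        del: blinfun_apply_blinfun_compose) (simp add: field_simps)
  have ab: "?S (\<lambda>i j. adj A (\<mu> i j) \<bullet> \<mu> (adj A i) j) = s"
  proof -
    have "adj A (\<mu> i j) \<bullet> \<mu> (adj A i) j = \<mu> ((A o\<^sub>L adj A) i) j \<bullet> \<mu> i j" for i j
      by (simp add: adj_left centroid_left[OF A] inner_commute)
    then show ?thesis using r1 by (simp del: blinfun_apply_blinfun_compose)
  qed
  have bc: "?S (\<lambda>i j. \<mu> (adj A i) j \<bullet> \<mu> i (adj A j)) = s"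
  proof -
    have "?S (\<lambda>i j. \<mu> (adj A i) j \<bullet> \<mu> i (adj A j)) = ?S (\<lambda>i j. \<mu> i j \<bullet> \<mu> (A i) (adj A j))"
      using sum_inner_swap[of \<mu> "adj A" id_blinfun \<mu> "adj A"] by simp
    also have "\<dots> = ?S (\<lambda>i j. \<mu> i (A j) \<bullet> \<mu> (A i) j)"
      by (simp add: sum_inner_adj[OF linear_blinfun linear_blinfun])
    also have "\<dots> = s"
      by (simp add: s_def centroid_left[OF A, symmetric] centroid_right[OF sk A, symmetric])
    finally show ?thesis .
  qed
  have cc: "?S (\<lambda>i j. \<mu> i (adj A j) \<bullet> \<mu> i (adj A j)) = b"
  proof -
    have "\<mu> i (adj A j) \<bullet> \<mu> i (adj A j) = \<mu> (adj A j) i \<bullet> \<mu> (adj A j) i" for i j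
      using skewD[OF sk, of i "adj A j"] by simp
    then show ?thesis unfolding b_def by (subst sum.swap) simp
  qed
  have "?S (\<lambda>i j. (norm (adj A (\<mu> i j) - \<mu> (adj A i) j))\<^sup>2) = a - 2 * s + b"
    unfolding ab[symmetric] a_def b_def
    by (simp add: power2_norm_eq_inner inner_diff_left inner_diff_right inner_commute sum.distrib sum_subtractf
        sum_distrib_left algebra_simps)
  moreover have "?S (\<lambda>i j. (norm (\<mu> (adj A i) j - \<mu> i (adj A j)))\<^sup>2) = b - 2 * s + b"
    unfolding bc[symmetric] by (subst (2) cc[symmetric]) (simp add: b_def power2_norm_eq_inner inner_diff_left
        inner_diff_right inner_commute sum.distrib sum_subtractf sum_distrib_left algebra_simps)
  ultimately show ?thesis using moment by (simp add: field_simps)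
qed

lemma centroid_ext_Basis:
  fixes \<mu> :: "'b::euclidean_space bracket" and A :: "'b \<Rightarrow>\<^sub>L 'b"
  assumes "\<And>i j. i \<in> Basis \<Longrightarrow> j \<in> Basis \<Longrightarrow> A (\<mu> i j) = \<mu> (A i) j"
  shows "centroid \<mu> A"
  unfolding centroid_def
proof (intro allI)
  fix x y
  show "A (\<mu> x y) = \<mu> (A x) y"
  proof (rule bracket_ext_Basis[where f="\<lambda>x y. A (\<mu> x y)" and h="\<lambda>x y. \<mu> (A x) y"])
    show "bilinear (\<lambda>x y. A (\<mu> x y))" "bilinear (\<lambda>x y. \<mu> (A x) y)"
      by (simp_all add: bilinear_def linear_iff blinfun.bilinear_simps)
  qed (rule assms)
qed

section \<open>Grading by the eigenvalues of the soliton derivation\<close>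

definition eigenproj :: "('b::euclidean_space \<Rightarrow> real) \<Rightarrow> 'b set \<Rightarrow> real \<Rightarrow> 'b \<Rightarrow> 'b" where
  "eigenproj ev E l z = (\<Sum>e\<in>E. if ev e = l then (z \<bullet> e) *\<^sub>R e else 0)"

lemma linear_eigenproj: "linear (eigenproj ev E l)"
  unfolding eigenproj_def
  by (intro linear_compose_sum ballI) (auto intro!: linearI simp: inner_left_distrib scaleR_left_distrib)

text \<open>The component of \<open>A\<close> of degree \<open>d\<close> for the grading of \<open>gl\<close> by \<open>ad D\<close>, where \<open>D\<close> has the
  eigenbasis \<open>E\<close> with eigenvalues \<open>ev\<close>.\<close>

definition graded_part :: "('b::euclidean_space \<Rightarrow> real) \<Rightarrow> 'b set \<Rightarrow> real \<Rightarrow> ('b \<Rightarrow>\<^sub>L 'b) \<Rightarrow> 'b \<Rightarrow>\<^sub>L 'b" where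
  "graded_part ev E d A = Blinfun (\<lambda>x. \<Sum>e\<in>E. (x \<bullet> e) *\<^sub>R eigenproj ev E (ev e + d) (A e))"

locale graded_soliton =
  fixes \<mu> :: "'b::euclidean_space bracket" and D :: "'b \<Rightarrow>\<^sub>L 'b" and E :: "'b set"
  assumes nil: "nilpotent_bracket \<mu>" and D_def: "D = Ric \<mu> + id_blinfun" and deriv: "derivation \<mu> D"
    and E: "orthonormal_eigenbasis D E"
begin

definition ev :: "'b \<Rightarrow> real" where "ev e = D e \<bullet> e"
abbreviation pr :: "real \<Rightarrow> 'b \<Rightarrow> 'b" where "pr \<equiv> eigenproj ev E"
abbreviation part :: "real \<Rightarrow> ('b \<Rightarrow>\<^sub>L 'b) \<Rightarrow> 'b \<Rightarrow>\<^sub>L 'b" where "part \<equiv> graded_part ev E"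

lemma D_self_adjoint: "D x \<bullet> y = x \<bullet> D y"
  by (simp add: D_def blinfun.add_left inner_left_distrib inner_right_distrib Ric_self_adjoint)

lemma finite_E: "finite E" and eig: "e \<in> E \<Longrightarrow> D e = ev e *\<^sub>R e" and norm_E: "e \<in> E \<Longrightarrow> norm e = 1"
  using E unfolding orthonormal_eigenbasis_def ev_def by blast+

lemma D_inner_E: "e \<in> E \<Longrightarrow> D x \<bullet> e = ev e * (x \<bullet> e)"
  unfolding D_self_adjoint by (simp add: eig)

lemmas inner_E = orthonormal_eigenbasis_inner[OF E]
lemmas expand_E = orthonormal_eigenbasis_expand[OF E]

lemma eqI_E: "(\<And>e. e \<in> E \<Longrightarrow> x \<bullet> e = y \<bullet> e) \<Longrightarrow> x = y"
  by (subst (1 2) expand_E[symmetric]) simp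

lemma pr_inner: "e \<in> E \<Longrightarrow> pr l z \<bullet> e = (if ev e = l then z \<bullet> e else 0)"
proof -
  assume e: "e \<in> E"
  have "pr l z \<bullet> e = (\<Sum>f\<in>E. if f = e then (if ev e = l then z \<bullet> e else 0) else 0)"
    unfolding eigenproj_def inner_sum_left by (rule sum.cong) (use inner_E e in auto)
  then show ?thesis using finite_E e by simp
qed

lemma eigenvector_inner: "D z = l *\<^sub>R z \<Longrightarrow> e \<in> E \<Longrightarrow> ev e \<noteq> l \<Longrightarrow> z \<bullet> e = 0"
proof -
  assume z: "D z = l *\<^sub>R z" and e: "e \<in> E" "ev e \<noteq> l"
  have "l * (z \<bullet> e) = ev e * (z \<bullet> e)"
    using D_inner_E[OF e(1), of z] by (simp add: z)
  then show ?thesis using e(2) by simp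
qed

lemma pr_eigenvector: "D z = l *\<^sub>R z \<Longrightarrow> pr l' z = (if l' = l then z else 0)"
  by (rule eqI_E) (auto simp: pr_inner eigenvector_inner[of z l])

lemma D_pr: "D (pr l z) = l *\<^sub>R pr l z"
  by (rule eqI_E) (simp add: D_inner_E pr_inner)

lemma linear_pr: "linear (pr l)"
  by (rule linear_eigenproj)

lemma part_apply: "part d A x = (\<Sum>e\<in>E. (x \<bullet> e) *\<^sub>R pr (ev e + d) (A e))"
  unfolding graded_part_def
  by (subst Blinfun_linear)
    (auto intro!: linear_compose_sum linearI simp: inner_left_distrib scaleR_left_distrib)

lemma part_eigenvector:
  assumes z: "D z = l *\<^sub>R z" shows "part d A z = pr (l + d) (A z)"
proof -
  have "part d A z = (\<Sum>e\<in>E. (z \<bullet> e) *\<^sub>R pr (l + d) (A e))"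
    unfolding part_apply
  proof (rule sum.cong[OF refl])
    fix e assume e: "e \<in> E"
    show "(z \<bullet> e) *\<^sub>R pr (ev e + d) (A e) = (z \<bullet> e) *\<^sub>R pr (l + d) (A e)"
      using eigenvector_inner[OF z e] by (cases "ev e = l") auto
  qed
  also have "\<dots> = pr (l + d) (A (\<Sum>e\<in>E. (z \<bullet> e) *\<^sub>R e))"
    by (simp add: blinfun.sum_right blinfun.scaleR_right linear_sum[OF linear_pr] linear_cmul[OF linear_pr])
  finally show ?thesis by (simp only: expand_E)
qed

lemma part_inner: "e \<in> E \<Longrightarrow> f \<in> E \<Longrightarrow> part d A e \<bullet> f = (if ev f = ev e + d then A e \<bullet> f else 0)"
  using part_eigenvector[OF eig, of e d A] by (simp add: pr_inner)

lemma blinfun_eqI_E: "(\<And>e. e \<in> E \<Longrightarrow> A e = B e) \<Longrightarrow> A = B" for A B :: "'b \<Rightarrow>\<^sub>L 'c::real_normed_vector"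
proof (rule blinfun_eqI)
  fix x assume *: "\<And>e. e \<in> E \<Longrightarrow> A e = B e"
  have "A (\<Sum>e\<in>E. (x \<bullet> e) *\<^sub>R e) = B (\<Sum>e\<in>E. (x \<bullet> e) *\<^sub>R e)"
    by (simp add: blinfun.sum_right blinfun.scaleR_right *)
  then show "A x = B x" by (simp only: expand_E)
qed

lemma part_degree: "(D o\<^sub>L part d A) - (part d A o\<^sub>L D) = d *\<^sub>R part d A"
proof (rule blinfun_eqI_E)
  fix e assume e: "e \<in> E"
  have "part d A (D e) = ev e *\<^sub>R part d A e"
    by (subst eig[OF e]) (rule blinfun.scaleR_right)
  then show "((D o\<^sub>L part d A) - (part d A o\<^sub>L D)) e = (d *\<^sub>R part d A) e"
    by (simp add: blinfun.diff_left blinfun.scaleR_left part_eigenvector[OF eig[OF e]] D_pr scaleR_left_distrib)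
qed

lemma bracket_eigen: "D x = a *\<^sub>R x \<Longrightarrow> D y = b *\<^sub>R y \<Longrightarrow> D (\<mu> x y) = (a + b) *\<^sub>R \<mu> x y"
  using deriv unfolding derivation_def by (simp add: blinfun.bilinear_simps scaleR_left_distrib)

lemma pr_bracket: "D y = b *\<^sub>R y \<Longrightarrow> pr (l + b) (\<mu> x y) = \<mu> (pr l x) y"
proof -
  assume y: "D y = b *\<^sub>R y"
  have "pr (l + b) (\<mu> f y) = \<mu> (pr l f) y" if f: "f \<in> E" for f
    using pr_eigenvector[OF bracket_eigen[OF eig[OF f] y], of "l + b"] pr_eigenvector[OF eig[OF f], of l]
    by (auto simp: blinfun.bilinear_simps)
  then have "pr (l + b) (\<mu> (\<Sum>f\<in>E. (x \<bullet> f) *\<^sub>R f) y) = \<mu> (pr l (\<Sum>f\<in>E. (x \<bullet> f) *\<^sub>R f)) y"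
    by (simp add: blinfun.bilinear_simps blinfun.sum_right blinfun.sum_left linear_sum[OF linear_pr] linear_cmul[OF linear_pr])
  then show ?thesis by (simp only: expand_E)
qed

text \<open>The bracket adds eigenvalues, so the centroid equation splits into homogeneous
  components.\<close>

lemma centroid_part:
  assumes "centroid \<mu> A" shows "centroid \<mu> (part d A)"
proof -
  have eq: "part d A (\<mu> e f) = \<mu> (part d A e) f" if e: "e \<in> E" and f: "f \<in> E" for e f
  proof -
    have "part d A (\<mu> e f) = pr (ev e + ev f + d) (A (\<mu> e f))"
      by (rule part_eigenvector[OF bracket_eigen[OF eig[OF e] eig[OF f]]])
    also have "\<dots> = pr ((ev e + d) + ev f) (\<mu> (A e) f)" by (simp add: centroid_left[OF assms] algebra_simps)
    also have "\<dots> = \<mu> (part d A e) f" by (simp add: pr_bracket[OF eig[OF f]] part_eigenvector[OF eig[OF e]])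
    finally show ?thesis .
  qed
  have "part d A o\<^sub>L \<mu> e = \<mu> (part d A e)" if "e \<in> E" for e
    by (rule blinfun_eqI_E) (simp add: eq that)
  then have e1: "part d A (\<mu> e y) = \<mu> (part d A e) y" if "e \<in> E" for e y
    using that by (metis blinfun_apply_blinfun_compose)
  have "part d A (\<mu> (\<Sum>e\<in>E. (x \<bullet> e) *\<^sub>R e) y) = \<mu> (part d A (\<Sum>e\<in>E. (x \<bullet> e) *\<^sub>R e)) y" for x y
    by (simp add: blinfun.sum_right blinfun.sum_left blinfun.bilinear_simps e1)
  then show ?thesis unfolding centroid_def by (simp only: expand_E) simp
qed

text \<open>\<open>Ric\<close> and \<open>D\<close> differ by the identity, so for \<open>A\<close>
  of degree \<open>d\<close> the moment map at the commutator of \<open>A\<close> and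
  \<open>adj A\<close> is \<open>d\<close> times the squared norm of \<open>A\<close>, while
  \<open>centroid_moment\<close> makes it a sum of squares. In degree 0 the squares vanish, the
  first being the centroid equation for \<open>adj A\<close>.\<close>

lemma centroid_degree:
  assumes A: "centroid \<mu> A" and d: "(D o\<^sub>L A) - (A o\<^sub>L D) = d *\<^sub>R A"
  shows "d \<ge> 0 \<or> A = 0" and "d = 0 \<Longrightarrow> centroid \<mu> (adj A)"
proof -
  let ?X = "\<Sum>i\<in>Basis. \<Sum>j\<in>Basis. (norm (adj A (\<mu> i j) - \<mu> (adj A i) j))\<^sup>2"
  let ?Y = "\<Sum>i\<in>Basis. \<Sum>j\<in>Basis. (norm (\<mu> (adj A i) j - \<mu> i (adj A j)))\<^sup>2"
  have eq: "4 * (d * tr (adj A o\<^sub>L A)) = ?X + ?Y / 2"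
    unfolding centroid_moment[OF nil A, symmetric] tr_soliton_commutator_adj[OF nil D_def deriv] d
    by (simp add: blinfun_compose_simps tr_linear tr_compose_commute[of A])
  have X: "?X \<ge> 0" and Y: "?Y \<ge> 0" by (intro sum_nonneg; simp)+
  then have "d * tr (adj A o\<^sub>L A) \<ge> 0" using eq by linarith
  then show "d \<ge> 0 \<or> A = 0"
    using tr_adj_compose_self_nonneg[of A] tr_adj_compose_self_eq_0[of A]
    by (metis antisym mult_less_0_iff not_le order_le_less)
  assume "d = 0"
  then have "?X = 0" using eq X Y by simp
  then have "adj A (\<mu> i j) = \<mu> (adj A i) j" if "i \<in> Basis" "j \<in> Basis" for i j
    using that by (simp add: sum_nonneg_eq_0_iff sum_nonneg)
  then show "centroid \<mu> (adj A)" by (rule centroid_ext_Basis)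
qed

lemma centroid_raises:
  assumes "centroid \<mu> A" "e \<in> E" "f \<in> E" "ev f < ev e"
  shows "A e \<bullet> f = 0"
proof -
  have "part (ev f - ev e) A = 0"
    using centroid_degree(1)[OF centroid_part[OF assms(1)] part_degree, of "ev f - ev e"] assms(4) by auto
  then show ?thesis using part_inner[OF assms(2,3), of "ev f - ev e" A] by simp
qed

lemma inner_apply_expand: "A z \<bullet> f = (\<Sum>e\<in>E. (z \<bullet> e) * (A e \<bullet> f))" for A :: "'b \<Rightarrow>\<^sub>L 'b"
proof -
  have "A z = A (\<Sum>e\<in>E. (z \<bullet> e) *\<^sub>R e)" by (simp only: expand_E)
  then show ?thesis by (simp add: blinfun.sum_right blinfun.scaleR_right inner_sum_left)
qed

text \<open>By \<open>centroid_raises\<close>, \<open>P\<close> is block triangular in the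
  eigenbasis, and passing to diagonal blocks is multiplicative on block triangular
  operators.\<close>

lemma part_0_idempotent:
  assumes P: "centroid \<mu> P" "\<And>x. P (P x) = P x"
  shows "part 0 P (part 0 P x) = part 0 P x"
proof -
  have "part 0 P o\<^sub>L part 0 P = part 0 P"
  proof (rule blinfun_eqI_E)
    fix e assume e: "e \<in> E"
    show "(part 0 P o\<^sub>L part 0 P) e = part 0 P e"
    proof (rule eqI_E)
      fix f assume f: "f \<in> E"
      have "part 0 P (part 0 P e) \<bullet> f = (\<Sum>h\<in>E. (part 0 P e \<bullet> h) * (part 0 P h \<bullet> f))"
        by (rule inner_apply_expand)
      also have "\<dots> = (if ev f = ev e then (\<Sum>h\<in>E. (P e \<bullet> h) * (P h \<bullet> f)) else 0)"
      proof (cases "ev f = ev e")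
        case True
        have "(part 0 P e \<bullet> h) * (part 0 P h \<bullet> f) = (P e \<bullet> h) * (P h \<bullet> f)" if h: "h \<in> E" for h
          using centroid_raises[OF P(1) e h] centroid_raises[OF P(1) h f] True e f h
          by (cases "ev h" "ev e" rule: linorder_cases) (auto simp: part_inner)
        then show ?thesis using True by simp
      next
        case False
        then show ?thesis using e f by (auto simp: part_inner intro!: sum.neutral)
      qed
      also have "\<dots> = part 0 P e \<bullet> f"
        using e f by (simp add: part_inner P(2) flip: inner_apply_expand)
      finally show "(part 0 P o\<^sub>L part 0 P) e \<bullet> f = part 0 P e \<bullet> f" by simp
    qed
  qed
  then show ?thesis by (metis blinfun_apply_blinfun_compose)
qed

text \<open>\<open>P\<close> and its degree \<open>0\<close> part agree on lowest components, hence each is injective on the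
  range of the other.\<close>

lemma part_0_lowest:
  assumes P: "centroid \<mu> P" and z: "z \<noteq> 0"
  obtains e where "e \<in> E" "z \<bullet> e \<noteq> 0" "P z \<bullet> e = part 0 P z \<bullet> e"
proof -
  let ?F = "{e \<in> E. z \<bullet> e \<noteq> 0}"
  have "?F \<noteq> {}" using z eqI_E[of z 0] by auto
  then obtain e where e: "e \<in> ?F" and min: "\<And>f. f \<in> ?F \<Longrightarrow> ev e \<le> ev f"
    using ex_is_arg_min_if_finite[of ?F ev] finite_E unfolding is_arg_min_linorder by auto
  have "(z \<bullet> f) * (P f \<bullet> e) = (z \<bullet> f) * (part 0 P f \<bullet> e)" if f: "f \<in> E" for f
  proof (cases "z \<bullet> f = 0")
    case False
    then have "ev e \<le> ev f" using min f by simp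
    then show ?thesis using centroid_raises[OF P f, of e] e f by (auto simp: part_inner)
  qed simp
  then have "P z \<bullet> e = part 0 P z \<bullet> e"
    unfolding inner_apply_expand[of _ z] by (rule sum.cong[OF refl])
  then show thesis using that[of e] e by blast
qed

end

section \<open>Direct summands of algebraic solitons\<close>

lemma direct_sum_projection:
  assumes "lie_algebra_on L br" and sum: "direct_sum_of_ideals L br I J"
  obtains f :: "'a::euclidean_space \<Rightarrow>\<^sub>L 'a" where "\<And>x. x \<in> L \<Longrightarrow> f x \<in> I" "\<And>x. x \<in> L \<Longrightarrow> x - f x \<in> J"
    "\<And>x. x \<in> I \<Longrightarrow> f x = x" "\<And>x. x \<in> J \<Longrightarrow> f x = 0"
proof -
  have L: "subspace L" using assms(1) by (simp add: lie_algebra_on_def)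
  have I: "subspace I" "I \<subseteq> L" and J: "subspace J" "J \<subseteq> L" and IJ: "I \<inter> J = {0}"
    and LIJ: "L = {x + y | x y. x \<in> I \<and> y \<in> J}"
    using sum unfolding direct_sum_of_ideals_def lie_ideal_def by blast+
  define h where "h x = (SOME y. y \<in> I \<and> x - y \<in> J)" for x
  have h: "h x \<in> I \<and> x - h x \<in> J" if "x \<in> L" for x
    unfolding h_def by (rule someI_ex) (use that LIJ in force)
  have uniq: "h x = y" if "x \<in> L" "y \<in> I" "x - y \<in> J" for x y
  proof -
    have "h x - y \<in> I" using h[OF that(1)] that I by (intro subspace_diff) auto
    moreover have "(x - y) - (x - h x) \<in> J" using h[OF that(1)] that J by (intro subspace_diff[of J "x - y" "x - h x"]) auto
    ultimately have "h x - y \<in> I \<inter> J" by simp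
    then show ?thesis using IJ by simp
  qed
  have "linear (\<lambda>x. h (proj L x))"
  proof (rule linearI)
    fix x y
    have "proj L x + proj L y - (h (proj L x) + h (proj L y)) \<in> J"
      using subspace_add[OF J(1), of "proj L x - h (proj L x)" "proj L y - h (proj L y)"] h[OF proj_in[OF L]]
      by (simp add: algebra_simps)
    then show "h (proj L (x + y)) = h (proj L x) + h (proj L y)"
      using h[OF proj_in[OF L]] proj_in[OF L] L I by (intro uniq) (auto simp: blinfun.add_right intro: subspace_add)
  next
    fix r x
    have "r *\<^sub>R proj L x - r *\<^sub>R h (proj L x) \<in> J"
      using subspace_scale[OF J(1), of "proj L x - h (proj L x)" r] h[OF proj_in[OF L]]
      by (simp add: scaleR_diff_right)
    then show "h (proj L (r *\<^sub>R x)) = r *\<^sub>R h (proj L x)"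
      using h[OF proj_in[OF L]] proj_in[OF L] L I by (intro uniq) (auto simp: blinfun.scaleR_right intro: subspace_scale)
  qed
  then have f: "Blinfun (\<lambda>x. h (proj L x)) x = h x" if "x \<in> L" for x
    using that by (simp add: Blinfun_linear proj_id[OF L])
  show thesis
  proof (rule that[of "Blinfun (\<lambda>x. h (proj L x))"])
    show "Blinfun (\<lambda>x. h (proj L x)) x = x" if "x \<in> I" for x
      using that I J f uniq[of x x] subspace_0[OF J(1)] by auto
    show "Blinfun (\<lambda>x. h (proj L x)) x = 0" if "x \<in> J" for x
      using that I J f uniq[of x 0] subspace_0[OF I(1)] by auto
  qed (use f h in auto)
qed

lemma model_inverse:
  fixes \<psi> :: "'a::euclidean_space \<Rightarrow>\<^sub>L 'b::euclidean_space"
  assumes "subspace L" "inj_on \<psi> L"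
  obtains \<kappa> :: "'b \<Rightarrow>\<^sub>L 'a" where "\<And>z. \<kappa> z \<in> L" "\<And>x. x \<in> L \<Longrightarrow> \<kappa> (\<psi> x) = x"
    "\<And>w. w \<in> \<psi> ` L \<Longrightarrow> \<psi> (\<kappa> w) = w"
proof -
  obtain k where k: "k ` UNIV \<subseteq> L" "linear k" "\<And>v. v \<in> L \<Longrightarrow> k (\<psi> v) = v"
    using linear_exists_left_inverse_on[OF linear_blinfun assms] by blast
  show thesis
    by (rule that[of "Blinfun k"]) (use k in \<open>auto simp: Blinfun_linear\<close>)
qed

lemma ideal_bracket:
  assumes "lie_algebra_on L br" "lie_ideal L br I" "x \<in> L" "y \<in> I"
  shows "br x y \<in> I" "br y x \<in> I"
proof -
  show 1: "br x y \<in> I" using assms unfolding lie_ideal_def by blast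
  have "y \<in> L" "subspace I" using assms unfolding lie_ideal_def by blast+
  then have "br y x = - br x y" "- br x y \<in> I"
    using lie_algebra_on_skew[OF assms(1) _ assms(3)] 1 subspace_neg by blast+
  then show "br y x \<in> I" by simp
qed

theorem soliton_model_summand:
  fixes \<psi> :: "'a::euclidean_space \<Rightarrow>\<^sub>L 'b::euclidean_space"
  assumes nilp: "nilpotent_lie_algebra_on L br" and model: "soliton_model L br \<psi> \<mu>"
    and sum: "direct_sum_of_ideals L br I J"
  shows "\<exists>(\<psi>' :: 'a \<Rightarrow>\<^sub>L 'b) \<mu>'. soliton_model I br \<psi>' \<mu>'"
proof -
  have bm: "bracket_model L br \<psi> \<mu>" and der: "derivation \<mu> (Ric \<mu> + id_blinfun)"
    using model by (simp_all add: soliton_model_def)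
  note nil = model_nilpotent[OF nilp bm] and lie = model_lie[OF nilp bm] and L = model_subspace[OF nilp bm]
  note sk = nil_skew[OF nil]
  have I: "subspace I" "I \<subseteq> L" "lie_ideal L br I" and J: "subspace J" "J \<subseteq> L" "lie_ideal L br J" and IJ: "I \<inter> J = {0}"
    using sum unfolding direct_sum_of_ideals_def lie_ideal_def by blast+
  define D where "D = Ric \<mu> + id_blinfun"
  obtain E where "orthonormal_eigenbasis D E"
    using exists_orthonormal_eigenbasis[of D]
    by (auto simp: D_def blinfun.add_left inner_left_distrib inner_right_distrib Ric_self_adjoint)
  then interpret graded_soliton \<mu> D E
    using nil der by unfold_locales (simp_all add: D_def)
  let ?W = "\<psi> ` L"
  note W = model_image_subspace[OF nilp bm]
  obtain f :: "'a \<Rightarrow>\<^sub>L 'a" where f: "\<And>x. x \<in> L \<Longrightarrow> f x \<in> I" "\<And>x. x \<in> L \<Longrightarrow> x - f x \<in> J"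
    "\<And>x. x \<in> I \<Longrightarrow> f x = x" "\<And>x. x \<in> J \<Longrightarrow> f x = 0"
    using direct_sum_projection[OF lie sum] by blast
  obtain \<kappa> :: "'b \<Rightarrow>\<^sub>L 'a" where \<kappa>: "\<And>z. \<kappa> z \<in> L" "\<And>x. x \<in> L \<Longrightarrow> \<kappa> (\<psi> x) = x" "\<And>w. w \<in> ?W \<Longrightarrow> \<psi> (\<kappa> w) = w"
    using model_inverse[OF L model_inj[OF nilp bm]] by blast
  define P where "P = \<psi> o\<^sub>L (f o\<^sub>L (\<kappa> o\<^sub>L proj ?W))"
  have P\<psi>: "P (\<psi> x) = \<psi> (f x)" if "x \<in> L" for x
    using that by (simp add: P_def proj_id[OF W] \<kappa>)
  have Pproj: "P u = P (proj ?W u)" for u by (simp add: P_def proj_idem[OF W])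
  have P_idem: "P (P u) = P u" for u
    using \<kappa>(1) f(1,3) I(2) by (simp add: P_def proj_id[OF W] \<kappa>(2) subset_eq)
  have f_br: "f (br x y) = br (f x) y" if x: "x \<in> L" and y: "y \<in> L" for x y
  proof -
    have fx: "f x \<in> L" "x - f x \<in> L" using f x I J by auto
    have "br (1 *\<^sub>R f x + 1 *\<^sub>R (x - f x)) y = 1 *\<^sub>R br (f x) y + 1 *\<^sub>R br (x - f x) y"
      using lie fx y unfolding lie_algebra_on_def by blast
    then have "br x y = br (f x) y + br (x - f x) y" by simp
    moreover have "br (f x) y \<in> I" "br (x - f x) y \<in> J"
      using ideal_bracket(2)[OF lie I(3) y] ideal_bracket(2)[OF lie J(3) y] f x by blast+
    ultimately show ?thesis using f by (simp add: blinfun.add_right)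
  qed
  have centroid_P: "centroid \<mu> P"
    unfolding centroid_def
  proof (intro allI)
    fix u v
    obtain x y where x: "x \<in> L" "proj ?W u = \<psi> x" and y: "y \<in> L" "proj ?W v = \<psi> y"
      using proj_in[OF W] by (metis (no_types, lifting) imageE)
    have "\<mu> u v = \<psi> (br x y)"
      using model_proj[OF nilp bm, of u v] model_hom[OF nilp bm x(1) y(1)] by (simp add: x y)
    then have "P (\<mu> u v) = \<psi> (br (f x) y)"
      using P\<psi>[OF model_br_in[OF nilp bm x(1) y(1)]] f_br[OF x(1) y(1)] by simp
    also have "\<dots> = \<mu> (\<psi> (f x)) (\<psi> y)" using f(1)[OF x(1)] I y by (intro model_hom[OF nilp bm]) auto
    also have "\<dots> = \<mu> (P u) v"
    proof -
      have "P u = \<psi> (f x)" by (subst Pproj) (simp add: x P\<psi>)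
      then have "proj ?W (P u) = P u" using f(1)[OF x(1)] I by (intro proj_id[OF W]) auto
      then show ?thesis using model_proj[OF nilp bm, of "P u" v] \<open>P u = \<psi> (f x)\<close> by (simp add: y)
    qed
    finally show "P (\<mu> u v) = \<mu> (P u) v" .
  qed
  \<comment> \<open>\<open>P\<close> need not commute with \<open>D\<close>, but its degree 0 part
    does; only in degree 0 does \<open>centroid_degree\<close> put the transpose into the
    centroid.\<close>
  define P0 where "P0 = part 0 P"
  have P0_idem: "P0 (P0 u) = P0 u" for u
    unfolding P0_def by (rule part_0_idempotent[OF centroid_P P_idem])
  have cP0: "centroid \<mu> P0" unfolding P0_def by (rule centroid_part[OF centroid_P])
  have DP0: "D (P0 u) = P0 (D u)" for u
  proof -
    have "((D o\<^sub>L P0) - (P0 o\<^sub>L D)) u = 0" unfolding P0_def part_degree by simp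
    then show ?thesis by (simp add: blinfun.diff_left)
  qed
  have cadj: "centroid \<mu> (adj P0)"
    using centroid_degree(2)[OF cP0, of 0] part_degree[of 0 P] by (simp add: P0_def)
  define R where "R = range P0"
  define Q where "Q = proj R"
  have R: "subspace R" unfolding R_def by (rule linear_subspace_image[OF linear_blinfun subspace_UNIV])
  have QR: "Q u \<in> R" for u unfolding Q_def by (rule proj_in[OF R])
  have Q_id: "Q u = u" if "u \<in> R" for u unfolding Q_def by (rule proj_id[OF R that])
  have R_I: "u \<in> R" if "P0 u = u" for u unfolding R_def using that by (metis rangeI)
  have P0R: "P0 u = u" if "u \<in> R" for u using that P0_idem by (auto simp: R_def)
  have perp: "(\<forall>r\<in>R. z \<bullet> r = 0) \<longleftrightarrow> adj P0 z = 0" for z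
    by (auto simp: R_def simp flip: adj_left)
  \<comment> \<open>The range of \<open>P0\<close> and the kernel of \<open>adj P0\<close> are
    orthogonal complements, and both are ideals because \<open>P0\<close> and \<open>adj P0\<close>
    lie in the centroid.\<close>
  have cQ: "Q (\<mu> u v) = \<mu> (Q u) v" for u v
    unfolding Q_def
  proof (rule proj_eqI[OF R])
    have "P0 (\<mu> (Q u) v) = \<mu> (Q u) v" by (simp add: centroid_left[OF cP0] P0R QR)
    then show "\<mu> (proj R u) v \<in> R" unfolding Q_def[symmetric] by (rule R_I)
    have "adj P0 (u - Q u) = 0"
      unfolding perp[symmetric] Q_def by (intro ballI proj_orthogonal[OF R])
    then have "adj P0 (\<mu> u v - \<mu> (Q u) v) = 0"
      by (simp add: centroid_left[OF cadj] blinfun.zero_left blinfun.zero_right flip: blinfun.diff_left blinfun.diff_right)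
    then show "(\<mu> u v - \<mu> (proj R u) v) \<bullet> z = 0" if "z \<in> R" for z
      using that unfolding perp[symmetric] Q_def by blast
  qed
  have DQ: "Q (D u) = D (Q u)" for u
    unfolding Q_def
  proof (rule proj_eqI[OF R])
    have "P0 (D (Q u)) = D (Q u)" by (simp add: DP0[symmetric] P0R QR)
    then show "D (proj R u) \<in> R" unfolding Q_def[symmetric] by (rule R_I)
    fix z assume z: "z \<in> R"
    have "P0 (D z) = D z" by (simp add: DP0[symmetric] P0R[OF z])
    then have "D z \<in> R" by (rule R_I)
    then show "(D u - D (proj R u)) \<bullet> z = 0"
      using proj_orthogonal[OF R, of "D z" u] by (simp add: D_self_adjoint flip: blinfun.diff_right)
  qed
  have RicQ: "Q (Ric \<mu> u) = Ric \<mu> (Q u)" for u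
    using DQ[of u] by (simp add: D_def blinfun.bilinear_simps)
  have cQ2: "Q (\<mu> u v) = \<mu> u (Q v)" for u v
    using centroid_right[OF sk, of Q u v] cQ by (simp add: centroid_def)
  have QQ: "Q (Q u) = Q u" for u by (simp add: Q_id QR)
  \<comment> \<open>The bracket of the ideal \<open>R\<close>, extended by zero: since
    \<open>Q\<close> is in the centroid, projecting the output amounts to projecting either
    input.\<close>
  define \<mu>' where "\<mu>' = bracket_of (\<lambda>u v. Q (\<mu> u v))"
  have \<mu>': "\<mu>' u v = Q (\<mu> u v)" for u v
    unfolding \<mu>'_def by (rule bracket_of_apply; intro linearI; simp add: blinfun.bilinear_simps)
  have Ric': "Ric \<mu>' u = Q (Ric \<mu> u)" for u
  proof (rule vector_eq_rdot[THEN iffD1, rule_format])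
    fix v
    have "\<mu>' i = Q o\<^sub>L \<mu> i" for i by (rule blinfun_eqI) (simp add: \<mu>')
    then have a: "adj (\<mu>' i) w = adj (\<mu> i) (Q w)" for i w by (simp add: adj_compose Q_def adj_proj[OF R])
    have "Ric \<mu>' u \<bullet> v = Ric \<mu> (Q u) \<bullet> Q v"
      unfolding Ric_inner a \<mu>' cQ2 ..
    also have "\<dots> = Q (Ric \<mu> (Q u)) \<bullet> v" by (simp add: Q_def proj_inner[OF R])
    finally show "Ric \<mu>' u \<bullet> v = Q (Ric \<mu> u) \<bullet> v" by (simp add: RicQ QQ)
  qed
  have "derivation \<mu>' (Ric \<mu>' + id_blinfun)"
    unfolding derivation_def
  proof (intro allI)
    fix u v
    have "(Ric \<mu>' + id_blinfun) (\<mu>' u v) = Q (D (\<mu> u v))"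
      by (simp add: blinfun.add_left Ric' \<mu>' D_def RicQ QQ blinfun.add_right)
    also have "\<dots> = Q (\<mu> (D u) v) + Q (\<mu> u (D v))"
      using deriv unfolding derivation_def by (simp add: blinfun.add_right)
    also have "Q (\<mu> (D u) v) = \<mu>' ((Ric \<mu>' + id_blinfun) u) v"
    proof -
      have "Q (\<mu> (Q (Ric \<mu> u)) v) = Q (\<mu> (Ric \<mu> u) v)" by (simp only: cQ[symmetric] QQ)
      then show ?thesis by (simp add: \<mu>' Ric' D_def blinfun.bilinear_simps)
    qed
    also have "Q (\<mu> u (D v)) = \<mu>' u ((Ric \<mu>' + id_blinfun) v)"
    proof -
      have "Q (\<mu> u (Q (Ric \<mu> v))) = Q (\<mu> u (Ric \<mu> v))" by (simp only: cQ2[symmetric] QQ)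
      then show ?thesis by (simp add: \<mu>' Ric' D_def blinfun.bilinear_simps)
    qed
    finally show "(Ric \<mu>' + id_blinfun) (\<mu>' u v) =
        \<mu>' ((Ric \<mu>' + id_blinfun) u) v + \<mu>' u ((Ric \<mu>' + id_blinfun) v)" .
  qed
  moreover have "bracket_model I br (P0 o\<^sub>L \<psi>) \<mu>'"
  proof -
    \<comment> \<open>\<open>P\<close> and \<open>P0\<close> agree at a lowest nonzero coefficient
      of \<open>z\<close>, so no nonzero vector is fixed by one and killed by the other.\<close>
    have zero: "z = 0" if "P z = z \<and> P0 z = 0 \<or> P0 z = z \<and> P z = 0" for z
    proof (rule ccontr)
      assume "z \<noteq> 0"
      from part_0_lowest[OF centroid_P this] obtain e where "z \<bullet> e \<noteq> 0" "P z \<bullet> e = P0 z \<bullet> e"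
        unfolding P0_def by blast
      then show False using that by auto
    qed
    have inj1: "inj_on P0 (range P)"
    proof (rule inj_onI)
      fix x y assume "x \<in> range P" "y \<in> range P" "P0 x = P0 y"
      then have "P (x - y) = x - y" "P0 (x - y) = 0" using P_idem by (auto simp: blinfun.diff_right)
      then show "x = y" using zero[of "x - y"] by simp
    qed
    have inj2: "inj_on P R"
    proof (rule inj_onI)
      fix x y assume "x \<in> R" "y \<in> R" "P x = P y"
      then have "P0 (x - y) = x - y" "P (x - y) = 0" using P0R by (auto simp: blinfun.diff_right)
      then show "x = y" using zero[of "x - y"] by simp
    qed
    have sP: "subspace (range P)" by (rule linear_subspace_image[OF linear_blinfun subspace_UNIV])
    have dim_img: "dim (A ` S) = dim S" if "inj_on A S" "subspace S" for A :: "'b \<Rightarrow>\<^sub>L 'b" and S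
      using that by (intro dim_image_eq[OF linear_blinfun]) (simp add: span_eq_iff[THEN iffD2])
    \<comment> \<open>Injectivity of \<open>P\<close> on \<open>R\<close> bounds the dimension of
      \<open>R\<close> by the rank of \<open>P\<close>, and injectivity of \<open>P0\<close> carries
      that rank over to the image.\<close>
    have "P0 ` range P = R"
    proof (rule subspace_dim_equal)
      show "subspace (P0 ` range P)" by (rule linear_subspace_image[OF linear_blinfun sP])
      show "P0 ` range P \<subseteq> R" by (auto simp: R_def)
      have "dim R = dim (P ` R)" by (rule dim_img[OF inj2 R, symmetric])
      also have "\<dots> \<le> dim (range P)" by (rule dim_subset) auto
      also have "\<dots> = dim (P0 ` range P)" by (rule dim_img[OF inj1 sP, symmetric])
      finally show "dim R \<le> dim (P0 ` range P)" .
    qed (rule R)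
    moreover have rP: "range P = \<psi> ` I"
    proof
      show "range P \<subseteq> \<psi> ` I" using f(1) \<kappa>(1) by (auto simp: P_def)
      show "\<psi> ` I \<subseteq> range P" using P\<psi> f(3) I(2) by (metis (no_types, lifting) image_subsetI rangeI subsetD)
    qed
    ultimately have img: "P0 ` \<psi> ` I = R" by simp
    show ?thesis
      unfolding bracket_model_def
    proof (intro conjI ballI allI impI)
      show "inj_on (P0 o\<^sub>L \<psi>) I"
        using comp_inj_on[OF inj_on_subset[OF model_inj[OF nilp bm] I(2)], of P0] inj1 rP
        by (simp add: o_def blinfun_compose.rep_eq)
    next
      fix x y assume x: "x \<in> I" and y: "y \<in> I"
      have "\<psi> (br x y) = \<mu> (\<psi> x) (\<psi> y)" using x y I by (intro model_hom[OF nilp bm]) auto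
      \<comment> \<open>An idempotent in the centroid is a homomorphism: write it twice and put one
        copy into each argument.\<close>
      then have "P0 (\<psi> (br x y)) = P0 (P0 (\<mu> (\<psi> x) (\<psi> y)))" by (simp add: P0_idem)
      also have "\<dots> = \<mu> (P0 (\<psi> x)) (P0 (\<psi> y))"
        by (subst centroid_left[OF cP0]) (rule centroid_right[OF sk cP0])
      also have "\<dots> = \<mu> (Q (P0 (\<psi> x))) (P0 (\<psi> y))" by (simp add: Q_id R_def)
      finally show "(P0 o\<^sub>L \<psi>) (br x y) = \<mu>' ((P0 o\<^sub>L \<psi>) x) ((P0 o\<^sub>L \<psi>) y)"
        by (simp add: \<mu>' cQ)
    next
      fix z assume z: "\<forall>x\<in>I. z \<bullet> (P0 o\<^sub>L \<psi>) x = 0"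
      have "Q z = 0" unfolding Q_def by (rule proj_0[OF R]) (use z img in auto)
      then show "\<mu>' z = 0" by (intro blinfun_eqI) (simp add: \<mu>' cQ blinfun.bilinear_simps)
      show "\<mu>' w z = 0" for w using \<open>Q z = 0\<close> by (simp add: \<mu>' cQ2 blinfun.bilinear_simps)
    qed
  qed
  ultimately show ?thesis unfolding soliton_model_def by blast
qed

section \<open>The simply transitive group of a soliton\<close>

context graded_soliton
begin

lemma ev_pos: "e \<in> E \<Longrightarrow> ev e > 0"
  using soliton_derivation_positive[OF nil D_def deriv eig] norm_E by fastforce

lemma E_nonempty: "E \<noteq> {}"
proof
  assume "E = {}"
  then have "(UNIV :: 'b set) = {0}" using E unfolding orthonormal_eigenbasis_def by simp
  then show False using nonempty_Basis nonzero_Basis by blast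
qed

section \<open>Filtration by eigenvalues\<close>

definition gap :: real where "gap = Min (ev ` E)"

lemma gap_pos: "gap > 0" and gap_le: "e \<in> E \<Longrightarrow> gap \<le> ev e"
  using ev_pos finite_E E_nonempty by (auto simp: gap_def)

text \<open>Membership in the sum of the eigenspaces with eigenvalue at least \<open>r\<close>. A
  filtration replaces the grading because \<open>ad a\<close> is not homogeneous for general
  \<open>a\<close>.\<close>

definition low :: "real \<Rightarrow> 'b \<Rightarrow> bool" where
  "low r x \<longleftrightarrow> (\<forall>f\<in>E. ev f < r \<longrightarrow> x \<bullet> f = 0)"

definition raises :: "real \<Rightarrow> ('b \<Rightarrow>\<^sub>L 'b) \<Rightarrow> bool" where
  "raises r M \<longleftrightarrow> (\<forall>e\<in>E. low (ev e + r) (M e))"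

lemma low_subspace: "subspace {x. low r x}"
  by (auto simp: subspace_def low_def inner_left_distrib)

lemma low_add: "low r x \<Longrightarrow> low r y \<Longrightarrow> low r (x + y)"
  and low_diff: "low r x \<Longrightarrow> low r y \<Longrightarrow> low r (x - y)"
  and low_scaleR: "low r x \<Longrightarrow> low r (c *\<^sub>R x)"
  by (auto simp: low_def inner_left_distrib inner_diff_left)

lemma low_sum: "(\<And>i. i \<in> I \<Longrightarrow> low r (x i)) \<Longrightarrow> low r (\<Sum>i\<in>I. x i)"
  using subspace_sum[OF low_subspace, of I x r] by simp

lemma low_mono: "low r x \<Longrightarrow> s \<le> r \<Longrightarrow> low s x"
  by (auto simp: low_def)

lemma low_eigenvector: "D z = l *\<^sub>R z \<Longrightarrow> low l z"
  using eigenvector_inner[of z l] by (auto simp: low_def)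

lemma low_E: "e \<in> E \<Longrightarrow> low (ev e) e"
  by (rule low_eigenvector[OF eig])

lemma low_expand:
  fixes M :: "'b \<Rightarrow>\<^sub>L 'b"
  assumes "low r x" "\<And>e. e \<in> E \<Longrightarrow> r \<le> ev e \<Longrightarrow> low s (M e)"
  shows "low s (M x)"
proof -
  have "low s (\<Sum>e\<in>E. (x \<bullet> e) *\<^sub>R M e)"
  proof (rule low_sum)
    fix e assume e: "e \<in> E"
    show "low s ((x \<bullet> e) *\<^sub>R M e)"
    proof (cases "ev e < r")
      case True
      then show ?thesis using assms(1) e by (simp add: low_def)
    next
      case False
      then show ?thesis using assms(2) e by (intro low_scaleR) auto
    qed
  qed
  also have "(\<Sum>e\<in>E. (x \<bullet> e) *\<^sub>R M e) = M (\<Sum>e\<in>E. (x \<bullet> e) *\<^sub>R e)"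
    by (simp add: blinfun.sum_right blinfun.scaleR_right)
  finally show ?thesis by (simp only: expand_E)
qed

lemma raises_low: "raises r M \<Longrightarrow> low s x \<Longrightarrow> low (s + r) (M x)"
  by (erule low_expand) (auto simp: raises_def intro: low_mono)

lemma raises_compose: "raises r M \<Longrightarrow> raises s N \<Longrightarrow> raises (r + s) (M o\<^sub>L N)"
  unfolding raises_def[of _ N] raises_def[of _ "M o\<^sub>L N"]
proof
  fix e assume M: "raises r M" and N: "\<forall>e\<in>E. low (ev e + s) (N e)" and e: "e \<in> E"
  show "low (ev e + (r + s)) ((M o\<^sub>L N) e)"
    using raises_low[OF M N[rule_format, OF e]] by (simp add: ac_simps)
qed

lemma raises_id: "raises 0 id_blinfun"
  by (simp add: raises_def low_E)

lemma raises_mono: "raises r M \<Longrightarrow> s \<le> r \<Longrightarrow> raises s M"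
  unfolding raises_def by (auto intro: low_mono)

lemma raises_sum: "(\<And>i. i \<in> I \<Longrightarrow> raises r (M i)) \<Longrightarrow> raises r (\<Sum>i\<in>I. M i)"
  unfolding raises_def by (auto simp: blinfun.sum_left intro: low_sum)

lemma low_bracket: "low r x \<Longrightarrow> low s y \<Longrightarrow> low (r + s) (\<mu> x y)"
proof -
  assume x: "low r x" and y: "low s y"
  have 1: "low (r + s) (\<mu> e f)" if "e \<in> E" "f \<in> E" "r \<le> ev e" "s \<le> ev f" for e f
    using low_mono[OF low_eigenvector[OF bracket_eigen[OF eig eig]], of e f "r + s"] that by simp
  have 2: "low (r + s) (\<mu> e y)" if "e \<in> E" "r \<le> ev e" for e
    using low_expand[OF y, of "r + s" "\<mu> e"] 1 that by blast
  have "low (r + s) (- \<mu> y x)"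
  proof -
    have "low (r + s) (\<mu> y e)" if "e \<in> E" "r \<le> ev e" for e
      using low_scaleR[OF 2[OF that], of "-1"] skewD[OF nil_skew[OF nil], of y e] by simp
    then have "low (r + s) (\<mu> y x)" by (rule low_expand[OF x])
    then show ?thesis using low_scaleR[of "r + s" "\<mu> y x" "-1"] by simp
  qed
  then show ?thesis using skewD[OF nil_skew[OF nil], of x y] by simp
qed

lemma raises_ad: "raises gap (\<mu> a)"
  unfolding raises_def
proof
  fix e assume e: "e \<in> E"
  have "low gap a" using gap_le by (force simp: low_def)
  then show "low (ev e + gap) (\<mu> a e)" using low_bracket[OF _ low_E[OF e], of gap a] by (simp add: add.commute)
qed

text \<open>An equation \<open>D v - l v = [a, v]\<close> determines \<open>v\<close> from its component of degree \<open>l\<close>, because \<open>ad a\<close>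
  strictly raises degrees.\<close>

lemma low_unique:
  assumes v: "D v - l *\<^sub>R v = \<mu> a v" and low: "low (l + gap) v"
  shows "v = 0"
proof (rule ccontr)
  assume "v \<noteq> 0"
  let ?F = "{e \<in> E. v \<bullet> e \<noteq> 0}"
  have "?F \<noteq> {}" using \<open>v \<noteq> 0\<close> eqI_E[of v 0] by auto
  then obtain e where e: "e \<in> ?F" and min: "\<And>f. f \<in> ?F \<Longrightarrow> ev e \<le> ev f"
    using ex_is_arg_min_if_finite[of ?F ev] finite_E unfolding is_arg_min_linorder by auto
  have "low (ev e) v" using min by (force simp: low_def)
  then have "low (ev e + gap) (\<mu> a v)" by (rule raises_low[OF raises_ad])
  then have "\<mu> a v \<bullet> e = 0" using e gap_pos by (simp add: low_def)
  then have "(ev e - l) * (v \<bullet> e) = 0"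
    using e by (simp add: v[symmetric] inner_diff_left D_inner_E algebra_simps)
  then have "ev e = l" using e by simp
  then have "v \<bullet> e = 0" using low[unfolded low_def, rule_format, of e] e gap_pos by simp
  then show False using e by simp
qed

text \<open>Inverse of \<open>ad D\<close> on operators, entry by entry. A zero denominator gives
  the entry 0; for \<open>M\<close> raising degrees by \<open>gap\<close> the corresponding entry of
  \<open>M\<close> is zero too, so \<open>D_K\<close> holds.\<close>

definition K :: "('b \<Rightarrow>\<^sub>L 'b) \<Rightarrow> 'b \<Rightarrow>\<^sub>L 'b" where
  "K M = Blinfun (\<lambda>x. \<Sum>e\<in>E. \<Sum>f\<in>E. ((x \<bullet> e) * ((M e \<bullet> f) / (ev f - ev e))) *\<^sub>R f)"

lemma K_apply: "K M x = (\<Sum>e\<in>E. \<Sum>f\<in>E. ((x \<bullet> e) * ((M e \<bullet> f) / (ev f - ev e))) *\<^sub>R f)"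
proof -
  have "linear (\<lambda>x. \<Sum>e\<in>E. \<Sum>f\<in>E. ((x \<bullet> e) * ((M e \<bullet> f) / (ev f - ev e))) *\<^sub>R f)"
    by (intro linear_compose_sum ballI linearI)
      (simp_all add: inner_left_distrib scaleR_left_distrib[symmetric] distrib_right add_divide_distrib)
  then show ?thesis by (simp add: K_def Blinfun_linear)
qed

lemma K_inner: "e \<in> E \<Longrightarrow> f \<in> E \<Longrightarrow> K M e \<bullet> f = (M e \<bullet> f) / (ev f - ev e)"
proof -
  assume e: "e \<in> E" and f: "f \<in> E"
  have "K M e \<bullet> f = (\<Sum>e'\<in>E. if e' = e then (\<Sum>f'\<in>E. if f' = f then (M e \<bullet> f) / (ev f - ev e) else 0) else 0)"
    unfolding K_apply inner_sum_left
    by (intro sum.cong refl) (use e f inner_E in \<open>auto intro!: sum.cong sum.neutral\<close>)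
  then show ?thesis using finite_E e f by simp
qed

lemma raises_K: "raises r M \<Longrightarrow> raises r (K M)"
  by (auto simp: raises_def low_def K_inner)

lemma D_K: "raises gap M \<Longrightarrow> (D o\<^sub>L K M) - (K M o\<^sub>L D) = M"
proof (rule blinfun_eqI_E, rule eqI_E)
  fix e f assume M: "raises gap M" and e: "e \<in> E" and f: "f \<in> E"
  have "((D o\<^sub>L K M) - (K M o\<^sub>L D)) e \<bullet> f = (ev f - ev e) * (K M e \<bullet> f)"
    using D_inner_E[OF f, of "K M e"] eig[OF e]
    by (simp add: blinfun.diff_left inner_diff_left blinfun.scaleR_right left_diff_distrib)
  also have "\<dots> = M e \<bullet> f"
    using M e f gap_pos by (auto simp: K_inner raises_def low_def)
  finally show "((D o\<^sub>L K M) - (K M o\<^sub>L D)) e \<bullet> f = M e \<bullet> f" .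
qed

lemma smooth_K: "smooth_on UNIV F \<Longrightarrow> smooth_on UNIV (\<lambda>a. K (F a))"
  for F :: "'c::euclidean_space \<Rightarrow> 'b \<Rightarrow>\<^sub>L 'b"
proof (rule smooth_blinfunI)
  fix v assume F: "smooth_on UNIV F"
  show "smooth_on UNIV (\<lambda>a. K (F a) v)"
    unfolding K_apply
  proof (intro smooth_sum)
    fix e f
    have "bounded_linear (\<lambda>M. ((v \<bullet> e) * ((blinfun_apply M e \<bullet> f) / (ev f - ev e))) *\<^sub>R f)"
      by (intro bounded_linear_scaleR_const bounded_linear_const_mult bounded_linear_divide[THEN bounded_linear_compose]
          bounded_linear_inner_left[THEN bounded_linear_compose] blinfun.bounded_linear_left)
    then show "smooth_on UNIV (\<lambda>a. ((v \<bullet> e) * ((F a e \<bullet> f) / (ev f - ev e))) *\<^sub>R f)"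
      by (rule smooth_bounded_linear[OF _ F])
  qed
qed

text \<open>Successive approximation for the equation \<open>D_A\<close>, starting from the
  identity; each step applies \<open>ad a\<close> and inverts \<open>ad D\<close>.\<close>

primrec term_A :: "nat \<Rightarrow> 'b \<Rightarrow> 'b \<Rightarrow>\<^sub>L 'b" where
  "term_A 0 a = id_blinfun"
| "term_A (Suc k) a = K (\<mu> a o\<^sub>L term_A k a)"

lemma raises_term: "raises (k * gap) (term_A k a)"
proof (induction k)
  case (Suc k)
  have "gap + real k * gap = real (Suc k) * gap" by (simp add: algebra_simps)
  then show ?case using raises_K[OF raises_compose[OF raises_ad Suc.IH]] by simp
qed (simp add: raises_id)

text \<open>Chosen so that \<open>order * gap\<close> exceeds every eigenvalue, which ends the
  series; the \<open>1\<close> keeps this strict when the quotient is an integer.\<close>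

definition order :: nat where "order = nat \<lceil>Max (ev ` E) / gap\<rceil> + 1"

lemma raises_order: "raises (order * gap) M \<Longrightarrow> M = 0"
  for M :: "'b \<Rightarrow>\<^sub>L 'b"
proof (rule blinfun_eqI_E, rule eqI_E)
  fix e f assume M: "raises (order * gap) M" and e: "e \<in> E" and f: "f \<in> E"
  have "ev f \<le> Max (ev ` E)" using f finite_E by simp
  moreover have "Max (ev ` E) < order * gap"
  proof -
    have "Max (ev ` E) / gap < order" unfolding order_def by linarith
    then show ?thesis using gap_pos by (simp add: pos_divide_less_eq)
  qed
  ultimately have "ev f < ev e + order * gap" using ev_pos[OF e] by simp
  then show "M e \<bullet> f = (0 :: 'b \<Rightarrow>\<^sub>L 'b) e \<bullet> f" using M e f by (simp add: raises_def low_def)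
qed

text \<open>The unique unipotent solution of \<open>[D, A] = ad a \<circ> A\<close>; it conjugates \<open>D\<close> to \<open>D - ad a\<close>.\<close>

definition A :: "'b \<Rightarrow> 'b \<Rightarrow>\<^sub>L 'b" where "A a = (\<Sum>k\<le>order. term_A k a)"

lemma smooth_A: "smooth_on UNIV A"
proof -
  have "smooth_on UNIV (term_A k)" for k
  proof (induction k)
    case 0
    have "term_A 0 = (\<lambda>_. id_blinfun)" by (rule ext) simp
    then show ?case by (simp only: smooth_const)
  next
    case (Suc k)
    have "term_A (Suc k) = (\<lambda>a. K (\<mu> a o\<^sub>L term_A k a))" by (rule ext) simp
    moreover have "smooth_on UNIV (\<lambda>a. K (\<mu> a o\<^sub>L term_A k a))"
      by (intro smooth_K smooth_blinfun_compose Suc.IH smooth_linear blinfun.bounded_linear_right)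
    ultimately show ?case by simp
  qed
  then show ?thesis unfolding A_def[abs_def] by (intro smooth_sum)
qed

text \<open>The two sums differ by an index shift, which is harmless because
  \<open>term_A order a = 0\<close>.\<close>

lemma D_A: "D (A a x) = A a (D x) + \<mu> a (A a x)"
proof -
  have z: "term_A order a = 0" by (rule raises_order[OF raises_term])
  have comm: "(D o\<^sub>L term_A (Suc k) a) - (term_A (Suc k) a o\<^sub>L D) = \<mu> a o\<^sub>L term_A k a" for k
  proof -
    have "raises gap (\<mu> a o\<^sub>L term_A k a)"
      by (rule raises_mono[OF raises_compose[OF raises_ad raises_term]]) (use gap_pos in simp)
    then show ?thesis by (simp add: D_K)
  qed
  have "(D o\<^sub>L A a) - (A a o\<^sub>L D) = (\<Sum>k\<le>order. (D o\<^sub>L term_A k a) - (term_A k a o\<^sub>L D))"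
    unfolding A_def
    by (rule blinfun_eqI) (simp add: blinfun.sum_left blinfun.sum_right blinfun.diff_left sum_subtractf)
  also have "\<dots> = (\<Sum>k<order. \<mu> a o\<^sub>L term_A k a)"
    by (subst sum.atMost_shift) (simp add: comm del: term_A.simps(2))
  also have "\<dots> = (\<Sum>k\<le>order. \<mu> a o\<^sub>L term_A k a)"
    by (simp add: lessThan_Suc_atMost[symmetric] z)
  also have "\<dots> = \<mu> a o\<^sub>L A a"
    unfolding A_def by (rule blinfun_eqI) (simp add: blinfun.sum_left blinfun.sum_right)
  finally have "((D o\<^sub>L A a) - (A a o\<^sub>L D)) x = (\<mu> a o\<^sub>L A a) x" by simp
  then show ?thesis by (simp add: blinfun.diff_left algebra_simps)
qed

lemma raises_A: "raises gap (A a - id_blinfun)"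
proof -
  have "A a - id_blinfun = (\<Sum>k<order. term_A (Suc k) a)"
    unfolding A_def by (subst sum.atMost_shift) (simp del: term_A.simps(2))
  moreover have "raises gap (term_A (Suc k) a)" for k
    by (rule raises_mono[OF raises_term]) (use gap_pos in simp)
  ultimately show ?thesis by (simp add: raises_sum del: term_A.simps(2))
qed

lemma low_A_diff: "low r x \<Longrightarrow> low (r + gap) (A a x - x)"
  using raises_low[OF raises_A, of r x a] by (simp add: blinfun.diff_left)

lemma low_A: "low r x \<Longrightarrow> low r (A a x)"
proof -
  assume x: "low r x"
  have "low r (A a x - x)" by (rule low_mono[OF low_A_diff[OF x]]) (use gap_pos in simp)
  then show ?thesis using low_add[OF _ x, of "A a x - x"] by simp
qed

lemma A_unique:
  fixes M :: "'b \<Rightarrow>\<^sub>L 'b"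
  assumes "\<And>e. e \<in> E \<Longrightarrow> D (M e) = ev e *\<^sub>R M e + \<mu> a (M e)" "\<And>e. e \<in> E \<Longrightarrow> low (ev e + gap) (M e - e)"
  shows "M = A a"
proof (rule blinfun_eqI_E)
  fix e assume e: "e \<in> E"
  have "M e - A a e = 0"
  proof (rule low_unique)
    show "D (M e - A a e) - ev e *\<^sub>R (M e - A a e) = \<mu> a (M e - A a e)"
      using D_A[of a e] eig[OF e] by (simp add: assms(1)[OF e] blinfun.diff_right blinfun.scaleR_right algebra_simps)
    show "low (ev e + gap) (M e - A a e)"
      using low_diff[OF assms(2)[OF e] low_A_diff[OF low_E[OF e]]] by simp
  qed
  then show "M e = A a e" by simp
qed

lemma A_0: "A 0 = id_blinfun"
  by (rule A_unique[symmetric]) (simp_all add: eig blinfun.zero_left blinfun.zero_right low_def)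

text \<open>For eigenvectors \<open>e\<close> and \<open>f\<close> both sides solve
  \<open>D v - l v = [a, v]\<close> with \<open>l = ev e + ev f\<close>, since \<open>D\<close> and
  \<open>ad a\<close> are derivations, and both have leading part \<open>\<mu> e f\<close>.\<close>

lemma A_hom: "A a (\<mu> x y) = \<mu> (A a x) (A a y)"
proof -
  have basis: "A a (\<mu> e f) = \<mu> (A a e) (A a f)" if e: "e \<in> E" and f: "f \<in> E" for e f
  proof -
    let ?v = "A a (\<mu> e f) - \<mu> (A a e) (A a f)" and ?l = "ev e + ev f"
    have der: "D (\<mu> u v) = \<mu> (D u) v + \<mu> u (D v)" "\<mu> a (\<mu> u v) = \<mu> (\<mu> a u) v + \<mu> u (\<mu> a v)" for u v
      using deriv ad_derivation[OF nil_skew[OF nil] nil_jacobi[OF nil]] unfolding derivation_def by blast+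
    have eigen: "D (\<mu> e f) = ?l *\<^sub>R \<mu> e f" by (rule bracket_eigen[OF eig[OF e] eig[OF f]])
    have "?v = 0"
    proof (rule low_unique)
      have "D (A a (\<mu> e f)) = ?l *\<^sub>R A a (\<mu> e f) + \<mu> a (A a (\<mu> e f))"
        by (simp only: D_A eigen blinfun.scaleR_right)
      moreover have "D (\<mu> (A a e) (A a f)) = ?l *\<^sub>R \<mu> (A a e) (A a f) + \<mu> a (\<mu> (A a e) (A a f))"
        by (simp add: der D_A eig[OF e] eig[OF f] blinfun.bilinear_simps scaleR_left_distrib)
      ultimately show "D ?v - ?l *\<^sub>R ?v = \<mu> a ?v"
        by (simp add: blinfun.diff_right scaleR_diff_right)
      have "low (?l + gap) (A a (\<mu> e f) - \<mu> e f)"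
        by (rule low_A_diff[OF low_eigenvector[OF eigen]])
      moreover have "low (?l + gap) (\<mu> (A a e - e) (A a f))"
        using low_bracket[OF low_A_diff[OF low_E[OF e]] low_A[OF low_E[OF f]], of a a] by (simp add: algebra_simps)
      moreover have "low (?l + gap) (\<mu> e (A a f - f))"
        using low_bracket[OF low_E[OF e] low_A_diff[OF low_E[OF f]], of a] by (simp add: algebra_simps)
      ultimately have "low (?l + gap) ((A a (\<mu> e f) - \<mu> e f) - (\<mu> (A a e - e) (A a f) + \<mu> e (A a f - f)))"
        by (rule low_diff[OF _ low_add])
      moreover have "(A a (\<mu> e f) - \<mu> e f) - (\<mu> (A a e - e) (A a f) + \<mu> e (A a f - f)) = ?v"
        by (simp add: blinfun.diff_left blinfun.diff_right)
      ultimately show "low (?l + gap) ?v" by (simp only:)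
    qed
    then show ?thesis by simp
  qed
  have "A a o\<^sub>L \<mu> e = \<mu> (A a e) o\<^sub>L A a" if "e \<in> E" for e
    by (rule blinfun_eqI_E) (simp add: basis that)
  then have e1: "A a (\<mu> e y) = \<mu> (A a e) (A a y)" if "e \<in> E" for e
    using that by (metis blinfun_apply_blinfun_compose)
  have "A a (\<mu> (\<Sum>e\<in>E. (x \<bullet> e) *\<^sub>R e) y) = \<mu> (A a (\<Sum>e\<in>E. (x \<bullet> e) *\<^sub>R e)) (A a y)"
    by (simp add: blinfun.sum_right blinfun.sum_left blinfun.bilinear_simps e1)
  then show ?thesis by (simp only: expand_E)
qed

text \<open>Origin of the group law: moving the automorphism \<open>A a\<close> past
  \<open>ad b\<close> turns it into \<open>ad (A a b)\<close>, so the composite solves the equation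
  for \<open>a + A a b\<close>, and solutions are unique.\<close>

lemma A_compose: "A a o\<^sub>L A b = A (a + A a b)"
proof (rule A_unique)
  fix e assume e: "e \<in> E"
  show "low (ev e + gap) ((A a o\<^sub>L A b) e - e)"
    using low_add[OF low_A[OF low_A_diff[OF low_E[OF e]]] low_A_diff[OF low_E[OF e]], of a b a]
    by (simp add: blinfun.diff_right)
  show "D ((A a o\<^sub>L A b) e) = ev e *\<^sub>R (A a o\<^sub>L A b) e + \<mu> (a + A a b) ((A a o\<^sub>L A b) e)"
    by (simp add: D_A A_hom blinfun.add_right blinfun.add_left eig[OF e] blinfun.scaleR_right)
qed

lemma A_A: "A a (A b x) = A (a + A a b) x"
  by (metis A_compose blinfun_apply_blinfun_compose)

lemma dir_deriv_A_apply: "dir_deriv (\<lambda>a. A a x) a c = dir_deriv A a c x"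
  by (rule dir_deriv_bounded_linear[OF blinfun.bounded_linear_left smooth_A])

lemma smooth_A_apply: "smooth_on UNIV (\<lambda>a. A a x)"
  by (rule smooth_blinfun_apply[OF smooth_A smooth_const])

text \<open>Differentiating \<open>D_A\<close> at \<open>0\<close> shows that the commutator of
  \<open>D\<close> with the derivative is \<open>ad (D b)\<close>. The operator \<open>ad b\<close>
  has the same commutator, and \<open>low_unique\<close> with \<open>a = 0\<close> identifies the
  two.\<close>

lemma dir_deriv_A_0: "dir_deriv A 0 (D b) = \<mu> b"
proof (rule blinfun_eqI_E)
  fix e assume e: "e \<in> E"
  let ?dA = "dir_deriv A 0 (D b)"
  have ad: "smooth_on UNIV (\<lambda>a. \<mu> a)" by (rule smooth_linear[OF blinfun.bounded_linear_right])
  have "dir_deriv (\<lambda>a. D (A a e)) 0 (D b) = dir_deriv (\<lambda>a. A a (D e) + \<mu> a (A a e)) 0 (D b)"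
    by (simp add: D_A)
  moreover have "dir_deriv (\<lambda>a. D (A a e)) 0 (D b) = D (?dA e)"
    by (simp add: dir_deriv_bounded_linear[OF blinfun.bounded_linear_right smooth_A_apply] dir_deriv_A_apply)
  moreover have "dir_deriv (\<lambda>a. A a (D e) + \<mu> a (A a e)) 0 (D b) = ?dA (D e) + \<mu> (D b) e"
    by (simp add: dir_deriv_add[OF smooth_A_apply smooth_blinfun_apply[OF ad smooth_A_apply]]
        dir_deriv_blinfun_apply[OF ad smooth_A_apply] dir_deriv_linear[OF blinfun.bounded_linear_right]
        dir_deriv_A_apply A_0 blinfun.zero_right blinfun.zero_left)
  ultimately have DdA: "D (?dA e) = ev e *\<^sub>R ?dA e + \<mu> (D b) e"
    by (simp add: eig[OF e] blinfun.scaleR_right)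
  have "dir_deriv (\<lambda>a. A a e - e) 0 (D b) \<in> {x. low (ev e + gap) x}"
    by (rule dir_deriv_in_subspace[OF smooth_diff[OF smooth_A_apply smooth_const] subspace_UNIV low_subspace])
      (auto intro: low_A_diff low_E e)
  then have low: "low (ev e + gap) (?dA e)"
    by (simp add: dir_deriv_diff[OF smooth_A_apply smooth_const] dir_deriv_A_apply)
  have "?dA e - \<mu> b e = 0"
  proof (rule low_unique[where a=0])
    have "D (\<mu> b e) = \<mu> (D b) e + ev e *\<^sub>R \<mu> b e"
      using deriv eig[OF e] unfolding derivation_def by (simp add: blinfun.scaleR_right)
    then show "D (?dA e - \<mu> b e) - ev e *\<^sub>R (?dA e - \<mu> b e) = \<mu> 0 (?dA e - \<mu> b e)"
      by (simp add: DdA blinfun.diff_right scaleR_diff_right blinfun.zero_right)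
    show "low (ev e + gap) (?dA e - \<mu> b e)"
      using low raises_ad e by (intro low_diff) (auto simp: raises_def)
  qed
  then show "?dA e = \<mu> b e" by simp
qed

lemma dir_deriv_A: "dir_deriv A a (A a (D b)) = A a o\<^sub>L \<mu> b"
proof -
  have tr: "smooth_on UNIV (\<lambda>c. a + A a c)"
    by (intro smooth_add smooth_const smooth_linear blinfun.bounded_linear_right)
  have "dir_deriv (\<lambda>c. A (a + A a c)) 0 (D b) = dir_deriv (\<lambda>c. A a o\<^sub>L A c) 0 (D b)"
    by (simp add: A_compose)
  moreover have "dir_deriv (\<lambda>c. A (a + A a c)) 0 (D b) = dir_deriv A a (A a (D b))"
    by (simp add: dir_deriv_compose[OF smooth_A tr] blinfun.zero_right
       dir_deriv_add[OF smooth_const smooth_linear[OF blinfun.bounded_linear_right]]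
       dir_deriv_linear[OF blinfun.bounded_linear_right])
  moreover have "dir_deriv (\<lambda>c. A a o\<^sub>L A c) 0 (D b) = A a o\<^sub>L \<mu> b"
    by (simp add: dir_deriv_bounded_linear[OF bounded_bilinear.bounded_linear_right[OF
          bounded_bilinear_blinfun_compose] smooth_A] dir_deriv_A_0)
  ultimately show ?thesis by simp
qed

section \<open>Inverses in the group\<close>

primrec pw :: "('b \<Rightarrow>\<^sub>L 'b) \<Rightarrow> nat \<Rightarrow> 'b \<Rightarrow>\<^sub>L 'b" where
  "pw N 0 = id_blinfun"
| "pw N (Suc k) = N o\<^sub>L pw N k"

text \<open>The Neumann series of the unipotent \<open>A a\<close>, finite for the same reason as
  the series of \<open>A\<close>.\<close>

definition Ai :: "'b \<Rightarrow> 'b \<Rightarrow>\<^sub>L 'b" where "Ai a = (\<Sum>k\<le>order. pw (id_blinfun - A a) k)"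

lemma smooth_Ai: "smooth_on UNIV Ai"
proof -
  have N: "smooth_on UNIV (\<lambda>a. id_blinfun - A a)" by (intro smooth_diff smooth_const smooth_A)
  have "smooth_on UNIV (\<lambda>a. pw (id_blinfun - A a) k)" for k
    by (induction k) (simp_all add: smooth_const smooth_blinfun_compose[OF N])
  then show ?thesis unfolding Ai_def[abs_def] by (intro smooth_sum)
qed

lemma A_Ai: "A a (Ai a x) = x"
proof -
  let ?N = "id_blinfun - A a"
  have N: "raises gap ?N"
    using raises_A[of a] low_scaleR[of _ _ "-1"] unfolding raises_def
    by (force simp: blinfun.diff_left)
  have pw: "raises (k * gap) (pw ?N k)" for k
  proof (induction k)
    case (Suc k)
    then show ?case using raises_compose[OF N Suc.IH] by (simp add: algebra_simps)
  qed (simp add: raises_id)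
  have z: "pw ?N order = 0" by (rule raises_order[OF pw])
  have "A a o\<^sub>L Ai a = (\<Sum>k\<le>order. pw ?N k - pw ?N (Suc k))"
    unfolding Ai_def
    by (rule blinfun_eqI) (simp add: blinfun.sum_left blinfun.sum_right blinfun.diff_left)
  also have "\<dots> = pw ?N 0 - pw ?N (Suc order)" by (rule sum_telescope)
  also have "\<dots> = id_blinfun" by (simp add: z blinfun_compose_simps)
  finally show ?thesis by (metis blinfun_apply_blinfun_compose blinfun_apply_id_blinfun)
qed

lemma Ai_A: "Ai a (A a x) = x"
proof -
  have "blinfun_apply (A a) \<circ> blinfun_apply (Ai a) = id" by (rule ext) (simp add: A_Ai)
  then have "blinfun_apply (Ai a) \<circ> blinfun_apply (A a) = id"
    using linear_inverse_left[OF linear_blinfun linear_blinfun] by metis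
  then show ?thesis by (metis comp_apply id_apply)
qed

lemma Ai_mult: "Ai (a + A a b) (A a x) = Ai b x"
proof -
  have "Ai (a + A a b) (A a (A b (Ai b x))) = Ai b x" by (simp only: A_A Ai_A)
  then show ?thesis by (simp only: A_Ai)
qed

lemma A_inverse: "A (- Ai a a) = Ai a"
proof -
  have "A a (A (- Ai a a) x) = x" for x
    by (simp add: A_A blinfun.minus_right A_Ai A_0)
  then show ?thesis by (intro blinfun_eqI) (metis Ai_A)
qed

definition Di :: "'b \<Rightarrow>\<^sub>L 'b" where "Di = Blinfun (\<lambda>x. \<Sum>e\<in>E. ((x \<bullet> e) / ev e) *\<^sub>R e)"

lemma Di_apply: "Di x = (\<Sum>e\<in>E. ((x \<bullet> e) / ev e) *\<^sub>R e)"
proof -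
  have "linear (\<lambda>x. \<Sum>e\<in>E. ((x \<bullet> e) / ev e) *\<^sub>R e)"
    by (intro linear_compose_sum ballI linearI)
      (simp_all add: inner_left_distrib add_divide_distrib scaleR_left_distrib)
  then show ?thesis by (simp add: Di_def Blinfun_linear)
qed

lemma D_Di: "D (Di x) = x"
proof -
  have "D (Di x) = (\<Sum>e\<in>E. ((x \<bullet> e) / ev e) *\<^sub>R D e)"
    by (simp add: Di_apply blinfun.sum_right blinfun.scaleR_right)
  also have "\<dots> = (\<Sum>e\<in>E. (x \<bullet> e) *\<^sub>R e)"
  proof (rule sum.cong[OF refl])
    fix e assume e: "e \<in> E"
    show "((x \<bullet> e) / ev e) *\<^sub>R D e = (x \<bullet> e) *\<^sub>R e"
      by (subst eig[OF e]) (use ev_pos[OF e] in simp)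
  qed
  finally show ?thesis by (simp only: expand_E)
qed

lemma Di_D: "Di (D x) = x"
proof -
  have "Di (D x) = (\<Sum>e\<in>E. (x \<bullet> e) *\<^sub>R e)"
    unfolding Di_apply by (rule sum.cong[OF refl]) (use D_inner_E ev_pos in force)
  then show ?thesis by (simp only: expand_E)
qed

lemma dir_deriv_Ai: "dir_deriv Ai a c = - (\<mu> (Di (Ai a c)) o\<^sub>L Ai a)"
proof (rule blinfun_eqI)
  fix x
  have c: "dir_deriv A a c = A a o\<^sub>L \<mu> (Di (Ai a c))"
    using dir_deriv_A[of a "Di (Ai a c)"] by (simp add: D_Di A_Ai)
  have "dir_deriv (\<lambda>a. Ai a o\<^sub>L A a) a c = dir_deriv (\<lambda>a. id_blinfun :: 'b \<Rightarrow>\<^sub>L 'b) a c"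
    by (rule arg_cong[where f="\<lambda>f. dir_deriv f a c"]) (intro ext blinfun_eqI, simp add: Ai_A)
  then have "((Ai a o\<^sub>L dir_deriv A a c) + (dir_deriv Ai a c o\<^sub>L A a)) (Ai a x) = 0"
    by (simp add: dir_deriv_blinfun_compose[OF smooth_Ai smooth_A])
  then show "dir_deriv Ai a c x = (- (\<mu> (Di (Ai a c)) o\<^sub>L Ai a)) x"
    by (simp add: c blinfun.add_left blinfun.minus_left A_Ai Ai_A eq_neg_iff_add_eq_0 add.commute)
qed

lemma D_Ai: "D (Ai a x) = Ai a (D x) - Ai a (\<mu> a x)"
proof -
  have "D x = A a (D (Ai a x)) + \<mu> a x" using D_A[of a "Ai a x"] by (simp add: A_Ai)
  then have "Ai a (D x) = Ai a (A a (D (Ai a x)) + \<mu> a x)" by simp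
  then show ?thesis by (simp add: blinfun.add_right Ai_A)
qed

text \<open>Lets the group restrict to the image of the Lie algebra. The component of
  \<open>A a e - e\<close> orthogonal to \<open>W\<close> is annihilated by \<open>D - ev e\<close>,
  as brackets lie in \<open>W\<close>, yet it only has degrees from \<open>ev e + gap\<close> on; so
  it is zero.\<close>

lemma A_diff_in:
  assumes W: "subspace W" "\<And>w. w \<in> W \<Longrightarrow> D w \<in> W" "\<And>x y. \<mu> x y \<in> W"
  shows "A a x - x \<in> W"
proof -
  define q where "q = id_blinfun - proj W"
  have q: "q z = z - proj W z" for z by (simp add: q_def blinfun.diff_left)
  have qW: "q z = 0 \<longleftrightarrow> z \<in> W" for z
    using proj_in[OF W(1), of z] proj_id[OF W(1), of z] by (auto simp: q)
  have Dq: "D (q z) = q (D z)" for z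
  proof -
    have "proj W (D z) = D (proj W z)"
    proof (rule proj_eqI[OF W(1)])
      show "D (proj W z) \<in> W" by (intro W(2) proj_in W(1))
      show "(D z - D (proj W z)) \<bullet> y = 0" if "y \<in> W" for y
        using proj_orthogonal[OF W(1) W(2)[OF that], of z] by (simp add: D_self_adjoint flip: blinfun.diff_right)
    qed
    then show ?thesis by (simp add: q blinfun.diff_right)
  qed
  have low_q: "low r z \<Longrightarrow> low r (q z)" for r z
  proof (erule low_expand)
    fix e assume e: "e \<in> E" "r \<le> ev e"
    have "D (q e) = ev e *\<^sub>R q e"
      unfolding Dq by (subst eig[OF e(1)]) (rule blinfun.scaleR_right)
    then show "low r (q e)" using low_mono[OF low_eigenvector] e(2) by blast
  qed
  have "q (A a e - e) = 0" if e: "e \<in> E" for e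
  proof (rule low_unique[where a=0])
    have "q (\<mu> a (A a e)) = 0" using qW W(3) by blast
    then show "D (q (A a e - e)) - ev e *\<^sub>R q (A a e - e) = \<mu> 0 (q (A a e - e))"
      using eig[OF e] by (simp add: Dq D_A blinfun.bilinear_simps algebra_simps)
    show "low (ev e + gap) (q (A a e - e))" by (intro low_q low_A_diff low_E e)
  qed
  then have "q o\<^sub>L (A a - id_blinfun) = 0"
    by (intro blinfun_eqI_E) (simp add: blinfun.diff_left)
  then have "q ((A a - id_blinfun) x) = 0" by (metis blinfun_apply_blinfun_compose blinfun.zero_left)
  then show ?thesis by (simp add: qW blinfun.diff_left)
qed

end

section \<open>The group structure on the given Lie algebra\<close>

locale soliton_group = graded_soliton \<mu> D E
  for \<mu> :: "'b::euclidean_space bracket" and D E +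
  fixes L :: "'a::euclidean_space set" and br :: "'a \<Rightarrow> 'a \<Rightarrow> 'a" and \<psi> :: "'a \<Rightarrow>\<^sub>L 'b"
  assumes nilp: "nilpotent_lie_algebra_on L br" and bm: "bracket_model L br \<psi> \<mu>"
begin

lemma L: "subspace L"
  by (rule model_subspace[OF nilp bm])

definition W :: "'b set" where "W = \<psi> ` L"

lemma W: "subspace W" unfolding W_def by (rule model_image_subspace[OF nilp bm])

lemma bracket_W: "\<mu> u v \<in> W" unfolding W_def by (rule model_bracket_in[OF nilp bm])

lemma D_W: "w \<in> W \<Longrightarrow> D w \<in> W"
  using model_Ric_in[OF nilp bm, of w] by (simp add: D_def blinfun.add_left subspace_add[OF W] flip: W_def)

lemma D_image: "D ` W = W"
proof (rule subspace_dim_equal)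
  show "subspace (D ` W)" by (rule linear_subspace_image[OF linear_blinfun W])
  have "inj_on D W" by (rule inj_on_inverseI[where g=Di]) (rule Di_D)
  then have "dim (D ` W) = dim W"
    by (intro dim_image_eq[OF linear_blinfun]) (simp add: span_eq_iff[THEN iffD2] W)
  then show "dim W \<le> dim (D ` W)" by simp
qed (use D_W W in auto)

lemma Di_W: "w \<in> W \<Longrightarrow> Di w \<in> W"
  using D_image Di_D by (metis imageE)

text \<open>Through \<open>\<phi>\<close> the group \<open>a * b = a + A a b\<close> on \<open>W\<close> becomes a group on \<open>L\<close> whose tangent
  bracket at \<open>0\<close> is \<open>br\<close>.\<close>

definition \<phi> :: "'a \<Rightarrow>\<^sub>L 'b" where "\<phi> = D o\<^sub>L \<psi>"

lemma \<phi>: "\<phi> x = D (\<psi> x)" by (simp add: \<phi>_def)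

lemma \<phi>_image: "\<phi> ` L = W"
  using D_image by (simp add: \<phi>_def W_def image_image)

lemma \<phi>_in: "x \<in> L \<Longrightarrow> \<phi> x \<in> W" using \<phi>_image by blast

lemma inj_\<phi>: "inj_on \<phi> L"
  using model_inj[OF nilp bm] Di_D unfolding inj_on_def \<phi> by metis

definition \<kappa> :: "'b \<Rightarrow>\<^sub>L 'a" where
  "\<kappa> = (SOME k :: 'b \<Rightarrow>\<^sub>L 'a. (\<forall>z. k z \<in> L) \<and> (\<forall>x\<in>L. k (\<phi> x) = x) \<and> (\<forall>w\<in>W. \<phi> (k w) = w))"

lemma \<kappa>_in: "\<kappa> z \<in> L" and \<kappa>_\<phi>: "x \<in> L \<Longrightarrow> \<kappa> (\<phi> x) = x" and \<phi>_\<kappa>: "w \<in> W \<Longrightarrow> \<phi> (\<kappa> w) = w"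
proof -
  have "\<exists>k :: 'b \<Rightarrow>\<^sub>L 'a. (\<forall>z. k z \<in> L) \<and> (\<forall>x\<in>L. k (\<phi> x) = x) \<and> (\<forall>w\<in>W. \<phi> (k w) = w)"
    using model_inverse[OF L inj_\<phi>] unfolding \<phi>_image by metis
  from someI_ex[OF this]
  show "\<kappa> z \<in> L" "x \<in> L \<Longrightarrow> \<kappa> (\<phi> x) = x" "w \<in> W \<Longrightarrow> \<phi> (\<kappa> w) = w"
    unfolding \<kappa>_def by blast+
qed

lemma A_W: "w \<in> W \<Longrightarrow> A a w \<in> W"
  using subspace_add[OF W A_diff_in[OF W D_W bracket_W, of a w]] by fastforce

lemma Ai_W: "w \<in> W \<Longrightarrow> Ai a w \<in> W"
  using subspace_diff[OF W _ A_diff_in[OF W D_W bracket_W, of a "Ai a w"], of w] by (simp add: A_Ai)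

definition mul :: "'a \<Rightarrow> 'a \<Rightarrow> 'a" where "mul x y = x + \<kappa> (A (\<phi> x) (\<phi> y))"

definition G :: "'a monoid" where "G = \<lparr>carrier = L, monoid.mult = mul, one = 0\<rparr>"

lemma G_simps: "carrier G = L" "x \<otimes>\<^bsub>G\<^esub> y = mul x y" "\<one>\<^bsub>G\<^esub> = 0"
  by (simp_all add: G_def)

lemma mul_in: "x \<in> L \<Longrightarrow> mul x y \<in> L"
  unfolding mul_def by (intro subspace_add L \<kappa>_in)

lemma \<phi>_mul: "y \<in> L \<Longrightarrow> \<phi> (mul x y) = \<phi> x + A (\<phi> x) (\<phi> y)"
  by (simp add: mul_def blinfun.add_right \<phi>_\<kappa> A_W \<phi>_in)

lemma eqI_\<phi>: "x \<in> L \<Longrightarrow> y \<in> L \<Longrightarrow> \<phi> x = \<phi> y \<Longrightarrow> x = y"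
  using inj_\<phi> by (rule inj_onD)

definition inverse_of :: "'a \<Rightarrow> 'a" where "inverse_of x = - \<kappa> (Ai (\<phi> x) (\<phi> x))"

lemma inverse_in: "inverse_of x \<in> L"
  unfolding inverse_of_def by (intro subspace_neg L \<kappa>_in)

lemma mul_inverse: "x \<in> L \<Longrightarrow> mul (inverse_of x) x = 0"
proof -
  assume x: "x \<in> L"
  have "\<phi> (inverse_of x) = - Ai (\<phi> x) (\<phi> x)"
    using x by (simp add: inverse_of_def blinfun.minus_right \<phi>_\<kappa> Ai_W \<phi>_in)
  then have "\<phi> (mul (inverse_of x) x) = \<phi> 0"
    by (simp add: \<phi>_mul[OF x] A_inverse blinfun.zero_right)
  then show ?thesis using x mul_in[OF inverse_in] subspace_0[OF L] by (intro eqI_\<phi>) auto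
qed

lemma group_G: "group G"
proof (rule groupI)
  fix x y z assume x: "x \<in> carrier G" and y: "y \<in> carrier G" and z: "z \<in> carrier G"
  then have mems: "x \<in> L" "y \<in> L" "z \<in> L" by (simp_all add: G_simps)
  show "x \<otimes>\<^bsub>G\<^esub> y \<in> carrier G" using mems by (simp add: G_simps mul_in)
  have "\<phi> (mul (mul x y) z) = \<phi> (mul x (mul y z))"
    using mems by (simp add: \<phi>_mul mul_in blinfun.add_right A_A)
  then show "x \<otimes>\<^bsub>G\<^esub> y \<otimes>\<^bsub>G\<^esub> z = x \<otimes>\<^bsub>G\<^esub> (y \<otimes>\<^bsub>G\<^esub> z)"
    using mems by (simp add: G_simps) (intro eqI_\<phi> mul_in)
next
  fix x assume "x \<in> carrier G"
  then have x: "x \<in> L" by (simp add: G_simps)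
  show "\<one>\<^bsub>G\<^esub> \<otimes>\<^bsub>G\<^esub> x = x"
    using x by (simp add: G_simps mul_def blinfun.zero_right A_0 \<kappa>_\<phi>)
  show "\<exists>y\<in>carrier G. y \<otimes>\<^bsub>G\<^esub> x = \<one>\<^bsub>G\<^esub>"
    using mul_inverse[OF x] inverse_in by (auto simp: G_simps)
qed (simp add: G_simps subspace_0[OF L])

lemma smooth_A_\<phi>: "smooth_on UNIV (\<lambda>x. A (\<phi> x))" and smooth_Ai_\<phi>: "smooth_on UNIV (\<lambda>x. Ai (\<phi> x))"
  by (rule smooth_compose[OF smooth_A smooth_linear[OF blinfun.bounded_linear_right]]
      smooth_compose[OF smooth_Ai smooth_linear[OF blinfun.bounded_linear_right]])+

lemma lie_group_G: "lie_group_on L G"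
  unfolding lie_group_on_def
proof (intro conjI L group_G G_simps(1))
  have "smooth_on UNIV (\<lambda>z. fst z + \<kappa> (A (\<phi> (fst z)) (\<phi> (snd z))))"
    by (intro smooth_add smooth_bounded_linear[OF blinfun.bounded_linear_right] smooth_blinfun_apply
        smooth_compose[OF smooth_A_\<phi> smooth_linear[OF bounded_linear_fst]] smooth_linear
        bounded_linear_fst bounded_linear_snd)
  then have "smooth_on (L \<times> L) (\<lambda>z. fst z + \<kappa> (A (\<phi> (fst z)) (\<phi> (snd z))))"
    by (rule smooth_on_subspace[OF subspace_Times[OF L L]])
  moreover have "(\<lambda>z. fst z + \<kappa> (A (\<phi> (fst z)) (\<phi> (snd z)))) = (\<lambda>(x, y). x \<otimes>\<^bsub>G\<^esub> y)"
    by (rule ext) (simp add: G_simps mul_def split_beta)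
  ultimately show "smooth_on (L \<times> L) (\<lambda>(x, y). x \<otimes>\<^bsub>G\<^esub> y)" by simp
  have "smooth_on UNIV inverse_of"
    unfolding inverse_of_def[abs_def]
    by (intro smooth_minus smooth_bounded_linear[OF blinfun.bounded_linear_right] smooth_blinfun_apply
        smooth_Ai_\<phi> smooth_linear blinfun.bounded_linear_right)
  then have "smooth_on L inverse_of" by (rule smooth_on_subspace[OF L])
  moreover have "inverse_of x = inv\<^bsub>G\<^esub> x" if "x \<in> L" for x
    using group.inv_equality[OF group_G, of "inverse_of x" x] that mul_inverse[OF that] inverse_in
    by (simp add: G_simps)
  ultimately show "smooth_on L (\<lambda>x. inv\<^bsub>G\<^esub> x)" by (rule smooth_on_cong[OF L])
qed

lemma left_translation: "left_translation_deriv G a x v = \<kappa> (A (\<phi> a) (\<phi> v))"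
proof -
  have bl: "bounded_linear (\<lambda>y. \<kappa> (A (\<phi> a) (\<phi> y)))"
    by (intro bounded_linear_compose[OF blinfun.bounded_linear_right] blinfun.bounded_linear_right)
  show ?thesis
    unfolding left_translation_deriv_def G_simps mul_def
    by (simp add: dir_deriv_add[OF smooth_const smooth_linear[OF bl]] dir_deriv_linear[OF bl])
qed

lemma dir_deriv_left_inv_field:
  assumes "u \<in> L" "v \<in> L"
  shows "dir_deriv (left_inv_field G u) 0 v = \<kappa> (\<mu> (\<psi> v) (D (\<psi> u)))"
proof -
  have 1: "smooth_on UNIV (\<lambda>x. A (\<phi> x) (\<phi> u))"
    by (intro smooth_blinfun_apply smooth_A_\<phi> smooth_const)
  have "dir_deriv (left_inv_field G u) 0 v = dir_deriv (\<lambda>x. \<kappa> (A (\<phi> x) (\<phi> u))) 0 v"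
    by (simp add: left_inv_field_def[abs_def] left_translation)
  also have "\<dots> = \<kappa> (dir_deriv (\<lambda>x. A (\<phi> x) (\<phi> u)) 0 v)"
    by (rule dir_deriv_bounded_linear[OF blinfun.bounded_linear_right 1])
  also have "dir_deriv (\<lambda>x. A (\<phi> x) (\<phi> u)) 0 v = dir_deriv (\<lambda>x. A (\<phi> x)) 0 v (\<phi> u)"
    by (rule dir_deriv_bounded_linear[OF blinfun.bounded_linear_left smooth_A_\<phi>])
  also have "dir_deriv (\<lambda>x. A (\<phi> x)) 0 v = \<mu> (\<psi> v)"
    by (simp add: dir_deriv_compose[OF smooth_A smooth_linear[OF blinfun.bounded_linear_right]]
        dir_deriv_linear[OF blinfun.bounded_linear_right] blinfun.zero_right)
      (simp add: \<phi> dir_deriv_A_0)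
  finally show ?thesis by (simp add: \<phi>)
qed

text \<open>The twist by \<open>D\<close> in \<open>\<phi>\<close> is absorbed here: in direction
  \<open>D u\<close> the derivative of \<open>A\<close> at \<open>0\<close> is \<open>ad u\<close>,
  so the tangent bracket on \<open>W\<close> sends \<open>(D u, D v)\<close> to
  \<open>D (\<mu> u v)\<close>.\<close>

lemma has_lie_algebra_G: "has_lie_algebra G L br"
  unfolding has_lie_algebra_def
proof (intro ballI)
  fix u v assume u: "u \<in> L" and v: "v \<in> L"
  have at0: "left_inv_field G w 0 = w" if "w \<in> L" for w
    using that by (simp add: left_inv_field_def left_translation blinfun.zero_right A_0 \<kappa>_\<phi>)
  have "vf_bracket (left_inv_field G u) (left_inv_field G v) \<one>\<^bsub>G\<^esub>
      = \<kappa> (\<mu> (\<psi> u) (D (\<psi> v))) - \<kappa> (\<mu> (\<psi> v) (D (\<psi> u)))"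
    using u v by (simp add: vf_bracket_def G_simps at0 dir_deriv_left_inv_field)
  also have "\<dots> = \<kappa> (D (\<mu> (\<psi> u) (\<psi> v)))"
    using deriv skewD[OF nil_skew[OF nil], of "\<psi> v" "D (\<psi> u)"] unfolding derivation_def
    by (simp add: blinfun.add_right blinfun.minus_right)
  also have "\<dots> = \<kappa> (\<phi> (br u v))" using model_hom[OF nilp bm u v] by (simp add: \<phi>)
  also have "\<dots> = br u v" by (rule \<kappa>_\<phi>[OF model_br_in[OF nilp bm u v]])
  finally show "vf_bracket (left_inv_field G u) (left_inv_field G v) \<one>\<^bsub>G\<^esub> = br u v" .
qed

section \<open>The left-invariant soliton metric\<close>

definition \<Theta> :: "'a \<Rightarrow> 'a \<Rightarrow>\<^sub>L 'b" where "\<Theta> x = Di o\<^sub>L (Ai (\<phi> x) o\<^sub>L \<phi>)"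
definition V :: "'a \<Rightarrow> 'b \<Rightarrow>\<^sub>L 'a" where "V x = \<kappa> o\<^sub>L (A (\<phi> x) o\<^sub>L D)"
definition g :: "'a \<Rightarrow> 'a \<Rightarrow> 'a \<Rightarrow> real" where "g x u v = \<Theta> x u \<bullet> \<Theta> x v"

lemma \<Theta>: "\<Theta> x a = Di (Ai (\<phi> x) (\<phi> a))" and V: "V x w = \<kappa> (A (\<phi> x) (D w))"
  by (simp_all add: \<Theta>_def V_def)

lemma smooth_\<Theta>: "smooth_on UNIV \<Theta>" and smooth_V: "smooth_on UNIV V"
  unfolding \<Theta>_def[abs_def] V_def[abs_def]
  by (intro smooth_blinfun_compose smooth_const smooth_Ai_\<phi> smooth_A_\<phi>)+

lemma dir_deriv_\<Theta>: "dir_deriv \<Theta> x a b = - Di (\<mu> (\<Theta> x a) (D (\<Theta> x b)))"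
proof -
  have sm: "smooth_on UNIV (\<lambda>x. Ai (\<phi> x) (\<phi> b))"
    by (intro smooth_blinfun_apply smooth_Ai_\<phi> smooth_const)
  have "dir_deriv \<Theta> x a b = dir_deriv (\<lambda>x. \<Theta> x b) x a"
    by (simp add: dir_deriv_bounded_linear[OF blinfun.bounded_linear_left smooth_\<Theta>])
  also have "\<dots> = Di (dir_deriv (\<lambda>x. Ai (\<phi> x) (\<phi> b)) x a)"
    unfolding \<Theta> by (rule dir_deriv_bounded_linear[OF blinfun.bounded_linear_right sm])
  also have "dir_deriv (\<lambda>x. Ai (\<phi> x) (\<phi> b)) x a = dir_deriv (\<lambda>x. Ai (\<phi> x)) x a (\<phi> b)"
    by (rule dir_deriv_bounded_linear[OF blinfun.bounded_linear_left smooth_Ai_\<phi>])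
  also have "dir_deriv (\<lambda>x. Ai (\<phi> x)) x a = dir_deriv Ai (\<phi> x) (\<phi> a)"
    by (simp add: dir_deriv_compose[OF smooth_Ai smooth_linear[OF blinfun.bounded_linear_right]]
        dir_deriv_linear[OF blinfun.bounded_linear_right])
  finally show ?thesis by (simp add: dir_deriv_Ai \<Theta> D_Di blinfun.minus_left blinfun.minus_right)
qed

lemma frame: "mc_frame L W \<mu> \<Theta> V g"
proof
  show "\<Theta> x a \<in> W" if "a \<in> L" for x a using that by (simp add: \<Theta> Di_W Ai_W \<phi>_in)
  show "V x w \<in> L" for x w by (simp add: V \<kappa>_in)
  show "V x (\<Theta> x a) = a" if "a \<in> L" for x a using that by (simp add: \<Theta> V D_Di A_Ai \<kappa>_\<phi>)
  show "\<Theta> x (V x w) = w" if "w \<in> W" for x w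
    using that by (simp add: \<Theta> V \<phi>_\<kappa> A_W D_W Ai_A Di_D)
  show "\<mu> z = 0" if "\<And>w. w \<in> W \<Longrightarrow> z \<bullet> w = 0" for z
    using that unfolding W_def by (rule model_support[OF nilp bm])
  show "dir_deriv \<Theta> x a b - dir_deriv \<Theta> x b a = - \<mu> (\<Theta> x a) (\<Theta> x b)" for x a b
  proof -
    have "dir_deriv \<Theta> x a b - dir_deriv \<Theta> x b a
        = - Di (\<mu> (\<Theta> x a) (D (\<Theta> x b)) - \<mu> (\<Theta> x b) (D (\<Theta> x a)))"
      by (simp add: dir_deriv_\<Theta> blinfun.diff_right)
    also have "\<mu> (\<Theta> x a) (D (\<Theta> x b)) - \<mu> (\<Theta> x b) (D (\<Theta> x a)) = D (\<mu> (\<Theta> x a) (\<Theta> x b))"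
      using deriv skewD[OF nil_skew[OF nil], of "\<Theta> x b" "D (\<Theta> x a)"] unfolding derivation_def by simp
    finally show ?thesis by (simp add: Di_D)
  qed
qed (simp_all add: L W smooth_\<Theta> smooth_V nil bracket_W g_def)

lemma riemannian_g: "riemannian_metric_on L g"
  unfolding riemannian_metric_on_def
proof (intro conjI ballI allI impI)
  show "smooth_on L (\<lambda>x. g x u v)" for u v
    unfolding g_def
    by (intro smooth_on_subspace[OF L] smooth_bilinear[OF bounded_bilinear_inner] smooth_blinfun_apply
        smooth_\<Theta> smooth_const)
  show "g x u v = g x v u" for x u v by (simp add: g_def inner_commute)
  show "g x (a *\<^sub>R u + b *\<^sub>R v) w = a * g x u w + b * g x v w" for x u v w a b
    by (simp add: g_def blinfun.bilinear_simps inner_left_distrib)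
  fix x u assume "x \<in> L" "u \<in> L" "u \<noteq> 0"
  then have "\<Theta> x u \<noteq> 0"
    using mc_frame.V_\<Theta>[OF frame, of x u] by (auto simp: blinfun.zero_right)
  then show "g x u u > 0" by (simp add: g_def)
qed

lemma left_invariant_g: "left_invariant_metric_on L G g"
  unfolding left_invariant_metric_on_def
proof (intro conjI riemannian_g ballI)
  fix a x u v assume mems: "a \<in> L" "x \<in> L" "u \<in> L" "v \<in> L"
  have "\<Theta> (mul a x) (\<kappa> (A (\<phi> a) (\<phi> w))) = \<Theta> x w" if "w \<in> L" for w
    using mems that by (simp add: \<Theta> \<phi>_\<kappa> A_W \<phi>_in \<phi>_mul Ai_mult)
  then show "g (a \<otimes>\<^bsub>G\<^esub> x) (left_translation_deriv G a x u) (left_translation_deriv G a x v) = g x u v"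
    using mems by (simp add: g_def G_simps left_translation)
qed

text \<open>The soliton field generates the automorphisms \<open>exp (t D / 2)\<close>, which are linear in this chart.\<close>

lemma ricci_soliton_g: "ricci_soliton_on L g"
  unfolding ricci_soliton_on_def
proof (intro conjI riemannian_g exI ballI)
  interpret F: mc_frame L W \<mu> \<Theta> V g by (rule frame)
  let ?X = "\<lambda>x. (1/2) *\<^sub>R \<kappa> (D (\<phi> x))"
  have blX: "bounded_linear ?X"
    by (intro bounded_linear_scaleR_right[THEN bounded_linear_compose]
        bounded_linear_compose[OF blinfun.bounded_linear_right] blinfun.bounded_linear_right)
  have X: "smooth_on UNIV ?X" by (rule smooth_linear[OF blX])
  have X_in: "?X x \<in> L" for x by (intro subspace_scale L \<kappa>_in)
  show "vector_field_on L ?X"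
    unfolding vector_field_on_def using smooth_on_subspace[OF L X] X_in by blast
  fix x u v assume mems: "x \<in> L" "u \<in> L" "v \<in> L"
  let ?y = "\<lambda>x. (1/2) *\<^sub>R Ai (\<phi> x) (\<phi> x)"
  have \<Theta>X: "\<Theta> z (?X z) = ?y z" if "z \<in> L" for z
  proof -
    have "\<Theta> z (?X z) = (1/2) *\<^sub>R Di (Ai (\<phi> z) (D (\<phi> z)))"
      using that by (simp add: \<Theta> blinfun.scaleR_right \<phi>_\<kappa> D_W \<phi>_in)
    also have "Ai (\<phi> z) (D (\<phi> z)) = D (Ai (\<phi> z) (\<phi> z))"
      by (simp add: D_Ai skew_self[OF nil_skew[OF nil]] blinfun.zero_right)
    finally show ?thesis by (simp add: Di_D)
  qed
  \<comment> \<open>The derivative of \<open>Ai\<close> contributes the bracket term with opposite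
    sign, leaving half of \<open>D\<close>.\<close>
  have \<tau>: "dir_deriv (\<lambda>y. \<Theta> y (?X y)) x a + \<mu> (\<Theta> x a) (\<Theta> x (?X x)) = (1/2) *\<^sub>R D (\<Theta> x a)"
    if "a \<in> L" for a
  proof -
    have lin: "smooth_on UNIV (\<lambda>x. \<phi> x)" by (rule smooth_linear[OF blinfun.bounded_linear_right])
    have "dir_deriv (\<lambda>y. \<Theta> y (?X y)) x a = dir_deriv ?y x a"
      by (rule dir_deriv_cong[OF L]) (use mems that \<Theta>X in auto)
    also have "\<dots> = (1/2) *\<^sub>R dir_deriv (\<lambda>x. Ai (\<phi> x) (\<phi> x)) x a"
      by (rule dir_deriv_bounded_linear[OF bounded_linear_scaleR_right smooth_blinfun_apply[OF smooth_Ai_\<phi> lin]])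
    also have "dir_deriv (\<lambda>x. Ai (\<phi> x) (\<phi> x)) x a = Ai (\<phi> x) (\<phi> a) + dir_deriv (\<lambda>x. Ai (\<phi> x)) x a (\<phi> x)"
      by (simp add: dir_deriv_blinfun_apply[OF smooth_Ai_\<phi> lin] dir_deriv_linear[OF blinfun.bounded_linear_right])
    also have "dir_deriv (\<lambda>x. Ai (\<phi> x)) x a = dir_deriv Ai (\<phi> x) (\<phi> a)"
      by (simp add: dir_deriv_compose[OF smooth_Ai lin] dir_deriv_linear[OF blinfun.bounded_linear_right])
    finally show ?thesis
      using \<Theta>X[OF mems(1)]
      by (simp add: dir_deriv_Ai \<Theta> D_Di blinfun.minus_left blinfun.scaleR_right scaleR_diff_right)
  qed
  have "lie_derivative_metric ?X g x u v = D (\<Theta> x u) \<bullet> \<Theta> x v"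
    unfolding F.lie_derivative_metric_eq[OF X X_in mems] \<tau>[OF mems(2)] \<tau>[OF mems(3)]
    by (simp add: D_self_adjoint)
  moreover have "D w = Ric \<mu> w + w" for w by (simp add: D_def blinfun.add_left)
  ultimately have "lie_derivative_metric ?X g x u v = Ric \<mu> (\<Theta> x u) \<bullet> \<Theta> x v + g x u v"
    by (simp only: g_def inner_left_distrib)
  then show "ricci_curvature L g x u v = - 1 * g x u v + lie_derivative_metric ?X g x u v"
    using F.ricci_curvature_eq[OF mems] by linarith
qed

lemma einstein_nilradical: "einstein_nilradical L br"
  unfolding einstein_nilradical_def nilsoliton_def
  using nilp lie_group_G has_lie_algebra_G left_invariant_g ricci_soliton_g by blast

end

theorem einstein_nilradical_if_soliton_model:
  fixes \<psi> :: "'a::euclidean_space \<Rightarrow>\<^sub>L 'b::euclidean_space"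
  assumes nilp: "nilpotent_lie_algebra_on L br" and model: "soliton_model L br \<psi> \<mu>"
  shows "einstein_nilradical L br"
proof -
  have bm: "bracket_model L br \<psi> \<mu>" and der: "derivation \<mu> (Ric \<mu> + id_blinfun)"
    using model by (simp_all add: soliton_model_def)
  define D where "D = Ric \<mu> + id_blinfun"
  obtain E where "orthonormal_eigenbasis D E"
    using exists_orthonormal_eigenbasis[of D]
    by (auto simp: D_def blinfun.add_left inner_left_distrib inner_right_distrib Ric_self_adjoint)
  then interpret soliton_group \<mu> D E L br \<psi>
    using der nilp bm model_nilpotent[OF nilp bm] by unfold_locales (simp_all add: D_def)
  show ?thesis by (rule einstein_nilradical)
qed

theorem soliton_model_if_einstein_nilradical:
  fixes L :: "'a::euclidean_space set"
  assumes "einstein_nilradical L br"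
  shows "\<exists>(\<psi> :: 'a \<Rightarrow>\<^sub>L 'a) \<mu>. soliton_model L br \<psi> \<mu>"
proof -
  obtain G g where "nilpotent_lie_algebra_on L br" "lie_group_on L G" "has_lie_algebra G L br"
    and sol: "left_invariant_metric_on L G g" "ricci_soliton_on L g"
    using assms unfolding einstein_nilradical_def nilsoliton_def by blast
  then interpret lie_group_frame L br G g by unfold_locales
  show ?thesis by (rule exists_soliton_model[OF sol(2)])
qed

section \<open>Direct sums of algebraic solitons\<close>

lemma sum_Basis_prod:
  "(\<Sum>i\<in>Basis. f i) = (\<Sum>i\<in>Basis. f (i, 0)) + (\<Sum>i\<in>Basis. f (0, i))"
  for f :: "'b::euclidean_space \<times> 'c::euclidean_space \<Rightarrow> 'd::comm_monoid_add"
  unfolding Basis_prod_def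
  by (subst sum.union_disjoint) (auto simp: sum.reindex inj_on_def)

context
  fixes \<mu>1 :: "'b::euclidean_space bracket" and \<mu>2 :: "'c::euclidean_space bracket"
begin

definition sum_bracket :: "('b \<times> 'c) bracket" where
  "sum_bracket = bracket_of (\<lambda>x y. (\<mu>1 (fst x) (fst y), \<mu>2 (snd x) (snd y)))"

lemma sum_bracket: "sum_bracket x y = (\<mu>1 (fst x) (fst y), \<mu>2 (snd x) (snd y))"
  unfolding sum_bracket_def
  by (rule bracket_of_apply; intro linearI; simp add: blinfun.bilinear_simps)

lemma adj_sum_bracket: "adj (sum_bracket z) x = (adj (\<mu>1 (fst z)) (fst x), adj (\<mu>2 (snd z)) (snd x))"
proof (rule vector_eq_rdot[THEN iffD1, rule_format])
  fix y
  show "adj (sum_bracket z) x \<bullet> y = (adj (\<mu>1 (fst z)) (fst x), adj (\<mu>2 (snd z)) (snd x)) \<bullet> y"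
    unfolding adj_left by (simp add: sum_bracket inner_prod_def adj_left)
qed

lemma Ric_sum_bracket: "Ric sum_bracket x = (Ric \<mu>1 (fst x), Ric \<mu>2 (snd x))"
proof (rule vector_eq_rdot[THEN iffD1, rule_format])
  fix y
  have "Ric sum_bracket x \<bullet> y = Ric \<mu>1 (fst x) \<bullet> fst y + Ric \<mu>2 (snd x) \<bullet> snd y"
    unfolding Ric_inner sum_Basis_prod
    by (simp add: adj_sum_bracket sum_bracket inner_prod_def blinfun.zero_right blinfun.zero_left adj_linear)
  then show "Ric sum_bracket x \<bullet> y = (Ric \<mu>1 (fst x), Ric \<mu>2 (snd x)) \<bullet> y"
    by (simp add: inner_prod_def)
qed

text \<open>The shared constant makes \<open>Ric + 1\<close> block diagonal with a derivation in
  each block.\<close>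

lemma derivation_sum_bracket:
  assumes "derivation \<mu>1 (Ric \<mu>1 + id_blinfun)" "derivation \<mu>2 (Ric \<mu>2 + id_blinfun)"
  shows "derivation sum_bracket (Ric sum_bracket + id_blinfun)"
  using assms by (simp add: derivation_def Ric_sum_bracket sum_bracket blinfun.add_left)

end

lemma direct_sum_commute: "direct_sum_of_ideals L br I J \<Longrightarrow> direct_sum_of_ideals L br J I"
  unfolding direct_sum_of_ideals_def by (auto simp: add.commute)

lemma nilpotent_ideal:
  assumes nilp: "nilpotent_lie_algebra_on L br" and I: "lie_ideal L br I"
  shows "nilpotent_lie_algebra_on I br"
proof -
  have sub: "subspace I" "I \<subseteq> L" and br: "\<And>x y. x \<in> L \<Longrightarrow> y \<in> I \<Longrightarrow> br x y \<in> I"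
    using I unfolding lie_ideal_def by blast+
  have lieL: "lie_algebra_on L br" using nilp by (simp add: nilpotent_lie_algebra_on_def)
  have lie: "lie_algebra_on I br"
    using lieL sub br unfolding lie_algebra_on_def subset_iff by (intro conjI ballI allI) blast+
  have mono: "lower_central_series I br k \<subseteq> lower_central_series L br k" for k
  proof (induction k)
    case (Suc k)
    show ?case unfolding lower_central_series.simps by (rule span_mono) (use Suc sub in blast)
  qed (use sub in simp)
  obtain k where "lower_central_series L br k = {0}" using nilp unfolding nilpotent_lie_algebra_on_def by blast
  then have "lower_central_series I br k = {0}"
    using mono[of k] subspace_0[OF subspace_lower_central_series[OF sub(1), of br k]] by blast
  then show ?thesis using lie unfolding nilpotent_lie_algebra_on_def by blast
qed

theorem soliton_model_direct_sum:
  fixes \<psi>1 :: "'a::euclidean_space \<Rightarrow>\<^sub>L 'b::euclidean_space" and \<psi>2 :: "'a \<Rightarrow>\<^sub>L 'c::euclidean_space"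
  assumes lie: "lie_algebra_on L br" and sum: "direct_sum_of_ideals L br I J"
    and m1: "soliton_model I br \<psi>1 \<mu>1" and m2: "soliton_model J br \<psi>2 \<mu>2"
  shows "\<exists>\<psi> :: 'a \<Rightarrow>\<^sub>L ('b \<times> 'c). soliton_model L br \<psi> (sum_bracket \<mu>1 \<mu>2)"
proof -
  have I: "lie_ideal L br I" "I \<subseteq> L" and J: "lie_ideal L br J" "J \<subseteq> L" and IJ: "I \<inter> J = {0}"
    using sum unfolding direct_sum_of_ideals_def lie_ideal_def by blast+
  obtain f :: "'a \<Rightarrow>\<^sub>L 'a" where f: "\<And>x. x \<in> L \<Longrightarrow> f x \<in> I" "\<And>x. x \<in> L \<Longrightarrow> x - f x \<in> J"
    "\<And>x. x \<in> I \<Longrightarrow> f x = x" "\<And>x. x \<in> J \<Longrightarrow> f x = 0"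
    using direct_sum_projection[OF lie sum] by blast
  define \<psi> where "\<psi> = Blinfun (\<lambda>x. (\<psi>1 (f x), \<psi>2 (x - f x)))"
  have \<psi>: "\<psi> x = (\<psi>1 (f x), \<psi>2 (x - f x))" for x
    unfolding \<psi>_def
    by (subst Blinfun_linear) (auto intro!: linearI simp: blinfun.bilinear_simps algebra_simps)
  have b1: "bracket_model I br \<psi>1 \<mu>1" and b2: "bracket_model J br \<psi>2 \<mu>2"
    using m1 m2 by (simp_all add: soliton_model_def)
  \<comment> \<open>A mixed bracket lies in both ideals.\<close>
  have cross: "br i j = 0" "br j i = 0" if "i \<in> I" "j \<in> J" for i j
    using ideal_bracket[OF lie I(1), of j i] ideal_bracket[OF lie J(1), of i j] that I J IJ by blast+
  have add: "br (x + x') z = br x z + br x' z" "br z (x + x') = br z x + br z x'"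
    if "x \<in> L" "x' \<in> L" "z \<in> L" for x x' z
  proof -
    have "br (1 *\<^sub>R x + 1 *\<^sub>R x') z = 1 *\<^sub>R br x z + 1 *\<^sub>R br x' z"
      "br z (1 *\<^sub>R x + 1 *\<^sub>R x') = 1 *\<^sub>R br z x + 1 *\<^sub>R br z x'"
      using lie that unfolding lie_algebra_on_def by blast+
    then show "br (x + x') z = br x z + br x' z" "br z (x + x') = br z x + br z x'" by simp_all
  qed
  have split: "br x y = br (f x) (f y) + br (x - f x) (y - f y)" if "x \<in> L" "y \<in> L" for x y
  proof -
    have m: "f x \<in> L" "x - f x \<in> L" "f y \<in> L" "y - f y \<in> L" using f that I J by blast+
    have "br x y = br (f x) y + br (x - f x) y" using add(1)[OF m(1,2) that(2)] by simp
    also have "br (f x) y = br (f x) (f y) + br (f x) (y - f y)" using add(2)[OF m(3,4) m(1)] by simp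
    also have "br (x - f x) y = br (x - f x) (f y) + br (x - f x) (y - f y)" using add(2)[OF m(3,4) m(2)] by simp
    finally show ?thesis using cross f that by simp
  qed
  have "bracket_model L br \<psi> (sum_bracket \<mu>1 \<mu>2)"
    unfolding bracket_model_def
  proof (intro conjI ballI allI impI)
    show "inj_on \<psi> L"
    proof (rule inj_onI)
      fix x y assume x: "x \<in> L" and y: "y \<in> L" and "\<psi> x = \<psi> y"
      then have "f x = f y" "x - f x = y - f y"
        using b1 b2 f x y unfolding bracket_model_def inj_on_def by (auto simp: \<psi>)
      then show "x = y" by simp
    qed
  next
    fix x y assume x: "x \<in> L" and y: "y \<in> L"
    have i: "br (f x) (f y) \<in> I" and j: "br (x - f x) (y - f y) \<in> J"
      using ideal_bracket(1)[OF lie I(1) subsetD[OF I(2) f(1)[OF x]] f(1)[OF y]]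
        ideal_bracket(1)[OF lie J(1) subsetD[OF J(2) f(2)[OF x]] f(2)[OF y]] by simp_all
    have fb: "f (br x y) = br (f x) (f y)"
      using f(3)[OF i] f(4)[OF j] by (simp add: split[OF x y] blinfun.add_right)
    then have "br x y - f (br x y) = br (x - f x) (y - f y)" by (simp add: split[OF x y])
    then show "\<psi> (br x y) = sum_bracket \<mu>1 \<mu>2 (\<psi> x) (\<psi> y)"
      using b1 b2 f x y fb unfolding bracket_model_def by (simp add: \<psi> sum_bracket)
  next
    fix z assume z: "\<forall>x\<in>L. z \<bullet> \<psi> x = 0"
    have "fst z \<bullet> \<psi>1 x = 0" if "x \<in> I" for x
      using z[rule_format, of x] that I f by (auto simp: \<psi> inner_prod_def blinfun.zero_right)
    moreover have "snd z \<bullet> \<psi>2 x = 0" if "x \<in> J" for x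
      using z[rule_format, of x] that J f by (auto simp: \<psi> inner_prod_def blinfun.zero_right)
    ultimately have 0: "\<mu>1 (fst z) = 0" "\<mu>2 (snd z) = 0" "\<And>w. \<mu>1 w (fst z) = 0" "\<And>w. \<mu>2 w (snd z) = 0"
      using b1 b2 unfolding bracket_model_def by blast+
    show "sum_bracket \<mu>1 \<mu>2 z = 0"
      by (rule blinfun_eqI) (simp add: sum_bracket 0 zero_prod_def)
    show "sum_bracket \<mu>1 \<mu>2 w z = 0" for w by (simp add: sum_bracket 0 zero_prod_def)
  qed
  then show ?thesis
    using derivation_sum_bracket m1 m2 unfolding soliton_model_def by blast
qed

theorem theorem3p5:
  fixes L N1 N2 :: "'a::euclidean_space set"
    and br :: "'a \<Rightarrow> 'a \<Rightarrow> 'a"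
  assumes "nilpotent_lie_algebra_on L br"
    and "direct_sum_of_ideals L br N1 N2"
  shows "einstein_nilradical L br \<longleftrightarrow> einstein_nilradical N1 br \<and> einstein_nilradical N2 br"
proof
  note nilp = assms(1) and sum = assms(2)
  have ideals: "lie_ideal L br N1" "lie_ideal L br N2"
    using sum unfolding direct_sum_of_ideals_def by blast+
  assume "einstein_nilradical L br"
  then obtain \<psi> :: "'a \<Rightarrow>\<^sub>L 'a" and \<mu> where "soliton_model L br \<psi> \<mu>"
    using soliton_model_if_einstein_nilradical by blast
  note summand = soliton_model_summand[OF nilp this]
  show "einstein_nilradical N1 br \<and> einstein_nilradical N2 br"
    using summand[OF sum] summand[OF direct_sum_commute[OF sum]]
      einstein_nilradical_if_soliton_model[OF nilpotent_ideal[OF nilp ideals(1)]]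
      einstein_nilradical_if_soliton_model[OF nilpotent_ideal[OF nilp ideals(2)]] by blast
next
  assume "einstein_nilradical N1 br \<and> einstein_nilradical N2 br"
  then obtain \<psi>1 \<psi>2 :: "'a \<Rightarrow>\<^sub>L 'a" and \<mu>1 \<mu>2
    where "soliton_model N1 br \<psi>1 \<mu>1" "soliton_model N2 br \<psi>2 \<mu>2"
    using soliton_model_if_einstein_nilradical by blast
  moreover have "lie_algebra_on L br" using assms(1) by (simp add: nilpotent_lie_algebra_on_def)
  \<comment> \<open>The joint model lives in \<open>'a \<times> 'a\<close>; models take values in an
    arbitrary Euclidean space for this reason.\<close>
  ultimately show "einstein_nilradical L br"
    using soliton_model_direct_sum[OF _ assms(2)] einstein_nilradical_if_soliton_model[OF assms(1)] by blast
qed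

end
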